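(* Let $n\ge 1$, let $\lambda_1,\dots,\lambda_n$ be complex numbers of unit modulus and let $A=\mathrm{diag}(\lambda_1,\dots,\lambda_n)$. Let $F:D_1\to\mathbb{C}^n$ be an analytic and univalent function such that $F(z)=Az+f(z)$ with $f(0)=0$ and $Df(0)=0$. Let $s>0$. Assume that $A$ is non-resonant and verifies the Bruno-$s$ condition (in the $n$-dimensional form, or, when $n=1$, in the one-dimensional form; both are given in the context). Then for all sufficiently small $0<r_{**}<1$ there exist positive constants $A_{**},B_{**},C_{**}$ such that for all $z_0\in\mathbb{C}^n$ with $0<|z_0|<r_{**}/2$, the $m$-th iterate $z_m=F^m(z_0)$ of $z_0$ by $F$ is well defined and verifies $$|z_m|=|F^m(z_0)|\le C_{**}\,r_{**}$$ for all integers $0\le m\le K_*$, where $$K_*=\Big\lfloor A_{**}^{-1}\exp\Big\{B_{**}\Big(\frac{r_{**}}{|z_0|}\Big)^{1/s}\Big\}\Big\rfloor .$$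
   Context: $\mathbb{N}$ denotes the non-negative integers. For $z\in\mathbb{C}^n$, $|z|=\max_{1\le i\le n}|z_i|$; $D_1=\{z\in\mathbb{C}^n: |z_i|<1,\ 1\le i\le n\}$ is the unit polydisk. For $\alpha\in\mathbb{N}^n$, $|\alpha|=\alpha_1+\dots+\alpha_n$ and $\lambda^\alpha=\lambda_1^{\alpha_1}\cdots\lambda_n^{\alpha_n}$. Univalent means injective. $F^m$ is the $m$-fold composition of $F$ with itself, and $\lfloor x\rfloor$ is the integer part of $x$. Non-resonant: $\lambda^\alpha-\lambda_j\ne 0$ for all $\alpha\in\mathbb{N}^n$ with $|\alpha|\ge 2$ and all $j\in\{1,\dots,n\}$. Small divisors: for non-resonant $\lambda_1,\dots,\lambda_n$ and integers $p\ge 3$, $$\Omega(p)=\min_{1\le j\le n}\ \inf_{\alpha\in\mathbb{N}^n,\ 2\le|\alpha|<p}|\lambda^\alpha-\lambda_j| .$$ Bruno-$s$ condition ($s>0$), $n$-dimensional form: there exists a strictly increasing sequence of positive integers $(p_k)_{k\ge 0}$, with $p_1\ge 3$, such that $$\limsup_{|\alpha|\to+\infty}\Big(2\sum_{m=0}^{\kappa(\alpha)}\frac{\log\Omega^{-1}(p_{m+1})}{p_m}-s\log|\alpha|\Big)<+\infty ,$$ where $\Omega^{-1}(p)=1/\Omega(p)$ and $\kappa(\alpha)$ is defined by $p_{\kappa(\alpha)}\le|\alpha|<p_{\kappa(\alpha)+1}$. Bruno-$s$ condition, one-dimensional form ($n=1$): $\lambda=e^{2\pi i\omega}$ with $\omega\in(0,1)\setminus\mathbb{Q}$,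 $(q_k)_{k\ge 0}$ are the denominators of the continued fraction convergents of $\omega$, and $$\limsup_{N\to+\infty}\Big(\sum_{j=0}^{k(N)}\frac{\log q_{j+1}}{q_j}-s\log N\Big)<+\infty ,$$ where $k(N)$ is defined by $q_{k(N)}\le N<q_{k(N)+1}$. *)

theory Defs
  imports "HOL-Analysis.Analysis"
begin

definition mi_order :: "('n::finite \<Rightarrow> nat) \<Rightarrow> nat" where
  "mi_order \<alpha> = (\<Sum>i\<in>UNIV. \<alpha> i)"

definition mi_power :: "complex ^ 'n::finite \<Rightarrow> ('n \<Rightarrow> nat) \<Rightarrow> complex" where
  "mi_power z \<alpha> = (\<Prod>i\<in>UNIV. (z $ i) ^ \<alpha> i)"

text \<open>Neither \<open>norm\<close> (Euclidean) nor \<open>infnorm\<close> (which separates real and imaginary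
  parts) is the maximum of the complex moduli.\<close>

definition maxnorm :: "complex ^ 'n::finite \<Rightarrow> real" where
  "maxnorm z = (MAX i. cmod (z $ i))"

definition unit_polydisk :: "(complex ^ 'n::finite) set" where
  "unit_polydisk = {z. \<forall>i. cmod (z $ i) < 1}"

text \<open>Analytic on an open set: every point has a polydisk on which the map is the sum of a
  (unconditionally) convergent power series with coefficients in \<open>\<complex>\<^sup>n\<close>.\<close>

definition mv_analytic_on ::
    "(complex ^ 'n::finite \<Rightarrow> complex ^ 'n) \<Rightarrow> (complex ^ 'n) set \<Rightarrow> bool" where
  "mv_analytic_on F S \<longleftrightarrow>
     (\<forall>a\<in>S. \<exists>\<rho>>0. \<exists>c :: ('n \<Rightarrow> nat) \<Rightarrow> complex ^ 'n. \<forall>z. maxnorm (z - a) < \<rho> \<longrightarrow>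
        ((\<lambda>\<alpha>. mi_power (z - a) \<alpha> *s c \<alpha>) has_sum F z) UNIV)"

definition diag_matrix :: "complex ^ 'n::finite \<Rightarrow> complex ^ 'n ^ 'n" where
  "diag_matrix l = (\<chi> i j. if i = j then l $ i else 0)"

definition non_resonant :: "complex ^ 'n::finite \<Rightarrow> bool" where
  "non_resonant l \<longleftrightarrow> (\<forall>\<alpha> j. mi_order \<alpha> \<ge> 2 \<longrightarrow> mi_power l \<alpha> - l $ j \<noteq> 0)"

definition Omega :: "complex ^ 'n::finite \<Rightarrow> nat \<Rightarrow> real" where
  "Omega l p =
     (MIN j. INF \<alpha>\<in>{\<alpha>. 2 \<le> mi_order \<alpha> \<and> mi_order \<alpha> < p}. cmod (mi_power l \<alpha> - l $ j))"

text \<open>For a non-decreasing unbounded \<open>p\<close> and \<open>N \<ge> p 0\<close> there is exactly one such \<open>k\<close>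
  (even if \<open>p\<close> has repeated values); the finitely many smaller \<open>N\<close> do not affect the
  upper limits below.\<close>

definition bracket_index :: "(nat \<Rightarrow> nat) \<Rightarrow> nat \<Rightarrow> nat" where
  "bracket_index p N = (THE k. p k \<le> N \<and> N < p (Suc k))"

definition bruno_cond :: "real \<Rightarrow> complex ^ 'n::finite \<Rightarrow> bool" where
  "bruno_cond s l \<longleftrightarrow>
     (\<exists>p :: nat \<Rightarrow> nat. strict_mono p \<and> (\<forall>k. p k > 0) \<and> p 1 \<ge> 3 \<and>
        Limsup (filtercomap mi_order at_top)
          (\<lambda>\<alpha> :: 'n \<Rightarrow> nat. ereal
             (2 * (\<Sum>m = 0..bracket_index p (mi_order \<alpha>). ln (1 / Omega l (p (m + 1))) / real (p m))
              - s * ln (real (mi_order \<alpha>)))) < \<infinity>)"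

text \<open>Complete quotients and partial quotients of the regular continued fraction
  \<open>\<omega> = [a\<^sub>0; a\<^sub>1, a\<^sub>2, \<dots>]\<close> of an irrational \<open>\<omega>\<close>.\<close>

fun cf_rem :: "real \<Rightarrow> nat \<Rightarrow> real" where
  "cf_rem \<omega> 0 = \<omega>"
| "cf_rem \<omega> (Suc k) = 1 / frac (cf_rem \<omega> k)"

definition cf_digit :: "real \<Rightarrow> nat \<Rightarrow> int" where
  "cf_digit \<omega> k = \<lfloor>cf_rem \<omega> k\<rfloor>"

text \<open>Denominators \<open>q\<^sub>k\<close> of the convergents \<open>[a\<^sub>0; a\<^sub>1, \<dots>, a\<^sub>k]\<close>; the digits \<open>a\<^sub>k\<close> with
  \<open>k \<ge> 1\<close> are positive, so \<open>nat\<close> does not truncate.\<close>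

fun cf_denom :: "real \<Rightarrow> nat \<Rightarrow> nat" where
  "cf_denom \<omega> 0 = 1"
| "cf_denom \<omega> (Suc 0) = nat (cf_digit \<omega> 1)"
| "cf_denom \<omega> (Suc (Suc k)) =
     nat (cf_digit \<omega> (Suc (Suc k))) * cf_denom \<omega> (Suc k) + cf_denom \<omega> k"

definition bruno_cond_1d :: "real \<Rightarrow> complex \<Rightarrow> bool" where
  "bruno_cond_1d s l \<longleftrightarrow>
     (\<exists>\<omega>. 0 < \<omega> \<and> \<omega> < 1 \<and> \<omega> \<notin> \<rat> \<and> l = exp (2 * of_real pi * \<i> * of_real \<omega>) \<and>
        limsup (\<lambda>N. ereal
          ((\<Sum>j = 0..bracket_index (cf_denom \<omega>) N.
              ln (real (cf_denom \<omega> (j + 1))) / real (cf_denom \<omega> j))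
           - s * ln (real N))) < \<infinity>)"

end

theory Submission
  imports Defs "HOL-Library.Multiset"
begin

text \<open>
  The formal solution \<open>h\<close> of \<open>F \<circ> h = h \<circ> A\<close>, \<open>h(w) = w + \<dots>\<close>, is a sum over trees whose inner nodes
  carry Taylor coefficients of \<open>F\<close> divided by small divisors \<open>\<lambda>\<^sup>\<alpha> - \<lambda>\<^sub>j\<close>, where \<open>\<alpha>\<close> counts the leaves below
  the node. Divisors of nested nodes cannot all be small; counting them (Bruno, Davie), the Bruno-\<open>s\<close>
  condition bounds the product of the inverse divisors in a tree with \<open>k\<close> leaves by \<open>c\<^sup>k k\<^sup>s\<^sup>k\<close>.

  Keeping only the trees with at most \<open>N\<close> leaves, one gets a polynomial map \<open>h\<close> close to the
  identity on a polydisk of radius \<open>\<rho>\<close> proportional to \<open>1 / N\<^sup>s\<close>, and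
  \<open>F (h w) - h (A w)\<close> is a sum over tuples of trees with more than \<open>N\<close> leaves in total (up to the Taylor
  remainder of \<open>F\<close>), hence of size \<open>2\<^sup>-\<^sup>N \<rho>\<close> for \<open>|w| \<le> \<rho> / 2\<close>. In the coordinate \<open>w\<close> an orbit drifts
  by at most that much at each step, so it stays inside for a time of order \<open>2\<^sup>N\<close>. The theorem
  follows with \<open>N\<close> proportional to \<open>|z\<^sub>0|\<^sup>-\<^sup>1\<^sup>/\<^sup>s\<close>.
\<close>

section \<open>Counting nodes of trees\<close>

text \<open>Why nested divisors compete: the leaves of a node t outside a node u below it form a
  monomial m. Up to a unimodular factor, the two divisors combine to lambda_u * m - lambda_t, which
  is again a divisor, of order one more than the difference of the sizes. Two nested nodes with
  small divisors must therefore differ in size by an amount that the smallness dictates.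

  The obstacle is the exponent, which has to come out as exactly s. The number of nodes with a small
  divisor, per leaf, needs the right leading constant: 2 / p_i in several dimensions, matching the
  factor 2 of the condition, and 1 / q_i in one dimension. Only errors that sum to O(1) per leaf are
  affordable; they end in the constant c.

  A bound of the form k^(s k) guarantees no radius of convergence, hence the truncation: for k <= N
  it is at most (N^s)^k, which is geometric. The gain 2^-N arises from evaluating at half the
  radius, where every leaf contributes a factor 1/2. The map h is never inverted as a whole; each
  step of an orbit is lifted separately by a fixed point argument.\<close>

datatype 'a tree = Leaf 'a | Node 'a "'a tree list"

fun root_label :: "'a tree \<Rightarrow> 'a" where
  "root_label (Leaf i) = i"
| "root_label (Node j ts) = j"

fun leaves :: "'a tree \<Rightarrow> 'a list" where
  "leaves (Leaf i) = [i]"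
| "leaves (Node j ts) = concat (map leaves ts)"

definition nleaves :: "'a tree \<Rightarrow> nat" where
  "nleaves t = length (leaves t)"

fun is_node :: "'a tree \<Rightarrow> bool" where
  "is_node (Leaf i) = False"
| "is_node (Node j ts) = True"

fun proper :: "'a tree \<Rightarrow> bool" where
  "proper (Leaf i) = True"
| "proper (Node j ts) = (2 \<le> length ts \<and> (\<forall>t\<in>set ts. proper t))"

fun node_count :: "('a tree \<Rightarrow> bool) \<Rightarrow> 'a tree \<Rightarrow> nat" where
  "node_count P (Leaf i) = 0"
| "node_count P (Node j ts) = (if P (Node j ts) then 1 else 0) + sum_list (map (node_count P) ts)"

fun max_sub :: "('a tree \<Rightarrow> bool) \<Rightarrow> 'a tree \<Rightarrow> 'a tree list" where
  "max_sub P (Leaf i) = []"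
| "max_sub P (Node j ts) = (if P (Node j ts) then [Node j ts] else concat (map (max_sub P) ts))"

lemma nleaves_Leaf [simp]: "nleaves (Leaf i) = 1"
  by (simp add: nleaves_def)

lemma nleaves_Node [simp]: "nleaves (Node j ts) = sum_list (map nleaves ts)"
  unfolding nleaves_def[abs_def] by (simp add: length_concat comp_def)

lemma sum_list_concat: "sum_list (concat xss) = sum_list (map sum_list xss)"
  for xss :: "'a::monoid_add list list"
  by (induction xss) auto

lemma length_le_sum_list:
  fixes f :: "'a \<Rightarrow> nat"
  assumes "\<And>t. t \<in> set ts \<Longrightarrow> 1 \<le> f t"
  shows "length ts \<le> sum_list (map f ts)"
  using assms
proof (induction ts)
  case (Cons a ts)
  then have "1 \<le> f a" "length ts \<le> sum_list (map f ts)" by auto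
  then show ?case by simp
qed simp

lemma nleaves_ge_1: "proper t \<Longrightarrow> 1 \<le> nleaves t"
proof (induction t)
  case (Node j ts)
  then have "length ts \<le> sum_list (map nleaves ts)"
    by (intro length_le_sum_list) auto
  with Node.prems show ?case by simp
qed simp

lemma nleaves_node_ge_2: "proper t \<Longrightarrow> is_node t \<Longrightarrow> 2 \<le> nleaves t"
proof (cases t)
  case (Node j ts)
  assume "proper t" "is_node t"
  with Node have "length ts \<le> sum_list (map nleaves ts)"
    by (intro length_le_sum_list) (auto intro: nleaves_ge_1[unfolded One_nat_def])
  with Node \<open>proper t\<close> show ?thesis by simp
qed simp

lemma length_le_lv_Node: "proper (Node j ts) \<Longrightarrow> length ts \<le> nleaves (Node j ts)"
  unfolding nleaves_Node by (intro length_le_sum_list) (auto intro: nleaves_ge_1[unfolded One_nat_def])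

lemma nleaves_child_less:
  assumes "proper (Node j ts)" "t \<in> set ts"
  shows "nleaves t < nleaves (Node j ts)"
proof -
  obtain us vs where ts: "ts = us @ t # vs" using assms(2) by (meson split_list)
  have "length (us @ vs) \<le> sum_list (map nleaves (us @ vs))"
    by (rule length_le_sum_list) (use assms ts in \<open>auto intro: nleaves_ge_1[unfolded One_nat_def]\<close>)
  moreover have "length (us @ vs) \<ge> 1" using assms ts by simp
  ultimately have "0 < sum_list (map nleaves (us @ vs))" by linarith
  then show ?thesis unfolding nleaves_Node by (simp add: ts del: sum_list_eq_0_iff)
qed

lemma mset_leaves_child:
  assumes "t \<in> set ts"
  shows "mset (leaves t) \<subseteq># mset (leaves (Node j ts))"
proof -
  obtain us vs where ts: "ts = us @ t # vs" using assms by (meson split_list)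
  show ?thesis by (simp add: ts)
qed

lemma nleaves_eq_size: "nleaves t = size (mset (leaves t))"
  by (simp add: nleaves_def)

lemma max_sub_props:
  assumes "proper t" "u \<in> set (max_sub P t)"
  shows "P u \<and> proper u \<and> is_node u \<and> mset (leaves u) \<subseteq># mset (leaves t)"
  using assms
proof (induction t)
  case (Node j ts)
  show ?case
  proof (cases "P (Node j ts)")
    case False
    then obtain t where t: "t \<in> set ts" "u \<in> set (max_sub P t)"
      using Node.prems by auto
    with Node show ?thesis
      using mset_leaves_child[OF t(1), of j] subset_mset.order_trans
      by (metis proper.simps(2))
  qed (use Node in auto)
qed simp

text \<open>Every counted node lies in the subtree of a topmost one. The count can be restarted
  there, so the induction only compares a bad node with the nearest bad ones below it.\<close>

lemma node_count_max_sub: "node_count P t = sum_list (map (node_count P) (max_sub P t))"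
proof (induction t)
  case (Node j ts)
  then have "map (node_count P) ts = map (\<lambda>t. sum_list (map (node_count P) (max_sub P t))) ts"
    by (intro map_cong) auto
  then have "sum_list (map (node_count P) ts) =
      sum_list (map (\<lambda>t. sum_list (map (node_count P) (max_sub P t))) ts)"
    by (rule arg_cong)
  then show ?case
    by (simp add: map_concat comp_def sum_list_concat)
qed simp

lemma nleaves_max_sub: "sum_list (map nleaves (max_sub P t)) \<le> nleaves t"
proof (induction t)
  case (Node j ts)
  then have "sum_list (map (\<lambda>t. sum_list (map nleaves (max_sub P t))) ts) \<le> sum_list (map nleaves ts)"
    by (intro sum_list_mono) auto
  then show ?case
    by (simp add: map_concat comp_def sum_list_concat)
qed simp

text \<open>Every proper tree with \<open>k\<close> leaves has at most \<open>count_bound q M k\<close> bad nodes. In several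
  dimensions this is used with \<open>q = 0\<close>: then \<open>1 / q = 0\<close>, and a divisibility by \<open>q\<close> of a
  positive number is impossible.\<close>

definition count_bound :: "nat \<Rightarrow> real \<Rightarrow> nat \<Rightarrow> real" where
  "count_bound q M k = real (k - 1) / real q + (if real k \<ge> M then 2 * real k / M - 1 else 0)"

text \<open>Only entries of size at least \<open>M\<close> reach the second part, each with its own
  \<open>- 1\<close>; how many there are decides the inductive step. The first part stays a single
  natural number so that divisibility by \<open>q\<close> can be applied to it.\<close>

lemma sum_list_count_bound:
  assumes "\<And>x. x \<in> set xs \<Longrightarrow> 1 \<le> x"
  shows "sum_list (map (count_bound q M) xs) =
    real (sum_list (map (\<lambda>x. x - 1) xs)) / real q
    + (2 * real (sum_list (filter (\<lambda>x. real x \<ge> M) xs)) / M - real (length (filter (\<lambda>x. real x \<ge> M) xs)))"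
  using assms
proof (induction xs)
  case (Cons a xs)
  then have "1 \<le> a" by simp
  moreover have "sum_list (map (\<lambda>x. x - 1) (a # xs)) = (a - 1) + sum_list (map (\<lambda>x. x - 1) xs)" by simp
  ultimately show ?case using Cons
    by (simp only: of_nat_add add_divide_distrib)
      (simp add: count_bound_def add_divide_distrib ring_distribs)
qed simp

lemma sum_list_filter_le: "sum_list (filter P xs) \<le> sum_list (xs :: nat list)"
  by (induction xs) auto

lemma sum_list_diff_1:
  assumes "\<And>x. x \<in> set xs \<Longrightarrow> 1 \<le> (x::nat)"
  shows "sum_list (map (\<lambda>x. x - 1) xs) + length xs = sum_list xs"
  using assms
proof (induction xs)
  case (Cons a xs)
  then have "1 \<le> a" "sum_list (map (\<lambda>x. x - 1) xs) + length xs = sum_list xs" by auto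
  then show ?case by simp
qed simp

text \<open>The terms \<open>x - 1\<close> lose one per entry, which keeps their sum below
  \<open>k - 1\<close>. A large entry forces \<open>k\<close> to be large, and its
  \<open>- 1\<close> pays for that of \<open>k\<close>; without large entries the second part for
  \<open>k\<close> is still nonnegative.\<close>

lemma count_bound_superadditive:
  assumes M: "M > 0" and xs: "\<And>x. x \<in> set xs \<Longrightarrow> 1 \<le> x" and k: "sum_list xs \<le> k" "1 \<le> k"
  shows "sum_list (map (count_bound q M) xs) \<le> count_bound q M k"
proof -
  define ls where "ls = filter (\<lambda>x. real x \<ge> M) xs"
  have eq: "sum_list (map (count_bound q M) xs) =
    real (sum_list (map (\<lambda>x. x - 1) xs)) / real q + (2 * real (sum_list ls) / M - real (length ls))"
    unfolding ls_def by (rule sum_list_count_bound[OF xs])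
  have "sum_list (map (\<lambda>x. x - 1) xs) \<le> k - 1"
  proof (cases xs)
    case (Cons a ys)
    then have "1 \<le> length xs" by simp
    then show ?thesis using sum_list_diff_1[of xs, OF xs] k by linarith
  qed simp
  then have 1: "real (sum_list (map (\<lambda>x. x - 1) xs)) / real q \<le> real (k - 1) / real q"
    by (intro divide_right_mono of_nat_mono) auto
  have ls_le: "sum_list ls \<le> k" using sum_list_filter_le[of _ xs] k unfolding ls_def
    by (meson order_trans)
  show ?thesis
  proof (cases "ls = []")
    case True
    have "real k \<ge> M \<Longrightarrow> 2 * real k / M - 1 \<ge> 0" using M by (simp add: field_simps)
    then show ?thesis using eq 1 True by (auto simp: count_bound_def)
  next
    case False
    then obtain x where x: "x \<in> set ls" by (cases ls) auto
    then have "real x \<ge> M" by (auto simp: ls_def)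
    moreover have "x \<le> k" using x ls_le member_le_sum_list order_trans by blast
    ultimately have kM: "real k \<ge> M" by linarith
    have "2 * real (sum_list ls) / M \<le> 2 * real k / M"
      using M ls_le by (intro divide_right_mono mult_left_mono) auto
    moreover have "length ls \<ge> 1" using False by (cases ls) auto
    ultimately show ?thesis using eq 1 kM by (simp add: count_bound_def)
  qed
qed

lemma multiple_step:
  fixes q a b :: nat
  assumes "q dvd a" "q dvd b" "a < b"
  shows "real a / real q + 1 \<le> real b / real q"
proof -
  obtain u v where uv: "a = q * u" "b = q * v" using assms by (auto elim!: dvdE)
  then have "q > 0" "u < v" using assms by (auto intro: Nat.gr0I)
  then show ?thesis using uv by simp
qed

lemma dvd_sum_list_diff_1:
  "(\<And>x. x \<in> set xs \<Longrightarrow> (q::nat) dvd x - 1) \<Longrightarrow> q dvd sum_list (map (\<lambda>x. x - 1) xs)"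
  by (induction xs) auto

text \<open>The inductive step for a bad node with \<open>k\<close> leaves whose maximal bad proper descendants have
  sizes \<open>xs\<close>. If exactly one of them is large, the remaining ones and the node itself are paid
  for by the size difference: it is either at least \<open>M / 2\<close> or, being a multiple of \<open>q\<close>, leaves
  room for one more multiple.\<close>

lemma count_bound_bad:
  assumes M: "M > 0" and xs: "\<And>x. x \<in> set xs \<Longrightarrow> 1 \<le> x" and k: "sum_list xs \<le> k" "2 \<le> k"
    and less: "\<And>x. x \<in> set xs \<Longrightarrow> x < k"
    and small_k: "real k < M \<Longrightarrow> q dvd k - 1"
    and small: "\<And>x. x \<in> set xs \<Longrightarrow> real x < M \<Longrightarrow> q dvd x - 1"
    and large: "\<And>x. x \<in> set xs \<Longrightarrow> real x \<ge> M \<Longrightarrow> real (k - x) \<ge> M / 2 \<or> q dvd k - x"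
  shows "1 + sum_list (map (count_bound q M) xs) \<le> count_bound q M k"
proof -
  define ls where "ls = filter (\<lambda>x. real x \<ge> M) xs"
  define S where "S = sum_list (map (\<lambda>x. x - 1) xs)"
  have eq: "sum_list (map (count_bound q M) xs) =
    real S / real q + (2 * real (sum_list ls) / M - real (length ls))"
    unfolding ls_def S_def by (rule sum_list_count_bound[OF xs])
  have S: "S + length xs = sum_list xs" unfolding S_def by (rule sum_list_diff_1[OF xs])
  have ls_le: "sum_list ls \<le> k" using sum_list_filter_le[of _ xs] k unfolding ls_def
    by (meson order_trans)
  \<comment> \<open>A single descendant is smaller than \<open>k\<close>, and two or more lose at
    least 2 through the terms \<open>x - 1\<close>.\<close>
  have S_less: "S < k - 1"
  proof (cases xs)
    case (Cons x ys)
    show ?thesis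
    proof (cases ys)
      case Nil
      then show ?thesis using Cons less[of x] xs[of x] by (auto simp: S_def)
    next
      case (Cons y zs)
      then show ?thesis using S k \<open>xs = x # ys\<close> by simp
    qed
  qed (use k in \<open>simp add: S_def\<close>)
  have Sq: "real S / real q \<le> real (k - 1) / real q"
    using S_less by (intro divide_right_mono of_nat_mono) auto
  show ?thesis
  proof (cases "real k < M")
    case True
    then have sm: "\<And>x. x \<in> set xs \<Longrightarrow> real x < M" using less by fastforce
    then have "ls = []" by (force simp: ls_def filter_empty_conv)
    moreover have "q dvd S" unfolding S_def using small sm by (intro dvd_sum_list_diff_1) auto
    ultimately show ?thesis
      using eq True multiple_step[OF _ small_k[OF True] S_less] by (simp add: count_bound_def)
  next
    case kM: False
    then have kM2: "2 * real k / M \<ge> 2" using M by (simp add: field_simps)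
    have cb: "count_bound q M k = real (k - 1) / real q + (2 * real k / M - 1)"
      using kM by (simp add: count_bound_def)
    \<comment> \<open>The bad node itself costs 1. With no large descendant,
      \<open>2 * k / M - 1\<close> is at least 1 and pays; with two or more, their surplus
      \<open>- 1\<close> pays. One large descendant is the critical case.\<close>
    consider "ls = []" | x where "ls = [x]" | x y zs where "ls = x # y # zs"
      by (metis list.exhaust)
    then show ?thesis
    proof cases
      case 1
      then show ?thesis using eq Sq cb kM2 by simp
    next
      case 2
      obtain us vs where us_vs: "xs = us @ x # vs" "\<forall>u\<in>set us. \<not> real u \<ge> M"
          "[] = filter (\<lambda>x. real x \<ge> M) vs"
        using 2 unfolding ls_def filter_eq_Cons_iff by blast
      have split: "xs = us @ x # vs" "\<And>u. u \<in> set (us @ vs) \<Longrightarrow> real u < M"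
        using us_vs filter_empty_conv[of "\<lambda>x. real x \<ge> M" vs] by auto
      have x: "x \<in> set xs" "real x \<ge> M" proof -
        have "x \<in> set ls" using 2 by simp
        then show "x \<in> set xs" "real x \<ge> M" by (auto simp: ls_def)
      qed
      define S' where "S' = sum_list (map (\<lambda>x. x - 1) (us @ vs))"
      have SS': "S = S' + (x - 1)" by (simp add: S_def S'_def split(1))
      have q': "q dvd S'" unfolding S'_def
        using small split by (intro dvd_sum_list_diff_1) auto
      have *: "S' + length (us @ vs) = sum_list (us @ vs)" unfolding S'_def
        by (rule sum_list_diff_1) (use xs split in auto)
      have **: "sum_list (us @ vs) + x \<le> k" using k(1) split(1) by simp
      have S'_less: "S' < k - x" 
        using * ** less[OF x(1)] by (cases "us @ vs") auto
      have eqx: "real (k - 1) = real (k - x) + real (x - 1)" using less[OF x(1)] xs[OF x(1)] by simp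
      have main: "1 + real S' / real q + 2 * real x / M \<le> real (k - x) / real q + 2 * real k / M"
      proof (cases "q dvd k - x")
        case True
        have "2 * real x / M \<le> 2 * real k / M"
          using M less[OF x(1)] by (intro divide_right_mono) auto
        then show ?thesis using multiple_step[OF q' True S'_less] by simp
      next
        case False
        then have "real (k - x) \<ge> M / 2" using large[OF x] by simp
        then have "(M + 2 * real x) / M \<le> 2 * real k / M"
          using M less[OF x(1)] by (intro divide_right_mono) (auto simp: of_nat_diff)
        then have "1 + 2 * real x / M \<le> 2 * real k / M"
          using M by (simp add: add_divide_distrib)
        moreover have "real S' / real q \<le> real (k - x) / real q"
          using S'_less by (intro divide_right_mono) auto
        ultimately show ?thesis by simp
      qed
      show ?thesis using main 2 unfolding eq cb SS' eqx by (simp add: add_divide_distrib)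
    next
      case 3
      have "2 * real (sum_list ls) / M \<le> 2 * real k / M"
        using M ls_le by (intro divide_right_mono mult_left_mono) auto
      moreover have "real (length ls) \<ge> 2" using 3 by simp
      ultimately show ?thesis using Sq unfolding eq cb by linarith
    qed
  qed
qed

text \<open>Induction on the number of leaves: the topmost \<open>P\<close>-nodes strictly below the
  root carry the rest of the count, and the root adds 1 or 0. Nesting enters only as inclusion of
  leaf multisets, because a divisor depends on nothing but the leaf multiset and the root
  label.\<close>

lemma node_count_le_count_bound:
  assumes M: "M > 0" and "proper t"
    and small: "\<And>t. proper t \<Longrightarrow> is_node t \<Longrightarrow> P t \<Longrightarrow> real (nleaves t) < M \<Longrightarrow> q dvd nleaves t - 1"
    and nested: "\<And>t u. proper t \<Longrightarrow> is_node t \<Longrightarrow> proper u \<Longrightarrow> is_node u \<Longrightarrow> P t \<Longrightarrow> P u \<Longrightarrow>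
        mset (leaves u) \<subseteq># mset (leaves t) \<Longrightarrow> nleaves u < nleaves t \<Longrightarrow>
        real (nleaves t - nleaves u) \<ge> M / 2 \<or> q dvd nleaves t - nleaves u"
  shows "real (node_count P t) \<le> count_bound q M (nleaves t)"
  using \<open>proper t\<close>
proof (induction "nleaves t" arbitrary: t rule: less_induct)
  case less
  show ?case
  proof (cases t)
    case (Leaf i)
    then show ?thesis using M by (auto simp: count_bound_def field_simps)
  next
    case (Node j ts)
    define us where "us = concat (map (max_sub P) ts)"
    have us: "P u \<and> proper u \<and> is_node u \<and> mset (leaves u) \<subseteq># mset (leaves t) \<and> nleaves u < nleaves t"
      if u: "u \<in> set us" for u
    proof -
      obtain v where v: "v \<in> set ts" "u \<in> set (max_sub P v)" using u by (auto simp: us_def)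
      then have "proper v" using less.prems Node by simp
      note p = max_sub_props[OF this v(2)]
      then have "nleaves u \<le> nleaves v" by (simp add: nleaves_eq_size size_mset_mono del: size_mset)
      then show ?thesis
        using p v nleaves_child_less[of j ts v] mset_leaves_child[OF v(1), of j] less.prems Node
        by (auto intro: subset_mset.order_trans)
    qed
    have sum: "sum_list (map (node_count P) ts) = sum_list (map (node_count P) us)"
      unfolding us_def by (simp add: map_concat comp_def sum_list_concat node_count_max_sub[symmetric])
    have lvs: "sum_list (map nleaves us) \<le> nleaves t"
      unfolding us_def Node
      by (simp add: map_concat comp_def sum_list_concat nleaves_max_sub sum_list_mono)
    have "real (sum_list (map (node_count P) us)) = sum_list (map (\<lambda>u. real (node_count P u)) us)"
      by (induction us) auto
    also have "\<dots> \<le> sum_list (map (\<lambda>u. count_bound q M (nleaves u)) us)"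
      using us less.hyps by (intro sum_list_mono) auto
    also have "\<dots> = sum_list (map (count_bound q M) (map nleaves us))" by (simp add: comp_def)
    finally have le: "real (sum_list (map (node_count P) us)) \<le> sum_list (map (count_bound q M) (map nleaves us))" .
    have ge1: "\<And>x. x \<in> set (map nleaves us) \<Longrightarrow> 1 \<le> x" using us nleaves_ge_1 by auto
    have t2: "2 \<le> nleaves t" using nleaves_node_ge_2[OF less.prems] Node by simp
    show ?thesis
    proof (cases "P t")
      case True
      have "1 + sum_list (map (count_bound q M) (map nleaves us)) \<le> count_bound q M (nleaves t)"
      proof (rule count_bound_bad[OF M ge1 lvs t2])
        show "q dvd nleaves t - 1" if "real (nleaves t) < M"
          using small[OF less.prems _ True that] Node by simp
        show "q dvd x - 1" if "x \<in> set (map nleaves us)" "real x < M" for x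
          using that us small by auto
        show "real (nleaves t - x) \<ge> M / 2 \<or> q dvd nleaves t - x" if x: "x \<in> set (map nleaves us)" for x
        proof -
          obtain u where u: "u \<in> set us" "x = nleaves u" using x by auto
          have "is_node t" using Node by simp
          from nested[OF less.prems this _ _ True] us[OF u(1)] show ?thesis unfolding u(2) by blast
        qed
      qed (use us in auto)
      then show ?thesis using le sum True Node by simp
    next
      case False
      have "sum_list (map (count_bound q M) (map nleaves us)) \<le> count_bound q M (nleaves t)"
        using t2 by (intro count_bound_superadditive[OF M ge1 lvs]) auto
      then show ?thesis using le sum False Node by simp
    qed
  qed
qed

lemma count_bound_le: "M > 0 \<Longrightarrow> count_bound q M k \<le> real k * (1 / real q + 2 / M)"
proof -
  assume "M > 0"
  have "real (k - 1) / real q \<le> real k / real q" by (intro divide_right_mono) auto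
  moreover have "0 \<le> 2 * real k / M" using \<open>M > 0\<close> by simp
  ultimately show ?thesis by (auto simp: count_bound_def ring_distribs mult.commute)
qed

section \<open>The logarithm of a product of inverse divisors, split by levels of smallness\<close>

definition monom_eval :: "complex ^ 'n \<Rightarrow> 'n list \<Rightarrow> complex" where
  "monom_eval z xs = prod_list (map (\<lambda>i. z $ i) xs)"

definition divisor :: "complex ^ 'n \<Rightarrow> 'n tree \<Rightarrow> real" where
  "divisor l t = cmod (monom_eval l (leaves t) - l $ root_label t)"

fun cost :: "complex ^ 'n \<Rightarrow> 'n tree \<Rightarrow> real" where
  "cost l (Leaf i) = 0"
| "cost l (Node j ts) = - ln (divisor l (Node j ts)) + sum_list (map (cost l) ts)"

text \<open>Branching is at least binary, so a bounded cost per node is a bounded cost per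
  leaf.\<close>

lemma node_count_True: "proper t \<Longrightarrow> node_count (\<lambda>_. True) t < nleaves t"
proof (induction t)
  case (Node j ts)
  have "sum_list (map (node_count (\<lambda>_. True)) ts) + length ts
      = sum_list (map (\<lambda>t. Suc (node_count (\<lambda>_. True) t)) ts)"
    by (induction ts) auto
  also have "\<dots> \<le> sum_list (map nleaves ts)"
    using Node by (intro sum_list_mono) (auto simp: Suc_le_eq)
  finally show ?case using Node.prems by simp
qed simp

text \<open>Writing the logarithm as a telescoping sum over the thresholds makes a constant factor in
  \<open>\<tau>\<close> cost only \<open>O(1)\<close> per node. Paying it once per level instead would cost \<open>\<Sum> 1 / p\<^sub>i\<close>, which may
  diverge and would spoil the exponent \<open>s\<close>.\<close>

lemma neg_ln_le_levels:
  fixes \<tau> :: "nat \<Rightarrow> real"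
  assumes "\<And>i. \<tau> i > 0" and "d \<ge> \<tau> (Suc K)" and anti: "\<And>i. \<tau> (Suc i) \<le> \<tau> i"
  shows "- ln d \<le> - ln (\<tau> 1) + (\<Sum>i=1..K. if d < \<tau> i then ln (\<tau> i) - ln (\<tau> (Suc i)) else 0)"
  using assms(2)
proof (induction K)
  case 0
  then show ?case using assms(1)[of 1] by simp
next
  case (Suc K)
  have mono: "ln (\<tau> (Suc i)) \<le> ln (\<tau> i)" for i using assms(1) anti by (meson ln_le_cancel_iff)
  show ?case
  proof (cases "d < \<tau> (Suc K)")
    case False
    then have "- ln d \<le> - ln (\<tau> 1) + (\<Sum>i=1..K. if d < \<tau> i then ln (\<tau> i) - ln (\<tau> (Suc i)) else 0)"
      using Suc.IH by simp
    then show ?thesis using False by simp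
  next
    case True
    have anti': "\<tau> j \<le> \<tau> i" if "i \<le> j" for i j
      using that anti by (rule lift_Suc_antimono_le[rotated])
    have "(\<Sum>i=1..Suc K. if d < \<tau> i then ln (\<tau> i) - ln (\<tau> (Suc i)) else 0)
        = (\<Sum>i=1..Suc K. ln (\<tau> i) - ln (\<tau> (Suc i)))"
    proof (rule sum.cong[OF refl])
      fix i assume "i \<in> {1..Suc K}"
      then have "\<tau> (Suc K) \<le> \<tau> i" by (intro anti') auto
      then show "(if d < \<tau> i then ln (\<tau> i) - ln (\<tau> (Suc i)) else 0) = ln (\<tau> i) - ln (\<tau> (Suc i))"
        using True by simp
    qed
    also have "\<dots> = ln (\<tau> 1) - ln (\<tau> (Suc (Suc K)))"
      by (induction K) auto
    finally have "(\<Sum>i=1..Suc K. if d < \<tau> i then ln (\<tau> i) - ln (\<tau> (Suc i)) else 0)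
        = ln (\<tau> 1) - ln (\<tau> (Suc (Suc K)))" .
    moreover have "- ln d \<le> - ln (\<tau> (Suc (Suc K)))"
      using Suc.prems assms(1)[of "Suc (Suc K)"] by simp
    ultimately show ?thesis by linarith
  qed
qed

text \<open>The estimate for one divisor, summed over all nodes: each level counts the nodes below
  its threshold. The cap \<open>n\<close> on sizes is there because the lowest threshold bounds
  divisors only up to a certain order.\<close>

lemma cost_le_levels:
  fixes \<tau> :: "nat \<Rightarrow> real"
  assumes pos: "\<And>i. \<tau> i > 0" and anti: "\<And>i. \<tau> (Suc i) \<le> \<tau> i"
    and lower: "\<And>t. proper t \<Longrightarrow> is_node t \<Longrightarrow> nleaves t \<le> n \<Longrightarrow> divisor l t \<ge> \<tau> (Suc K)"
    and "proper t" "nleaves t \<le> n"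
  shows "cost l t \<le> - ln (\<tau> 1) * real (node_count (\<lambda>_. True) t)
    + (\<Sum>i=1..K. (ln (\<tau> i) - ln (\<tau> (Suc i))) * real (node_count (\<lambda>t. divisor l t < \<tau> i) t))"
  using assms(4,5)
proof (induction t)
  case (Node j ts)
  define R where "R t = - ln (\<tau> 1) * real (node_count (\<lambda>_. True) t)
    + (\<Sum>i=1..K. (ln (\<tau> i) - ln (\<tau> (Suc i))) * real (node_count (\<lambda>t. divisor l t < \<tau> i) t))" for t
  have R_sum: "sum_list (map R ts) = - ln (\<tau> 1) * real (sum_list (map (node_count (\<lambda>_. True)) ts))
    + (\<Sum>i=1..K. (ln (\<tau> i) - ln (\<tau> (Suc i))) *
         real (sum_list (map (node_count (\<lambda>t. divisor l t < \<tau> i)) ts)))"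
    by (induction ts) (auto simp: R_def ring_distribs sum.distrib)
  have "sum_list (map (cost l) ts) \<le> sum_list (map R ts)"
  proof (intro sum_list_mono)
    fix t assume t: "t \<in> set ts"
    have "nleaves t \<le> n" using nleaves_child_less[OF Node.prems(1) t] Node.prems(2) by simp
    then show "cost l t \<le> R t" unfolding R_def using Node t by auto
  qed
  moreover have "- ln (divisor l (Node j ts)) \<le> - ln (\<tau> 1)
      + (\<Sum>i=1..K. if divisor l (Node j ts) < \<tau> i then ln (\<tau> i) - ln (\<tau> (Suc i)) else 0)"
    using Node.prems by (intro neg_ln_le_levels pos anti lower) auto
  moreover have "R (Node j ts) = (- ln (\<tau> 1)
      + (\<Sum>i=1..K. if divisor l (Node j ts) < \<tau> i then ln (\<tau> i) - ln (\<tau> (Suc i)) else 0))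
      + sum_list (map R ts)"
  proof -
    have "(ln (\<tau> i) - ln (\<tau> (Suc i))) * real (node_count (\<lambda>t. divisor l t < \<tau> i) (Node j ts))
      = (if divisor l (Node j ts) < \<tau> i then ln (\<tau> i) - ln (\<tau> (Suc i)) else 0)
        + (ln (\<tau> i) - ln (\<tau> (Suc i))) *
           real (sum_list (map (node_count (\<lambda>t. divisor l t < \<tau> i)) ts))" for i
      by (simp add: ring_distribs)
    then show ?thesis unfolding R_sum
      by (simp add: R_def[of "Node j ts"] sum.distrib ring_distribs)
  qed
  ultimately show ?case unfolding R_def by simp
qed simp

text \<open>Common to both forms of the condition. In several dimensions it is applied with
  \<open>M i = p i\<close> and \<open>q i = 0\<close>, in one dimension with the denominators
  \<open>q i\<close> and \<open>M i = q (Suc i) / 14\<close>.\<close>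

lemma cost_le:
  fixes \<tau> M :: "nat \<Rightarrow> real" and q :: "nat \<Rightarrow> nat"
  assumes pos: "\<And>i. \<tau> i > 0" and anti: "\<And>i. \<tau> (Suc i) \<le> \<tau> i" and M: "\<And>i. M i > 0"
    and lower: "\<And>t. proper t \<Longrightarrow> is_node t \<Longrightarrow> nleaves t \<le> n \<Longrightarrow> divisor l t \<ge> \<tau> (Suc K)"
    and small: "\<And>i t. 1 \<le> i \<Longrightarrow> proper t \<Longrightarrow> is_node t \<Longrightarrow> divisor l t < \<tau> i \<Longrightarrow>
        real (nleaves t) < M i \<Longrightarrow> q i dvd nleaves t - 1"
    and nested: "\<And>i t u. 1 \<le> i \<Longrightarrow> proper t \<Longrightarrow> is_node t \<Longrightarrow> proper u \<Longrightarrow> is_node u \<Longrightarrow>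
        divisor l t < \<tau> i \<Longrightarrow> divisor l u < \<tau> i \<Longrightarrow>
        mset (leaves u) \<subseteq># mset (leaves t) \<Longrightarrow> nleaves u < nleaves t \<Longrightarrow>
        real (nleaves t - nleaves u) \<ge> M i / 2 \<or> q i dvd nleaves t - nleaves u"
    and t: "proper t" "nleaves t \<le> n"
  shows "cost l t \<le> real (nleaves t) *
    (\<bar>ln (\<tau> 1)\<bar> + (\<Sum>i=1..K. (ln (\<tau> i) - ln (\<tau> (Suc i))) * (1 / real (q i) + 2 / M i)))"
proof -
  have mono: "ln (\<tau> (Suc i)) \<le> ln (\<tau> i)" for i using pos anti by (meson ln_le_cancel_iff)
  have "cost l t \<le> - ln (\<tau> 1) * real (node_count (\<lambda>_. True) t)
    + (\<Sum>i=1..K. (ln (\<tau> i) - ln (\<tau> (Suc i))) * real (node_count (\<lambda>t. divisor l t < \<tau> i) t))"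
    by (rule cost_le_levels[OF pos anti lower t])
  also have "\<dots> \<le> \<bar>ln (\<tau> 1)\<bar> * real (nleaves t)
    + (\<Sum>i=1..K. (ln (\<tau> i) - ln (\<tau> (Suc i))) * (real (nleaves t) * (1 / real (q i) + 2 / M i)))"
  proof (intro add_mono sum_mono mult_left_mono)
    have "- ln (\<tau> 1) * real (node_count (\<lambda>_. True) t) \<le> \<bar>ln (\<tau> 1)\<bar> * real (node_count (\<lambda>_. True) t)"
      by (intro mult_right_mono) auto
    also have "\<dots> \<le> \<bar>ln (\<tau> 1)\<bar> * real (nleaves t)"
      using node_count_True[OF t(1)] by (intro mult_left_mono) auto
    finally show "- ln (\<tau> 1) * real (node_count (\<lambda>_. True) t) \<le> \<bar>ln (\<tau> 1)\<bar> * real (nleaves t)" .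
  next
    fix i assume "i \<in> {1..K}"
    then have i: "1 \<le> i" by simp
    have "real (node_count (\<lambda>t. divisor l t < \<tau> i) t) \<le> count_bound (q i) (M i) (nleaves t)"
      by (rule node_count_le_count_bound[OF M t(1) small[OF i] nested[OF i]])
    then show "real (node_count (\<lambda>t. divisor l t < \<tau> i) t) \<le> real (nleaves t) * (1 / real (q i) + 2 / M i)"
      using count_bound_le[OF M] order_trans by blast
  qed (use mono in auto)
  also have "\<dots> = real (nleaves t) *
    (\<bar>ln (\<tau> 1)\<bar> + (\<Sum>i=1..K. (ln (\<tau> i) - ln (\<tau> (Suc i))) * (1 / real (q i) + 2 / M i)))"
    by (subst distrib_left, subst sum_distrib_left) (simp only: mult.commute mult.left_commute)
  finally show ?thesis .
qed

section \<open>The Bruno condition in several dimensions\<close>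

lemma monom_eval_Nil [simp]: "monom_eval z [] = 1"
  and monom_eval_Cons [simp]: "monom_eval z (i # xs) = z $ i * monom_eval z xs"
  and monom_eval_append: "monom_eval z (xs @ ys) = monom_eval z xs * monom_eval z ys"
  by (simp_all add: monom_eval_def)

lemma mi_power_add_one:
  "mi_power z (\<lambda>j. \<alpha> j + (if j = i then 1 else 0)) = z $ i * mi_power z \<alpha>"
  by (simp add: mi_power_def power_add prod.distrib if_distrib[of "\<lambda>n. _ ^ n"] prod.delta' cong: if_cong)

lemma mi_order_add_one: "mi_order (\<lambda>j. \<alpha> j + (if j = i then 1 else 0)) = Suc (mi_order \<alpha>)"
  by (simp add: mi_order_def sum.distrib)

lemma count_Cons: "count (mset (i # xs)) = (\<lambda>j. count (mset xs) j + (if j = i then 1 else 0))"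
  by (auto simp: fun_eq_iff)

text \<open>Links words, which fit lists of children and leaves, to the exponents used in the
  hypotheses.\<close>

lemma monom_eval_eq_mi_power: "monom_eval z xs = mi_power z (count (mset xs))"
  by (induction xs) (simp_all add: mi_power_def[of _ "\<lambda>_. 0"] count_Cons mi_power_add_one del: mset.simps(2))

lemma mi_order_count: "mi_order (count (mset xs)) = length xs"
  by (induction xs) (simp_all add: mi_order_def[of "\<lambda>_. 0"] count_Cons mi_order_add_one del: mset.simps(2))

lemma monom_eval_cong_mset: "mset xs = mset ys \<Longrightarrow> monom_eval z xs = monom_eval z ys"
  by (simp add: monom_eval_eq_mi_power)

lemma ex_word: "\<exists>xs. count (mset xs) = \<alpha>" for \<alpha> :: "'n::finite \<Rightarrow> nat"
proof -
  obtain xs where "mset xs = Abs_multiset \<alpha>" using ex_mset by blast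
  then have "count (mset xs) = \<alpha>" by (simp add: Abs_multiset_inverse)
  then show ?thesis ..
qed

lemma norm_monom_eval: "(\<And>i. cmod (l $ i) = 1) \<Longrightarrow> cmod (monom_eval l xs) = 1"
  by (induction xs) (auto simp: norm_mult)

text \<open>With b, m, and b * m the monomials of the leaves of u, of the other leaves of t, and of
  all leaves of t: lambda_u * m - lambda_t = (lambda_u - b) * m + (b * m - lambda_t), and m has
  modulus 1.\<close>

lemma nested_divisors:
  assumes unit: "\<And>i. cmod (l $ i) = 1" and "mset (leaves u) \<subseteq># mset (leaves t)"
  obtains xs where "length xs = nleaves t - nleaves u"
    "cmod (monom_eval l (root_label u # xs) - l $ root_label t) \<le> divisor l u + divisor l t"
proof -
  obtain C where C: "mset (leaves t) = mset (leaves u) + C"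
    using assms(2) by (auto simp: mset_subset_eq_exists_conv)
  obtain xs where xs: "mset xs = C" using ex_mset by blast
  have "mset (leaves t) = mset (leaves u @ xs)" using C xs by simp
  note eq = monom_eval_cong_mset[OF this, of l] mset_eq_length[OF this]
  have "monom_eval l (root_label u # xs) - l $ root_label t =
      (l $ root_label u - monom_eval l (leaves u)) * monom_eval l xs + (monom_eval l (leaves t) - l $ root_label t)"
    unfolding eq by (simp add: monom_eval_append algebra_simps)
  also have "cmod \<dots> \<le> cmod ((l $ root_label u - monom_eval l (leaves u)) * monom_eval l xs)
      + cmod (monom_eval l (leaves t) - l $ root_label t)"
    by (rule norm_triangle_ineq)
  also have "\<dots> = divisor l u + divisor l t"
    by (simp add: divisor_def norm_mult norm_monom_eval[OF unit] norm_minus_commute)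
  finally show ?thesis using that[of xs] eq(2) by (simp add: nleaves_def)
qed

lemma finite_mi_order: "finite {\<alpha> :: 'n::finite \<Rightarrow> nat. mi_order \<alpha> < p}"
proof (rule finite_subset)
  show "{\<alpha> :: 'n \<Rightarrow> nat. mi_order \<alpha> < p} \<subseteq> PiE UNIV (\<lambda>_. {..<p})"
  proof (safe, simp_all)
    fix \<alpha> :: "'n \<Rightarrow> nat" and i
    assume "mi_order \<alpha> < p"
    moreover have "\<alpha> i \<le> mi_order \<alpha>" unfolding mi_order_def by (rule member_le_sum) auto
    ultimately show "\<alpha> i < p" by simp
  qed
qed (intro finite_PiE, auto)

lemma ex_mi_order: "\<exists>\<alpha> :: 'n::finite \<Rightarrow> nat. mi_order \<alpha> = n"
  using mi_order_count[of "replicate n (undefined::'n)"] by (metis length_replicate)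

lemma Omega_le:
  assumes "2 \<le> length xs" "length xs < p"
  shows "Omega l p \<le> cmod (monom_eval l xs - l $ j)"
proof -
  let ?S = "{\<alpha>. 2 \<le> mi_order \<alpha> \<and> mi_order \<alpha> < p}"
  have "Omega l p \<le> (INF \<alpha>\<in>?S. cmod (mi_power l \<alpha> - l $ j))"
    unfolding Omega_def by (intro Min_le) auto
  also have "\<dots> \<le> cmod (mi_power l (count (mset xs)) - l $ j)"
    using assms by (intro cINF_lower bdd_belowI2[where m = 0]) (auto simp: mi_order_count)
  finally show ?thesis by (simp add: monom_eval_eq_mi_power)
qed

text \<open>Only finitely many exponents compete, and \<open>3 \<le> p\<close> admits those of order
  2, so the infimum is a minimum. Positivity then follows from non-resonance.\<close>

lemma Omega_attained:
  fixes l :: "complex ^ 'a::finite"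
  assumes "3 \<le> p"
  obtains \<alpha> j where "2 \<le> mi_order \<alpha>" "mi_order \<alpha> < p" "Omega l p = cmod (mi_power l \<alpha> - l $ j)"
proof -
  let ?S = "{\<alpha> :: 'a \<Rightarrow> nat. 2 \<le> mi_order \<alpha> \<and> mi_order \<alpha> < p}"
  define I where "I j = (INF \<alpha>\<in>?S. cmod (mi_power l \<alpha> - l $ j))" for j
  have "Omega l p \<in> range I" unfolding Omega_def I_def by (intro Min_in) auto
  then obtain j where j: "Omega l p = I j" by auto
  have fin: "finite ?S" by (rule finite_subset[OF _ finite_mi_order[of p]]) auto
  obtain \<alpha> :: "'a \<Rightarrow> nat" where \<alpha>: "mi_order \<alpha> = 2" using ex_mi_order by blast
  have "\<alpha> \<in> ?S" using assms \<alpha> by simp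
  then have ne: "?S \<noteq> {}" by blast
  have "I j = Min ((\<lambda>\<alpha>. cmod (mi_power l \<alpha> - l $ j)) ` ?S)"
    unfolding I_def using fin ne by (intro cInf_eq_Min) auto
  also have "\<dots> \<in> (\<lambda>\<alpha>. cmod (mi_power l \<alpha> - l $ j)) ` ?S"
    using fin ne by (intro Min_in) auto
  finally show ?thesis using that j by auto
qed

lemma Omega_pos: "non_resonant l \<Longrightarrow> 3 \<le> p \<Longrightarrow> Omega l p > 0"
  by (metis Omega_attained non_resonant_def zero_less_norm_iff)

lemma Omega_antimono:
  assumes "3 \<le> p" "p \<le> p'"
  shows "Omega l p' \<le> Omega l p"
proof -
  obtain \<alpha> j where \<alpha>: "2 \<le> mi_order \<alpha>" "mi_order \<alpha> < p" "Omega l p = cmod (mi_power l \<alpha> - l $ j)"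
    using Omega_attained[OF assms(1)] by metis
  obtain xs where xs: "count (mset xs) = \<alpha>" using ex_word by blast
  have "Omega l p' \<le> cmod (monom_eval l xs - l $ j)"
    using \<alpha> assms mi_order_count[of xs] xs by (intro Omega_le) auto
  then show ?thesis using \<alpha> xs by (simp add: monom_eval_eq_mi_power)
qed

text \<open>Dirichlet's argument: two powers of a point on the unit circle come close.\<close>

lemma unit_power_near:
  fixes z :: complex
  assumes "cmod z = 1"
  obtains m where "2 \<le> m" "cmod (z ^ m - z) < 1"
proof -
  have "bounded (range (\<lambda>n. z ^ n))"
    by (rule boundedI[where B = 1]) (auto simp: norm_power assms)
  then obtain r :: "nat \<Rightarrow> nat" and w where r: "strict_mono r" "((\<lambda>n. z ^ n) \<circ> r) \<longlonglongrightarrow> w"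
    using bounded_imp_convergent_subsequence by blast
  then have "Cauchy ((\<lambda>n. z ^ n) \<circ> r)" using LIMSEQ_imp_Cauchy by blast
  then obtain N where N: "\<And>a b. a \<ge> N \<Longrightarrow> b \<ge> N \<Longrightarrow> dist (((\<lambda>n. z ^ n) \<circ> r) a) (((\<lambda>n. z ^ n) \<circ> r) b) < 1"
    unfolding Cauchy_def by (metis zero_less_one)
  define a d where "a = r N" and "d = r (Suc N) - r N"
  have d: "r (Suc N) = a + d" "1 \<le> d"
    using strict_monoD[OF r(1), of N "Suc N"] by (auto simp: a_def d_def)
  have "cmod (z ^ (a + d) - z ^ a) < 1"
    using N[of "Suc N" N] d by (simp add: dist_norm a_def)
  also have "z ^ (a + d) - z ^ a = z ^ a * (z ^ d - 1)" by (simp add: power_add algebra_simps)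
  finally have "cmod (z ^ d - 1) < 1" by (simp add: norm_mult norm_power assms)
  moreover have "z ^ Suc d - z = z * (z ^ d - 1)" by (simp add: algebra_simps)
  ultimately have "cmod (z ^ Suc d - z) < 1" by (metis assms norm_mult mult_1)
  then show ?thesis using that[of "Suc d"] d by auto
qed

text \<open>Weak monotonicity has to suffice, since the denominators of a continued fraction may
  begin 1, 1. The least index with \<open>N < p k\<close> supplies the bracket.\<close>

lemma bracket_index:
  assumes mono: "\<And>i. p i \<le> p (Suc i)" and unb: "\<exists>k. N < p k" and "p 0 \<le> N"
  shows "p (bracket_index p N) \<le> N" "N < p (Suc (bracket_index p N))"
proof -
  have mono': "p i \<le> p j" if "i \<le> j" for i j using mono that by (rule lift_Suc_mono_le)
  define k where "k = (LEAST k. N < p k)"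
  have k: "N < p k" unfolding k_def using unb by (rule LeastI_ex)
  then have "k \<noteq> 0" using assms(3) by (metis not_less)
  then obtain i where i: "k = Suc i" using not0_implies_Suc by blast
  have "p i \<le> N" using not_less_Least[of i "\<lambda>k. N < p k"] i by (simp add: k_def not_less)
  then have ex: "p i \<le> N \<and> N < p (Suc i)" using k i by simp
  have "j = i" if "p j \<le> N \<and> N < p (Suc j)" for j
  proof (rule ccontr)
    assume "j \<noteq> i"
    then consider "Suc j \<le> i" | "Suc i \<le> j" by linarith
    then show False using mono'[of "Suc j" i] mono'[of "Suc i" j] that ex by cases auto
  qed
  then have "p (bracket_index p N) \<le> N \<and> N < p (Suc (bracket_index p N))"
    unfolding bracket_index_def using ex by (rule theI[where a = i, rotated])
  then show "p (bracket_index p N) \<le> N" "N < p (Suc (bracket_index p N))" by auto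
qed

lemma bounded_of_eventually:
  fixes f :: "nat \<Rightarrow> real"
  assumes "\<And>n. n \<ge> N \<Longrightarrow> f n \<le> C"
  obtains C' where "\<And>n. f n \<le> C'" "C \<le> C'"
proof -
  define C' where "C' = Max (insert C (f ` {..<N}))"
  have 1: "C \<le> C'" unfolding C'_def by (intro Max_ge) auto
  moreover have "f n \<le> C'" for n
  proof (cases "n < N")
    case True
    then show ?thesis unfolding C'_def by (intro Max_ge) auto
  qed (use assms[of n] 1 in auto)
  ultimately show ?thesis using that by blast
qed

text \<open>Level i has threshold \<open>Omega l (p i) / 2\<close>; a bad node has at least
  \<open>p i\<close> leaves and nested ones differ by at least \<open>p i / 2\<close>, so there are
  at most \<open>2 / p i\<close> per leaf. Weighted by \<open>L (i + 1) - L i\<close>, these rates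
  give the sum of the condition, minus terms \<open>2 * L i / p i\<close> that are eventually
  nonnegative.\<close>

lemma cost_bruno:
  fixes l :: "complex ^ 'n::finite"
  assumes unit: "\<And>i. cmod (l $ i) = 1" and nonres: "non_resonant l" and "bruno_cond s l"
  shows "\<exists>C. \<forall>t. proper t \<longrightarrow> cost l t \<le> real (nleaves t) * (s * ln (real (nleaves t)) + C)"
proof -
  obtain p :: "nat \<Rightarrow> nat" where p: "strict_mono p" "\<And>k. p k > 0" "p 1 \<ge> 3"
    and lim: "Limsup (filtercomap mi_order at_top)
          (\<lambda>\<alpha> :: 'n \<Rightarrow> nat. ereal
             (2 * (\<Sum>m = 0..bracket_index p (mi_order \<alpha>). ln (1 / Omega l (p (m + 1))) / real (p m))
              - s * ln (real (mi_order \<alpha>)))) < \<infinity>"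
    using assms(3) unfolding bruno_cond_def by blast
  \<comment> \<open>Below \<open>p 0\<close> the value of \<open>bracket_index\<close> is
    unspecified. Level 0 serves there, since all that is needed is
    \<open>n < p (Suc (k n))\<close>.\<close>
  define k where "k n = (if n < p 0 then 0 else bracket_index p n)" for n
  define L where "L i = ln (1 / Omega l (p i))" for i
  define B where "B n = 2 * (\<Sum>m = 0..bracket_index p n. L (m + 1) / real (p m)) - s * ln (real n)" for n
  obtain C0 where "Limsup (filtercomap mi_order at_top) (\<lambda>\<alpha> :: 'n \<Rightarrow> nat. ereal (B (mi_order \<alpha>))) < ereal C0"
    using lim less_PInf_Ex_of_nat unfolding B_def L_def by auto
  then have "eventually (\<lambda>\<alpha> :: 'n \<Rightarrow> nat. ereal (B (mi_order \<alpha>)) < ereal C0) (filtercomap mi_order at_top)"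
    by (rule Limsup_lessD)
  then obtain n0 where n0: "\<And>\<alpha> :: 'n \<Rightarrow> nat. n0 \<le> mi_order \<alpha> \<Longrightarrow> B (mi_order \<alpha>) < C0"
    by (auto simp: eventually_filtercomap_at_top_linorder)
  have B: "B n < C0" if "n0 \<le> n" for n
    using n0 ex_mi_order[where 'n = 'n, of n] that by blast
  have pmono: "p i \<le> p j" if "i \<le> j" for i j using p(1) that by (simp add: strict_mono_less_eq)
  have p3: "3 \<le> p i" if "1 \<le> i" for i using pmono[OF that] p(3) by simp
  have k_less: "n < p (Suc (k n))" for n
  proof (cases "n < p 0")
    case True
    then show ?thesis using pmono[of 0 1] by (simp add: k_def)
  next
    case False
    have "n < p (Suc n)" using strict_mono_imp_increasing[OF p(1), of "Suc n"] by simp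
    then show ?thesis using bracket_index(2)[of p n] pmono False by (auto simp: k_def)
  qed
  \<comment> \<open>Divisors of low order may exceed 1. A power close to its base makes
    \<open>Omega l (p i) \<le> 1\<close> for all large i, which settles the sign of
    \<open>L i\<close>.\<close>
  obtain m where m: "2 \<le> m" "cmod ((l $ undefined) ^ m - l $ undefined) < 1"
    using unit_power_near[OF unit] .
  have "monom_eval l (replicate m undefined) = (l $ undefined) ^ m"
    by (induction m) auto
  then have Omega1: "Omega l (p i) \<le> 1" if "m < i" for i
    using Omega_le[of "replicate m undefined" "p i" l undefined] m that
      strict_mono_imp_increasing[OF p(1), of i] by simp
  have Omega_pos': "Omega l (p i) > 0" if "1 \<le> i" for i using Omega_pos[OF nonres p3[OF that]] .
  have L_nonneg: "L i \<ge> 0" if "m < i" for i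
    unfolding L_def using Omega1[OF that] Omega_pos'[of i] that m by (simp add: ln_ge_zero)
  \<comment> \<open>The half makes two divisors below the threshold add up to less than
    \<open>Omega\<close>. The value \<open>p 0\<close> may be below 3, where \<open>Omega\<close> is
    not controlled; \<open>max\<close> replaces it by \<open>p 1\<close>.\<close>
  define \<tau> where "\<tau> i = Omega l (p (max 1 i)) / 2" for i
  have \<tau>_pos: "\<tau> i > 0" for i unfolding \<tau>_def using Omega_pos'[of "max 1 i"] by simp
  have \<tau>_anti: "\<tau> (Suc i) \<le> \<tau> i" for i
    unfolding \<tau>_def using p3 by (intro divide_right_mono Omega_antimono pmono) auto
  have ln_\<tau>: "ln (\<tau> i) - ln (\<tau> (Suc i)) = L (Suc i) - L i" if "1 \<le> i" for i
    using Omega_pos'[of i] Omega_pos'[of "Suc i"] that by (simp add: \<tau>_def L_def ln_div max_def)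
  define W where "W n = (\<Sum>i=1..k n. (ln (\<tau> i) - ln (\<tau> (Suc i))) * (1 / real 0 + 2 / real (p i)))" for n
  have cost: "cost l t \<le> real (nleaves t) * (\<bar>ln (\<tau> 1)\<bar> + W (nleaves t))" if t: "proper t" for t
    unfolding W_def
  proof (rule cost_le[where n = "nleaves t"])
    fix t' :: "'n tree" assume t': "proper t'" "is_node t'" "nleaves t' \<le> nleaves t"
    have "Omega l (p (Suc (k (nleaves t)))) \<le> divisor l t'"
      unfolding divisor_def using nleaves_node_ge_2[OF t'(1,2)] k_less[of "nleaves t"] t'(3)
      by (intro Omega_le) (auto simp: nleaves_def)
    then show "\<tau> (Suc (k (nleaves t))) \<le> divisor l t'"
      using \<tau>_pos[of "Suc (k (nleaves t))"] by (simp add: \<tau>_def max_def)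
  next
    fix i and t' :: "'n tree"
    assume t': "1 \<le> i" "proper t'" "is_node t'" "divisor l t' < \<tau> i" "real (nleaves t') < real (p i)"
    have "Omega l (p i) \<le> divisor l t'"
      unfolding divisor_def using nleaves_node_ge_2[OF t'(2,3)] t'(5)
      by (intro Omega_le) (auto simp: nleaves_def)
    then show "0 dvd nleaves t' - 1" using t'(4) \<tau>_pos[of i] t'(1) by (simp add: \<tau>_def max_def)
  next
    fix i and t' u :: "'n tree"
    assume a: "1 \<le> i" "divisor l t' < \<tau> i" "divisor l u < \<tau> i"
      "mset (leaves u) \<subseteq># mset (leaves t')" "nleaves u < nleaves t'"
    obtain xs where xs: "length xs = nleaves t' - nleaves u"
      "cmod (monom_eval l (root_label u # xs) - l $ root_label t') \<le> divisor l u + divisor l t'"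
      using nested_divisors[OF unit a(4)] .
    \<comment> \<open>The \<open>Suc\<close> is the root label of u in front of the word. Hence the
      difference is at least \<open>p i - 1\<close>, which is at least \<open>p i / 2\<close>
      because \<open>p i\<close> is at least 3.\<close>
    have "\<not> Suc (nleaves t' - nleaves u) < p i"
    proof
      assume "Suc (nleaves t' - nleaves u) < p i"
      then have "Omega l (p i) \<le> cmod (monom_eval l (root_label u # xs) - l $ root_label t')"
        using xs(1) a(5) by (intro Omega_le) auto
      then show False using xs(2) a(1-3) by (simp add: \<tau>_def max_def)
    qed
    then have "real (p i) \<le> real (nleaves t' - nleaves u) + 1" by simp
    then show "real (p i) / 2 \<le> real (nleaves t' - nleaves u) \<or> 0 dvd nleaves t' - nleaves u"
      using p3[OF a(1)] by linarith
  qed (use t \<tau>_pos \<tau>_anti p(2) in auto)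
  define D where "D = (\<Sum>i\<le>m. 2 * \<bar>L i\<bar>)"
  have W_le: "W n - s * ln (real n) \<le> C0 + \<bar>2 * L 1 / real (p 0)\<bar> + D" if n: "n \<ge> max n0 (p 0)" for n
  proof -
    have kn: "k n = bracket_index p n" using n by (simp add: k_def)
    have "W n = (\<Sum>i=1..k n. 2 * L (Suc i) / real (p i)) + (\<Sum>i=1..k n. - 2 * L i / real (p i))"
      unfolding W_def sum.distrib[symmetric]
      by (intro sum.cong) (auto simp: ln_\<tau> diff_divide_distrib algebra_simps)
    \<comment> \<open>These terms are at most 0 beyond m, so only finitely many count, with a bound
      independent of n.\<close>
    also have "(\<Sum>i=1..k n. - 2 * L i / real (p i)) \<le> (\<Sum>i=1..k n. if i \<le> m then 2 * \<bar>L i\<bar> else 0)"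
    proof (rule sum_mono)
      fix i
      have "- 2 * L i / real (p i) \<le> 2 * \<bar>L i\<bar> / real (p i)" by (intro divide_right_mono) auto
      also have "\<dots> \<le> 2 * \<bar>L i\<bar> / 1"
        using p(2)[of i] by (intro divide_left_mono) auto
      finally show "- 2 * L i / real (p i) \<le> (if i \<le> m then 2 * \<bar>L i\<bar> else 0)"
        using L_nonneg[of i] by (simp add: divide_nonneg_nonneg not_le)
    qed
    also have "\<dots> = (\<Sum>i\<in>{1..k n} \<inter> {..m}. 2 * \<bar>L i\<bar>)"
      by (subst sum.inter_restrict) (auto intro!: sum.cong)
    also have "\<dots> \<le> D" unfolding D_def by (intro sum_mono2) auto
    finally have "W n \<le> (\<Sum>i=1..k n. 2 * L (Suc i) / real (p i)) + D" by simp
    \<comment> \<open>The levels start at 1, so the term of index 0 is split off into the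
      constant.\<close>
    moreover have "2 * (\<Sum>m = 0..bracket_index p n. L (m + 1) / real (p m)) =
        2 * L 1 / real (p 0) + (\<Sum>i=1..k n. 2 * L (Suc i) / real (p i))"
      unfolding kn by (simp add: sum.atLeast_Suc_atMost sum_distrib_left ring_distribs)
    ultimately show ?thesis using B[of n] n unfolding B_def by (simp add: abs_if)
  qed
  obtain C' where C': "\<And>n. W n - s * ln (real n) \<le> C'"
    using bounded_of_eventually[of "max n0 (p 0)" "\<lambda>n. W n - s * ln (real n)", OF W_le] by blast
  have "cost l t \<le> real (nleaves t) * (s * ln (real (nleaves t)) + (\<bar>ln (\<tau> 1)\<bar> + C'))" if t: "proper t" for t
  proof -
    note cost[OF t]
    also have "real (nleaves t) * (\<bar>ln (\<tau> 1)\<bar> + W (nleaves t)) \<le> real (nleaves t) * (s * ln (real (nleaves t)) + (\<bar>ln (\<tau> 1)\<bar> + C'))"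
      using C'[of "nleaves t"] by (intro mult_left_mono) auto
    finally show ?thesis .
  qed
  then show ?thesis by blast
qed

section \<open>The Bruno condition in one dimension\<close>

text \<open>Numerators of the convergents of a number between 0 and 1: the digit of index 0
  vanishes, which explains the initial values.\<close>

fun cf_num :: "real \<Rightarrow> nat \<Rightarrow> int" where
  "cf_num \<omega> 0 = 0"
| "cf_num \<omega> (Suc 0) = 1"
| "cf_num \<omega> (Suc (Suc k)) = cf_digit \<omega> (Suc (Suc k)) * cf_num \<omega> (Suc k) + cf_num \<omega> k"

definition cf_err :: "real \<Rightarrow> nat \<Rightarrow> real" where
  "cf_err \<omega> k = real (cf_denom \<omega> k) * \<omega> - of_int (cf_num \<omega> k)"

context
  fixes \<omega> :: real
  assumes \<omega>: "0 < \<omega>" "\<omega> < 1" "\<omega> \<notin> \<rat>"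
begin

lemma cf_rem_irrational: "cf_rem \<omega> k \<notin> \<rat>"
proof (induction k)
  case (Suc k)
  show ?case
  proof
    assume "cf_rem \<omega> (Suc k) \<in> \<rat>"
    then have "inverse (cf_rem \<omega> (Suc k)) \<in> \<rat>" by (rule Rats_inverse)
    then show False using Suc by simp
  qed
qed (use \<omega> in simp)

lemma frac_cf_rem: "0 < frac (cf_rem \<omega> k)" "frac (cf_rem \<omega> k) < 1"
proof -
  have "cf_rem \<omega> k \<notin> \<int>" using cf_rem_irrational Ints_subset_Rats by blast
  then show "0 < frac (cf_rem \<omega> k)" by (simp add: frac_gt_0_iff)
qed (rule frac_lt_1)

lemma cf_rem_Suc_gt_1: "1 < cf_rem \<omega> (Suc k)"
  using frac_cf_rem[of k] by simp

lemma cf_digit_Suc_ge_1: "1 \<le> cf_digit \<omega> (Suc k)"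
  unfolding cf_digit_def using cf_rem_Suc_gt_1[of k] by (simp only: le_floor_iff)

lemma cf_digit_diff_rem: "of_int (cf_digit \<omega> k) - cf_rem \<omega> k = - frac (cf_rem \<omega> k)"
  by (simp add: cf_digit_def frac_def)

text \<open>By the recurrence, the next error is the current one times (digit minus complete
  quotient). Both the alternation of signs and the decrease of the errors are read off from
  this.\<close>

lemma cf_err_Suc: "cf_err \<omega> (Suc k) = - cf_err \<omega> k * frac (cf_rem \<omega> (Suc k))"
proof (induction k)
  case 0
  have 1: "frac \<omega> = \<omega>" using \<omega> by (simp add: frac_eq)
  have d: "real (nat (cf_digit \<omega> (Suc 0))) = of_int (cf_digit \<omega> (Suc 0))"
    using cf_digit_Suc_ge_1[of 0] by simp
  have "cf_err \<omega> (Suc 0) = of_int (cf_digit \<omega> (Suc 0)) * \<omega> - 1"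
    using d by (simp add: cf_err_def)
  also have "\<dots> = \<omega> * (of_int (cf_digit \<omega> (Suc 0)) - cf_rem \<omega> (Suc 0))"
    using 1 \<omega> by (simp add: field_simps)
  finally show ?case unfolding cf_digit_diff_rem by (simp add: cf_err_def)
next
  case (Suc k)
  have d: "real (nat (cf_digit \<omega> (Suc (Suc k)))) = of_int (cf_digit \<omega> (Suc (Suc k)))"
    using cf_digit_Suc_ge_1[of "Suc k"] by simp
  have "cf_err \<omega> k = - cf_err \<omega> (Suc k) * cf_rem \<omega> (Suc (Suc k))"
    using Suc frac_cf_rem(1)[of "Suc k"] by (simp add: field_simps)
  moreover have "cf_err \<omega> (Suc (Suc k)) = of_int (cf_digit \<omega> (Suc (Suc k))) * cf_err \<omega> (Suc k) + cf_err \<omega> k"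
    using d by (simp add: cf_err_def algebra_simps)
  ultimately have "cf_err \<omega> (Suc (Suc k)) =
      cf_err \<omega> (Suc k) * (of_int (cf_digit \<omega> (Suc (Suc k))) - cf_rem \<omega> (Suc (Suc k)))"
    by (simp add: algebra_simps del: cf_rem.simps)
  then show ?case unfolding cf_digit_diff_rem by simp
qed

lemma cf_err_sign: "0 < (-1) ^ k * cf_err \<omega> k"
proof (induction k)
  case 0
  then show ?case using \<omega> by (simp add: cf_err_def)
next
  case (Suc k)
  have "(-1) ^ Suc k * cf_err \<omega> (Suc k) = ((-1) ^ k * cf_err \<omega> k) * frac (cf_rem \<omega> (Suc k))"
    by (simp add: cf_err_Suc del: cf_rem.simps)
  then show ?case using Suc frac_cf_rem(1)[of "Suc k"] by (simp del: cf_rem.simps)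
qed

lemma cf_err_det:
  "real (cf_denom \<omega> (Suc k)) * cf_err \<omega> k - real (cf_denom \<omega> k) * cf_err \<omega> (Suc k) = (-1) ^ k"
proof (induction k)
  case 0
  then show ?case by (simp add: cf_err_def)
next
  case (Suc k)
  have d: "real (nat (cf_digit \<omega> (Suc (Suc k)))) = of_int (cf_digit \<omega> (Suc (Suc k)))"
    using cf_digit_Suc_ge_1[of "Suc k"] by simp
  have e: "cf_err \<omega> (Suc (Suc k)) = of_int (cf_digit \<omega> (Suc (Suc k))) * cf_err \<omega> (Suc k) + cf_err \<omega> k"
    using d by (simp add: cf_err_def algebra_simps)
  have q: "real (cf_denom \<omega> (Suc (Suc k))) =
      of_int (cf_digit \<omega> (Suc (Suc k))) * real (cf_denom \<omega> (Suc k)) + real (cf_denom \<omega> k)"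
    using d by simp
  have "real (cf_denom \<omega> (Suc (Suc k))) * cf_err \<omega> (Suc k) - real (cf_denom \<omega> (Suc k)) * cf_err \<omega> (Suc (Suc k))
    = - (real (cf_denom \<omega> (Suc k)) * cf_err \<omega> k - real (cf_denom \<omega> k) * cf_err \<omega> (Suc k))"
    unfolding e q by (simp only: algebra_simps)
  then show ?case using Suc by (simp del: cf_denom.simps)
qed

lemma cf_num_det:
  "int (cf_denom \<omega> k) * cf_num \<omega> (Suc k) - int (cf_denom \<omega> (Suc k)) * cf_num \<omega> k = (-1) ^ k"
proof -
  have "of_int (int (cf_denom \<omega> k) * cf_num \<omega> (Suc k) - int (cf_denom \<omega> (Suc k)) * cf_num \<omega> k) =
      real (cf_denom \<omega> (Suc k)) * cf_err \<omega> k - real (cf_denom \<omega> k) * cf_err \<omega> (Suc k)"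
    by (simp add: cf_err_def algebra_simps del: cf_denom.simps cf_num.simps)
  then have "of_int (int (cf_denom \<omega> k) * cf_num \<omega> (Suc k) - int (cf_denom \<omega> (Suc k)) * cf_num \<omega> k) =
      (of_int ((-1) ^ k) :: real)"
    unfolding cf_err_det by simp
  then show ?thesis by (simp only: of_int_eq_iff)
qed

lemma cf_denom_pos: "1 \<le> cf_denom \<omega> k"
proof (induction k rule: nat_less_induct)
  case (1 n)
  consider "n = 0" | "n = 1" | i where "n = Suc (Suc i)"
    by (metis One_nat_def not0_implies_Suc)
  then show ?case
  proof cases
    case 2
    then show ?thesis using cf_digit_Suc_ge_1[of 0] by (simp del: cf_rem.simps)
  next
    case 3
    then have "1 \<le> cf_denom \<omega> i" using 1 by simp
    then show ?thesis using 3 by simp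
  qed simp
qed

lemma cf_denom_add: "cf_denom \<omega> (Suc k) + cf_denom \<omega> k \<le> cf_denom \<omega> (Suc (Suc k))"
proof -
  have "1 * cf_denom \<omega> (Suc k) \<le> nat (cf_digit \<omega> (Suc (Suc k))) * cf_denom \<omega> (Suc k)"
    using cf_digit_Suc_ge_1[of "Suc k"] by (intro mult_right_mono) auto
  then show ?thesis by simp
qed

lemma cf_denom_mono: "cf_denom \<omega> k \<le> cf_denom \<omega> (Suc k)"
proof (cases k)
  case 0
  then show ?thesis using cf_denom_pos[of 1] by simp
next
  case (Suc i)
  then show ?thesis using cf_denom_add[of i] by (simp del: cf_denom.simps)
qed

text \<open>The denominator at least doubles every two steps. Squaring avoids roots of 2, and the
  factor 2 covers index 1, where the denominator may still be 1.\<close>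

lemma two_power_le_cf_denom_square: "2 ^ k \<le> 2 * (cf_denom \<omega> k)\<^sup>2"
proof (induction k rule: nat_less_induct)
  case (1 n)
  consider "n = 0" | "n = 1" | i where "n = Suc (Suc i)"
    by (metis One_nat_def not0_implies_Suc)
  then show ?case
  proof cases
    case 2
    then show ?thesis using cf_denom_pos[of 1] by simp
  next
    case 3
    have "2 * cf_denom \<omega> i \<le> cf_denom \<omega> n"
      using cf_denom_add[of i] cf_denom_mono[of i] unfolding 3 by linarith
    then have "(2 * cf_denom \<omega> i)\<^sup>2 \<le> (cf_denom \<omega> n)\<^sup>2" by (rule power_mono) simp
    moreover have "2 ^ i \<le> 2 * (cf_denom \<omega> i)\<^sup>2" using 1 3 by simp
    ultimately show ?thesis using 3 by (simp add: power2_eq_square)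
  qed simp
qed

lemma cf_denom_unbounded: "\<exists>k. N < cf_denom \<omega> k"
proof (rule ccontr)
  assume "\<not> ?thesis"
  then have "cf_denom \<omega> k \<le> N" for k by (simp add: not_less)
  then have "(cf_denom \<omega> (2 * N ^ 2))\<^sup>2 \<le> N\<^sup>2" by (intro power_mono) auto
  then have "2 ^ (2 * N ^ 2) \<le> 2 * N ^ 2" using two_power_le_cf_denom_square[of "2 * N ^ 2"] by linarith
  moreover have "2 * N ^ 2 < 2 ^ (2 * N ^ 2)" by (rule less_exp)
  ultimately show False by simp
qed

lemma abs_cf_err: "\<bar>cf_err \<omega> k\<bar> = (-1) ^ k * cf_err \<omega> k"
proof -
  have "\<bar>cf_err \<omega> k\<bar> = \<bar>(-1) ^ k * cf_err \<omega> k\<bar>" by (simp add: abs_mult)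
  also have "\<dots> = (-1) ^ k * cf_err \<omega> k" using cf_err_sign[of k] by (rule abs_of_pos)
  finally show ?thesis .
qed

text \<open>The signs alternate, so the determinant identity becomes a sum of absolute values. It
  pins the error at k between \<open>1 / (2 * q)\<close> and \<open>1 / q\<close>, for q the
  denominator at \<open>Suc k\<close>.\<close>

lemma cf_err_sum:
  "real (cf_denom \<omega> (Suc k)) * \<bar>cf_err \<omega> k\<bar> + real (cf_denom \<omega> k) * \<bar>cf_err \<omega> (Suc k)\<bar> = 1"
proof -
  have "real (cf_denom \<omega> (Suc k)) * \<bar>cf_err \<omega> k\<bar> + real (cf_denom \<omega> k) * \<bar>cf_err \<omega> (Suc k)\<bar>
    = (-1) ^ k * (real (cf_denom \<omega> (Suc k)) * cf_err \<omega> k - real (cf_denom \<omega> k) * cf_err \<omega> (Suc k))"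
    unfolding abs_cf_err by (simp add: algebra_simps del: cf_denom.simps)
  then show ?thesis unfolding cf_err_det by (simp add: power_mult_distrib[symmetric])
qed

lemma abs_cf_err_le: "\<bar>cf_err \<omega> k\<bar> \<le> 1 / real (cf_denom \<omega> (Suc k))"
proof -
  have "real (cf_denom \<omega> (Suc k)) * \<bar>cf_err \<omega> k\<bar> \<le> 1"
    using cf_err_sum[of k] by (smt (verit) mult_nonneg_nonneg of_nat_0_le_iff)
  then show ?thesis using cf_denom_pos[of "Suc k"] by (simp add: field_simps del: cf_denom.simps)
qed

lemma abs_cf_err_ge: "1 / (2 * real (cf_denom \<omega> (Suc k))) \<le> \<bar>cf_err \<omega> k\<bar>"
proof -
  have "\<bar>cf_err \<omega> (Suc k)\<bar> \<le> \<bar>cf_err \<omega> k\<bar>"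
    using frac_cf_rem[of "Suc k"]
    by (simp add: cf_err_Suc abs_mult mult_left_le del: cf_rem.simps)
  then have "real (cf_denom \<omega> k) * \<bar>cf_err \<omega> (Suc k)\<bar> \<le> real (cf_denom \<omega> (Suc k)) * \<bar>cf_err \<omega> k\<bar>"
    using cf_denom_mono[of k] by (intro mult_mono) auto
  then have "1 \<le> 2 * real (cf_denom \<omega> (Suc k)) * \<bar>cf_err \<omega> k\<bar>"
    using cf_err_sum[of k] by linarith
  then show ?thesis using cf_denom_pos[of "Suc k"] by (simp add: field_simps del: cf_denom.simps)
qed

text \<open>The pair (m, P) is an integer combination of two consecutive convergents. For m below
  the larger denominator the coefficients have opposite signs or the second is 0; as the errors
  alternate too, the two contributions cannot cancel.\<close>

lemma best_approximation:
  assumes m: "1 \<le> m" "m < cf_denom \<omega> (Suc k)"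
  shows "\<bar>cf_err \<omega> k\<bar> \<le> \<bar>real m * \<omega> - of_int P\<bar>"
proof -
  define q q' p p' where "q = int (cf_denom \<omega> k)" and "q' = int (cf_denom \<omega> (Suc k))"
    and "p = cf_num \<omega> k" and "p' = cf_num \<omega> (Suc k)"
  define e :: int where "e = (-1) ^ k"
  have det: "q * p' - q' * p = e" unfolding q_def q'_def p_def p'_def e_def by (rule cf_num_det)
  have ee: "e * e = 1" unfolding e_def by (simp add: power_mult_distrib[symmetric])
  \<comment> \<open>Cramer's rule; the determinant \<open>e\<close> is its own inverse.\<close>
  define u v where "u = e * (int m * p' - P * q')" and "v = e * (q * P - p * int m)"
  have mu: "u * q + v * q' = e * (q * p' - q' * p) * int m"
    unfolding u_def v_def by (simp add: algebra_simps)
  have Pu: "u * p + v * p' = e * (q * p' - q' * p) * P"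
    unfolding u_def v_def by (simp add: algebra_simps)
  have mu: "int m = u * q + v * q'" and Pu: "P = u * p + v * p'"
    using mu Pu unfolding det ee by simp_all
  have q: "1 \<le> q" "1 \<le> q'" unfolding q_def q'_def using cf_denom_pos[of k] cf_denom_pos[of "Suc k"] by simp_all
  have m': "1 \<le> int m" "int m < q'" using m by (simp_all add: q'_def)
  have eq: "real m * \<omega> - of_int P = of_int u * cf_err \<omega> k + of_int v * cf_err \<omega> (Suc k)"
  proof -
    have "real m = of_int (int m)" by simp
    then show ?thesis unfolding mu Pu cf_err_def q_def q'_def p_def p'_def
      by (simp add: algebra_simps del: cf_denom.simps cf_num.simps)
  qed
  have u0: "u \<noteq> 0"
  proof
    assume "u = 0"
    then have "int m = v * q'" using mu by simp
    then have "0 < v * q'" "v * q' < 1 * q'" using m' by simp_all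
    then have "0 < v" "v < 1" using q by (simp_all only: zero_less_mult_iff mult_less_cancel_right) auto
    then show False by simp
  qed
  have uv: "u * v \<le> 0"
  proof (rule ccontr)
    assume "\<not> u * v \<le> 0"
    then consider "u > 0" "v > 0" | "u < 0" "v < 0" by (auto simp: not_le zero_less_mult_iff)
    then show False
    proof cases
      case 1
      then have "1 * q' \<le> v * q'" "0 < u * q" using q by (auto intro: mult_right_mono)
      then show False using mu m' by linarith
    next
      case 2
      then have "v * q' < 0" "u * q < 0" using q by (auto simp: mult_less_0_iff)
      then show False using mu m' by linarith
    qed
  qed
  have "0 \<le> (of_int u * cf_err \<omega> k) * (of_int v * cf_err \<omega> (Suc k))"
  proof -
    have "(of_int u * cf_err \<omega> k) * (of_int v * cf_err \<omega> (Suc k)) =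
      of_int (- (u * v)) * ((cf_err \<omega> k)\<^sup>2 * frac (cf_rem \<omega> (Suc k)))"
      by (simp add: cf_err_Suc power2_eq_square del: cf_rem.simps)
    also have "\<dots> \<ge> 0"
      using uv frac_cf_rem[of "Suc k"] by (intro mult_nonneg_nonneg) (auto simp del: cf_rem.simps of_int_minus of_int_mult)
    finally show ?thesis .
  qed
  then have "\<bar>of_int u * cf_err \<omega> k\<bar> \<le> \<bar>real m * \<omega> - of_int P\<bar>"
    unfolding eq by (auto simp: zero_le_mult_iff)
  moreover have "1 * \<bar>cf_err \<omega> k\<bar> \<le> \<bar>of_int u\<bar> * \<bar>cf_err \<omega> k\<bar>"
    using u0 by (intro mult_right_mono) auto
  ultimately show ?thesis by (simp add: abs_mult)
qed

end

section \<open>Small divisors on the circle\<close>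

lemma sin_pi_ge:
  fixes y :: real
  assumes "\<bar>y\<bar> \<le> 1 / 2"
  shows "\<bar>y\<bar> \<le> \<bar>sin (pi * y)\<bar>"
proof -
  \<comment> \<open>Up to 1/6 the cosine is at least 1/2, and the mean value theorem applies; beyond
    that the sine is at least 1/2 already.\<close>
  have *: "y \<le> sin (pi * y)" if y: "0 \<le> y" "y \<le> 1 / 2" for y :: real
  proof (cases "y \<le> 1 / 6")
    case True
    show ?thesis
    proof (cases "y = 0")
      case False
      then have "0 < pi * y" using y by simp
      then obtain x where x: "0 < x" "x < pi * y" "sin (pi * y) - sin 0 = (pi * y - 0) * cos x"
        using MVT2[of 0 "pi * y" sin cos] by (auto intro: derivative_eq_intros)
      have "x \<le> pi / 3" using x(2) \<open>y \<le> 1 / 6\<close> mult_left_mono[of y "1/6" pi] pi_gt_zero by linarith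
      then have "cos (pi / 3) \<le> cos x" using x(1) pi_gt_zero by (intro cos_monotone_0_pi_le) auto
      then have "pi * y * (1 / 2) \<le> pi * y * cos x"
        using y by (intro mult_left_mono) (auto simp: cos_60)
      moreover have "2 * y \<le> pi * y" using y pi_ge_two by (intro mult_right_mono) auto
      ultimately have "y \<le> pi * y * cos x" by linarith
      then show ?thesis using x(3) by simp
    qed simp
  next
    case False
    have "sin (pi / 6) \<le> sin (pi * y)"
      using False y by (intro sin_monotone_2pi_le) (auto simp: field_simps)
    then show ?thesis using y by (simp add: sin_30)
  qed
  show ?thesis
  proof (cases "y \<ge> 0")
    case True
    then show ?thesis using *[of y] assms by simp
  next
    case False
    then show ?thesis using *[of "-y"] assms by simp
  qed
qed

text \<open>In one dimension this is the divisor of a tree with \<open>m + 1\<close> leaves, after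
  dividing by lambda, which has modulus 1.\<close>

definition circle_dist :: "real \<Rightarrow> nat \<Rightarrow> real" where
  "circle_dist \<omega> m = cmod (exp (2 * of_real pi * \<i> * of_real \<omega>) ^ m - 1)"

lemma circle_dist_eq:
  "circle_dist \<omega> m = 2 * \<bar>sin (pi * (real m * \<omega> - of_int P))\<bar>"
proof -
  have per: "exp (2 * of_real pi * \<i> * of_int P :: complex) = 1"
    using exp_integer_2pi[of "of_int P"] by (simp add: mult_ac)
  have "exp (2 * of_real pi * \<i> * of_real \<omega>) ^ m = exp (of_nat m * (2 * of_real pi * \<i> * of_real \<omega>))"
    by (simp add: exp_of_nat_mult)
  also have "\<dots> = exp (of_nat m * (2 * of_real pi * \<i> * of_real \<omega>)) / exp (2 * of_real pi * \<i> * of_int P)"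
    by (subst per) simp
  also have "\<dots> = exp (\<i> * of_real (2 * pi * (real m * \<omega> - of_int P)))"
    unfolding exp_diff[symmetric] by (rule arg_cong[where f = exp]) (simp add: algebra_simps)
  finally have "circle_dist \<omega> m = cmod (exp (\<i> * of_real (2 * pi * (real m * \<omega> - of_int P))) - 1)"
    unfolding circle_dist_def by (rule arg_cong)
  then show ?thesis unfolding dist_exp_i_1 by simp
qed

lemma circle_dist_le: "circle_dist \<omega> m \<le> 2 * pi * \<bar>real m * \<omega> - of_int P\<bar>"
  using abs_sin_x_le_abs_x[of "pi * (real m * \<omega> - of_int P)"]
  by (simp add: circle_dist_eq[of \<omega> m P] abs_mult)

lemma circle_dist_ge:
  assumes "\<And>P. d \<le> \<bar>real m * \<omega> - of_int P\<bar>"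
  shows "2 * d \<le> circle_dist \<omega> m"
proof -
  have "\<bar>real m * \<omega> - of_int (round (real m * \<omega>))\<bar> \<le> 1 / 2"
    using of_int_round_abs_le[of "real m * \<omega>"] by (simp add: abs_minus_commute)
  from sin_pi_ge[OF this] assms[of "round (real m * \<omega>)"]
  show ?thesis by (simp add: circle_dist_eq[of \<omega> m "round (real m * \<omega>)"])
qed

lemma circle_dist_diff: "circle_dist \<omega> b \<le> circle_dist \<omega> (a + b) + circle_dist \<omega> a"
proof -
  let ?e = "exp (2 * of_real pi * \<i> * of_real \<omega>) :: complex"
  have n: "cmod (?e ^ k) = 1" for k
    by (simp add: norm_power norm_exp_eq_Re)
  have "?e ^ a * (?e ^ b - 1) = (?e ^ (a + b) - 1) - (?e ^ a - 1)"
    by (simp add: power_add algebra_simps)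
  then have "cmod (?e ^ a * (?e ^ b - 1)) \<le> cmod (?e ^ (a + b) - 1) + cmod (?e ^ a - 1)"
    by (metis norm_triangle_ineq4)
  then show ?thesis by (simp add: circle_dist_def norm_mult n)
qed

context
  fixes \<omega> :: real
  assumes \<omega>: "0 < \<omega>" "\<omega> < 1" "\<omega> \<notin> \<rat>"
begin

lemma circle_dist_lower:
  assumes "1 \<le> m" "m < cf_denom \<omega> (Suc k)"
  shows "1 / real (cf_denom \<omega> (Suc k)) \<le> circle_dist \<omega> m"
proof -
  have "2 * (1 / (2 * real (cf_denom \<omega> (Suc k)))) \<le> circle_dist \<omega> m"
    using best_approximation[OF \<omega> assms] abs_cf_err_ge[OF \<omega>, of k]
    by (intro circle_dist_ge) (meson order_trans)
  then show ?thesis by simp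
qed

text \<open>Write m = a * q + b with b < q. If b is not 0, its power is at distance at least 1 / q
  from 1. The part a * q moves the point by at most 7 * a / q', where 7 bounds
  \<open>2 * pi\<close>; with a <= m / q and m < q' / 14 this is below 1 / (2 * q).\<close>

lemma dvd_if_circle_dist_small:
  assumes "real m < real (cf_denom \<omega> (Suc (Suc k))) / 14"
    and "circle_dist \<omega> m < 1 / (2 * real (cf_denom \<omega> (Suc k)))"
  shows "cf_denom \<omega> (Suc k) dvd m"
proof (rule ccontr)
  define q q' where "q = cf_denom \<omega> (Suc k)" and "q' = cf_denom \<omega> (Suc (Suc k))"
  have q: "1 \<le> q" "1 \<le> q'" unfolding q_def q'_def by (rule cf_denom_pos[OF \<omega>])+
  assume "\<not> cf_denom \<omega> (Suc k) dvd m"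
  then have b: "1 \<le> m mod q" "m mod q < q" using q by (auto simp: q_def dvd_eq_mod_eq_0)
  define a where "a = m div q"
  have "real a * real q \<le> real m" unfolding a_def
    by (metis of_nat_le_iff of_nat_mult div_times_less_eq_dividend)
  then have aq: "real a \<le> real m / real q" using q by (simp add: field_simps)
  have "1 / real q \<le> circle_dist \<omega> (m mod q)"
    using circle_dist_lower[of "m mod q" k] b by (simp add: q_def)
  also have "\<dots> \<le> circle_dist \<omega> m + circle_dist \<omega> (a * q)"
    using circle_dist_diff[of \<omega> "m mod q" "a * q"] by (simp add: a_def)
  also have "circle_dist \<omega> (a * q) \<le> 2 * pi * \<bar>real (a * q) * \<omega> - of_int (int a * cf_num \<omega> (Suc k))\<bar>"
    by (rule circle_dist_le)
  also have "real (a * q) * \<omega> - of_int (int a * cf_num \<omega> (Suc k)) = real a * cf_err \<omega> (Suc k)"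
    by (simp add: cf_err_def q_def algebra_simps del: cf_denom.simps cf_num.simps)
  also have "2 * pi * \<bar>real a * cf_err \<omega> (Suc k)\<bar> \<le> 7 * (real a * (1 / real q'))"
    unfolding abs_mult using abs_cf_err_le[OF \<omega>, of "Suc k"] pi_less_4 pi_approx
    by (intro mult_mono) (auto simp: q'_def simp del: cf_denom.simps)
  also have "7 * (real a * (1 / real q')) \<le> 7 * (real m / real q * (1 / real q'))"
    using aq by (intro mult_left_mono mult_right_mono) auto
  also have "\<dots> = 7 * real m / real q' / real q" by simp
  also have "\<dots> \<le> (1 / 2) / real q"
    using assms(1) q by (intro divide_right_mono) (auto simp: q'_def field_simps simp del: cf_denom.simps)
  finally have "1 / real q - (1 / 2) / real q \<le> circle_dist \<omega> m" by simp
  then show False using assms(2) by (simp add: q_def)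
qed

text \<open>Since ln q <= 2 * sqrt q, each term is at most 2 / sqrt q, and sqrt q grows at least
  like 2^(i/4) / 2.\<close>

lemma summable_ln_cf_denom: "summable (\<lambda>i. ln (real (cf_denom \<omega> i)) / real (cf_denom \<omega> i))"
proof (rule summable_comparison_test')
  have "norm (2 powr (-1/4) :: real) < 1" by (simp add: powr_less_one)
  then have "summable (\<lambda>i. (2 powr (-1/4) :: real) ^ i)" by (rule summable_geometric)
  then show "summable (\<lambda>i. 4 * (2 powr (-1/4) :: real) ^ i)" by (rule summable_mult)
  fix i
  define q where "q = real (cf_denom \<omega> i)"
  have q: "1 \<le> q" unfolding q_def using cf_denom_pos[OF \<omega>, of i] by simp
  have "(2::real) ^ i \<le> 2 * q ^ 2"
    using two_power_le_cf_denom_square[OF \<omega>, of i] unfolding q_def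
    by (metis (mono_tags, lifting) of_nat_le_iff of_nat_mult of_nat_numeral of_nat_power)
  then have "((2::real) ^ i) powr (1/4) \<le> (2 * q ^ 2) powr (1/4)" by (intro powr_mono2) auto
  also have "\<dots> = 2 powr (1/4) * sqrt q"
    using q by (simp add: powr_mult powr_half_sqrt[symmetric] powr_powr flip: powr_numeral)
  also have "\<dots> \<le> 2 * sqrt q"
    using powr_mono[of "1/4" 1 "2::real"] q by (intro mult_right_mono) auto
  finally have 1: "((2::real) ^ i) powr (1/4) \<le> 2 * sqrt q" .
  have 2: "(2 powr (-1/4) :: real) ^ i * ((2::real) ^ i) powr (1/4) = 1"
    by (simp add: powr_realpow[symmetric] powr_powr powr_add[symmetric])
  have "ln q = 2 * ln (sqrt q)" using q by (simp add: ln_sqrt)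
  also have "\<dots> \<le> 2 * sqrt q" using ln_le_minus_one[of "sqrt q"] q by simp
  finally have "ln q / q \<le> 2 * sqrt q / q" using q by (intro divide_right_mono) auto
  also have "\<dots> = 2 / sqrt q" using q by (simp add: field_simps)
  also have "\<dots> = 2 * ((2 powr (-1/4) :: real) ^ i * ((2::real) ^ i) powr (1/4)) / sqrt q"
    unfolding 2 by simp
  also have "\<dots> \<le> 2 * ((2 powr (-1/4) :: real) ^ i * (2 * sqrt q)) / sqrt q"
    using 1 q by (intro divide_right_mono mult_left_mono) auto
  also have "\<dots> = 4 * (2 powr (-1/4) :: real) ^ i" using q by simp
  finally show "norm (ln (real (cf_denom \<omega> i)) / real (cf_denom \<omega> i)) \<le> 4 * (2 powr (-1/4) :: real) ^ i"
    using q by (simp add: q_def)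
qed

end

text \<open>Among the sizes below \<open>q\<^sub>i\<^sub>+\<^sub>1 / 14\<close>, bad ones are \<open>1\<close> plus a multiple of \<open>q\<^sub>i\<close>. This saves the factor \<open>2\<close> of
  the count in several dimensions, up to the convergent sum of \<open>ln q\<^sub>i / q\<^sub>i\<close>.\<close>

lemma cost_bruno_1d:
  fixes l :: "complex ^ 'n::finite"
  assumes card: "CARD('n) = 1" and br: "\<And>i. bruno_cond_1d s (l $ i)"
  shows "\<exists>C. \<forall>t. proper t \<longrightarrow> cost l t \<le> real (nleaves t) * (s * ln (real (nleaves t)) + C)"
proof -
  have eq: "i = j" for i j :: 'n using card card_1_singletonE by (metis UNIV_I singletonD)
  define z where "z = l $ undefined"
  have lz: "l $ i = z" for i unfolding z_def using eq by metis
  obtain \<omega> where \<omega>: "0 < \<omega>" "\<omega> < 1" "\<omega> \<notin> \<rat>" and z: "z = exp (2 * of_real pi * \<i> * of_real \<omega>)"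
    and lim: "limsup (\<lambda>N. ereal
          ((\<Sum>j = 0..bracket_index (cf_denom \<omega>) N.
              ln (real (cf_denom \<omega> (j + 1))) / real (cf_denom \<omega> j))
           - s * ln (real N))) < \<infinity>"
    using br[of undefined] unfolding bruno_cond_1d_def z_def[symmetric] by blast
  define q where "q = cf_denom \<omega>"
  define k where "k = bracket_index q"
  have q1: "1 \<le> q i" for i unfolding q_def by (rule cf_denom_pos[OF \<omega>])
  have qmono: "q i \<le> q (Suc i)" for i unfolding q_def by (rule cf_denom_mono[OF \<omega>])
  have k: "n < q (Suc (k n))" if "1 \<le> n" for n unfolding k_def
    by (rule bracket_index(2)) (use that qmono cf_denom_unbounded[OF \<omega>] in \<open>auto simp: q_def\<close>)
  define B where "B n = (\<Sum>j = 0..k n. ln (real (q (j + 1))) / real (q j)) - s * ln (real n)" for n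
  obtain C0 where "limsup (\<lambda>n. ereal (B n)) < ereal C0"
    using lim less_PInf_Ex_of_nat unfolding B_def k_def q_def by auto
  then have "eventually (\<lambda>n. ereal (B n) < ereal C0) sequentially" by (rule Limsup_lessD)
  then obtain n0 where B: "\<And>n. n \<ge> n0 \<Longrightarrow> B n < C0" by (auto simp: eventually_sequentially)
  have div: "divisor l t = circle_dist \<omega> (nleaves t - 1)" if "proper t" for t :: "'n tree"
  proof -
    have "monom_eval l xs = z ^ length xs" for xs by (induction xs) (auto simp: lz)
    then have "divisor l t = cmod (z ^ nleaves t - z)" by (simp add: divisor_def lz nleaves_def)
    also have "z ^ nleaves t - z = z * (z ^ (nleaves t - 1) - 1)"
      using nleaves_ge_1[OF that] by (cases "nleaves t") (auto simp: algebra_simps)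
    also have "cmod z = 1" by (simp add: z norm_exp_eq_Re)
    then have "cmod (z * (z ^ (nleaves t - 1) - 1)) = circle_dist \<omega> (nleaves t - 1)"
      by (simp add: norm_mult circle_dist_def z)
    finally show ?thesis .
  qed
  \<comment> \<open>Half the threshold of \<open>dvd_if_circle_dist_small\<close>, as differences of
    nested nodes add two divisors.\<close>
  define \<tau> where "\<tau> i = 1 / (4 * real (q i))" for i
  have \<tau>_pos: "\<tau> i > 0" for i unfolding \<tau>_def using q1[of i] by simp
  have \<tau>_anti: "\<tau> (Suc i) \<le> \<tau> i" for i
    unfolding \<tau>_def using q1[of i] qmono[of i] by (intro divide_left_mono) auto
  have ln_\<tau>: "ln (\<tau> i) - ln (\<tau> (Suc i)) \<le> ln (real (q (Suc i)))" for i
    using q1[of i] q1[of "Suc i"] by (simp add: \<tau>_def ln_div ln_mult)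
  define W where "W n = (\<Sum>i=1..k n. (ln (\<tau> i) - ln (\<tau> (Suc i))) *
      (1 / real (q i) + 2 / (real (q (Suc i)) / 14)))" for n
  have cost: "cost l t \<le> real (nleaves t) * (\<bar>ln (\<tau> 1)\<bar> + W (nleaves t))" if t: "proper t" for t
    unfolding W_def
  proof (rule cost_le[where n = "nleaves t"])
    fix t' :: "'n tree" assume t': "proper t'" "is_node t'" "nleaves t' \<le> nleaves t"
    note lv2 = nleaves_node_ge_2[OF t'(1,2)]
    have "1 / real (q (Suc (k (nleaves t)))) \<le> circle_dist \<omega> (nleaves t' - 1)"
      unfolding q_def
      by (rule circle_dist_lower[OF \<omega>]) (use lv2 t'(3) k[of "nleaves t"] in \<open>auto simp: q_def\<close>)
    moreover have "\<tau> (Suc (k (nleaves t))) \<le> 1 / real (q (Suc (k (nleaves t))))"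
      unfolding \<tau>_def using q1[of "Suc (k (nleaves t))"] by (intro divide_left_mono) auto
    ultimately show "\<tau> (Suc (k (nleaves t))) \<le> divisor l t'" unfolding div[OF t'(1)] by linarith
  next
    fix i and t' :: "'n tree"
    assume t': "1 \<le> i" "proper t'" "is_node t'" "divisor l t' < \<tau> i" "real (nleaves t') < real (q (Suc i)) / 14"
    obtain j where j: "i = Suc j" using t'(1) by (cases i) auto
    have "\<tau> i \<le> 1 / (2 * real (q i))" unfolding \<tau>_def using q1[of i] by (intro divide_left_mono) auto
    then show "q i dvd nleaves t' - 1" using t' unfolding j q_def
      by (intro dvd_if_circle_dist_small[OF \<omega>]) (auto simp: div simp del: cf_denom.simps)
  next
    fix i and t' u :: "'n tree"
    assume a: "1 \<le> i" "proper t'" "proper u" "divisor l t' < \<tau> i" "divisor l u < \<tau> i" "nleaves u < nleaves t'"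
    obtain j where j: "i = Suc j" using a(1) by (cases i) auto
    have "circle_dist \<omega> (nleaves t' - nleaves u) \<le> circle_dist \<omega> (nleaves t' - 1) + circle_dist \<omega> (nleaves u - 1)"
      using circle_dist_diff[of \<omega> "nleaves t' - nleaves u" "nleaves u - 1"] nleaves_ge_1[OF a(3)] a(6) by simp
    also have "\<dots> < \<tau> i + \<tau> i" using a by (simp add: div)
    also have "\<dots> = 1 / (2 * real (q i))" by (simp add: \<tau>_def)
    finally have "circle_dist \<omega> (nleaves t' - nleaves u) < 1 / (2 * real (q i))" .
    moreover have "real (nleaves t' - nleaves u) < real (q (Suc i)) / 14"
      if "\<not> real (q (Suc i)) / 14 / 2 \<le> real (nleaves t' - nleaves u)" using that by linarith
    ultimately show "real (q (Suc i)) / 14 / 2 \<le> real (nleaves t' - nleaves u) \<or> q i dvd nleaves t' - nleaves u"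
      unfolding j q_def using dvd_if_circle_dist_small[OF \<omega>] by blast
  qed (use t \<tau>_pos \<tau>_anti q1 in \<open>auto simp: Suc_le_eq\<close>)
  define D where "D = (\<Sum>i. ln (real (q i)) / real (q i))"
  have nn: "0 \<le> ln (real (q i)) / real (q j)" for i j using q1[of i] by simp
  have lnq: "0 \<le> ln (real (q i))" for i using q1[of i] by simp
  have W_le: "W n - s * ln (real n) \<le> C0 + 28 * D" if n: "n \<ge> n0" for n
  proof -
    \<comment> \<open>The rate \<open>1 / q i\<close> reproduces the sum of the condition, and
      \<open>28 / q (Suc i)\<close>, which is \<open>2 / M i\<close>, leaves a convergent
      series.\<close>
    have "W n \<le> (\<Sum>i=1..k n. ln (real (q (Suc i))) * (1 / real (q i) + 28 / real (q (Suc i))))"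
      unfolding W_def using ln_\<tau> by (intro sum_mono mult_mono) (use lnq in auto)
    also have "\<dots> = (\<Sum>i=1..k n. ln (real (q (Suc i))) / real (q i))
        + 28 * (\<Sum>i=1..k n. ln (real (q (Suc i))) / real (q (Suc i)))"
      by (simp add: ring_distribs sum.distrib sum_distrib_left mult.commute)
    also have "(\<Sum>i=1..k n. ln (real (q (Suc i))) / real (q i)) \<le>
        (\<Sum>j=0..k n. ln (real (q (j + 1))) / real (q j))"
      unfolding Suc_eq_plus1 by (intro sum_mono2) (use nn in auto)
    also have "(\<Sum>i=1..k n. ln (real (q (Suc i))) / real (q (Suc i))) =
        (\<Sum>i\<in>Suc ` {1..k n}. ln (real (q i)) / real (q i))"
      by (subst sum.reindex) (simp, simp only: comp_def)
    also have "\<dots> \<le> D" unfolding D_def q_def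
      by (rule sum_le_suminf[OF summable_ln_cf_denom[OF \<omega>]]) (use nn in \<open>auto simp: q_def\<close>)
    finally show ?thesis using B[OF n] unfolding B_def by simp
  qed
  obtain C' where C': "\<And>n. W n - s * ln (real n) \<le> C'"
    using bounded_of_eventually[of n0 "\<lambda>n. W n - s * ln (real n)", OF W_le] by blast
  have "cost l t \<le> real (nleaves t) * (s * ln (real (nleaves t)) + (\<bar>ln (\<tau> 1)\<bar> + C'))" if t: "proper t" for t
  proof -
    note cost[OF t]
    also have "real (nleaves t) * (\<bar>ln (\<tau> 1)\<bar> + W (nleaves t)) \<le> real (nleaves t) * (s * ln (real (nleaves t)) + (\<bar>ln (\<tau> 1)\<bar> + C'))"
      using C'[of "nleaves t"] by (intro mult_left_mono) auto
    finally show ?thesis .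
  qed
  then show ?thesis by blast
qed

section \<open>Taylor expansion indexed by words\<close>

lemma cmod_le_maxnorm: "cmod (z $ i) \<le> maxnorm z"
  unfolding maxnorm_def by (intro Max_ge) auto

lemma maxnorm_le_iff: "maxnorm z \<le> c \<longleftrightarrow> (\<forall>i. cmod (z $ i) \<le> c)"
  unfolding maxnorm_def by (subst Max_le_iff) auto

lemma maxnorm_nonneg: "0 \<le> maxnorm z"
  using cmod_le_maxnorm[of z undefined] norm_ge_zero order_trans by blast

lemma maxnorm_0 [simp]: "maxnorm 0 = 0"
  using maxnorm_le_iff[of 0 0] maxnorm_nonneg[of 0] by (auto intro: antisym)

lemma maxnorm_triangle: "maxnorm (z + w) \<le> maxnorm z + maxnorm w"
  unfolding maxnorm_le_iff
  using norm_triangle_ineq cmod_le_maxnorm by (metis add_mono order_trans vector_add_component)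

lemma maxnorm_le_norm: "maxnorm z \<le> norm z"
  unfolding maxnorm_le_iff by (simp add: Finite_Cartesian_Product.norm_nth_le)

lemma norm_le_maxnorm: "norm z \<le> real CARD('n) * maxnorm z" for z :: "complex ^ 'n::finite"
proof -
  have "norm z \<le> (\<Sum>i\<in>UNIV. cmod (z $ i))" 
    unfolding norm_vec_def by (rule L2_set_le_sum) simp
  also have "\<dots> \<le> (\<Sum>i\<in>(UNIV :: 'n set). maxnorm z)" by (intro sum_mono cmod_le_maxnorm)
  finally show ?thesis by simp
qed

definition wlists :: "'a set \<Rightarrow> nat \<Rightarrow> 'a list set" where
  "wlists A k = {ts. set ts \<subseteq> A \<and> length ts = k}"

lemma finite_wlists: "finite A \<Longrightarrow> finite (wlists A k)"
  unfolding wlists_def by (rule finite_lists_length_eq)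

lemma wlists_0 [simp]: "wlists A 0 = {[]}"
  by (auto simp: wlists_def)

lemma sum_wlists_Suc:
  assumes "finite A"
  shows "(\<Sum>ws\<in>wlists A (Suc k). f ws) = (\<Sum>a\<in>A. \<Sum>ws\<in>wlists A k. f (a # ws))"
proof -
  have eq: "wlists A (Suc k) = (\<lambda>(a, ws). a # ws) ` (A \<times> wlists A k)"
    by (auto simp: wlists_def length_Suc_conv)
  have "inj_on (\<lambda>(a, ws). a # ws) (A \<times> wlists A k)" by (auto simp: inj_on_def)
  then show ?thesis
    unfolding eq by (simp add: sum.reindex sum.cartesian_product comp_def case_prod_unfold)
qed

lemma norm_mi_power_le: "cmod (mi_power z \<alpha>) \<le> maxnorm z ^ mi_order \<alpha>"
proof -
  have "cmod (mi_power z \<alpha>) = (\<Prod>i\<in>UNIV. cmod (z $ i) ^ \<alpha> i)"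
    by (simp add: mi_power_def prod_norm[symmetric] norm_power)
  also have "\<dots> \<le> (\<Prod>i\<in>UNIV. maxnorm z ^ \<alpha> i)"
    by (intro prod_mono) (auto intro!: power_mono cmod_le_maxnorm)
  also have "\<dots> = maxnorm z ^ mi_order \<alpha>" by (simp add: mi_order_def power_sum)
  finally show ?thesis .
qed

text \<open>Each exponent gets one representative word carrying its whole coefficient, and all other
  words get 0. This avoids multinomial factors, and substituting into a word is plain
  distributivity.\<close>

lemma analytic_word_expansion:
  fixes F :: "complex ^ 'n::finite \<Rightarrow> complex ^ 'n"
  assumes "mv_analytic_on F unit_polydisk"
  obtains K M a where "K \<ge> 1" "M \<ge> 2" "\<And>j w. cmod (a j w) \<le> K * M ^ length w"
    "\<And>y j N. M * maxnorm y \<le> 1 \<Longrightarrow>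
      cmod (F y $ j - (\<Sum>k\<le>N. \<Sum>w\<in>wlists UNIV k. a j w * monom_eval y w)) \<le> K * (M * maxnorm y) ^ Suc N"
proof -
  have "(0 :: complex ^ 'n) \<in> unit_polydisk" by (simp add: unit_polydisk_def)
  then obtain \<rho> c where \<rho>: "\<rho> > 0"
    and c: "\<And>z. maxnorm z < \<rho> \<Longrightarrow> ((\<lambda>\<alpha>. mi_power z \<alpha> *s c \<alpha>) has_sum F z) UNIV"
    using assms unfolding mv_analytic_on_def by (metis diff_zero)
  define r where "r = min \<rho> 1 / 2"
  define M where "M = 1 / r"
  have r: "0 < r" "r < \<rho>" "r \<le> 1 / 2" using \<rho> by (auto simp: r_def)
  have M: "M \<ge> 2" using r by (simp add: M_def field_simps)
  define b where "b j \<alpha> = c \<alpha> $ j" for j \<alpha>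
  have comp: "((\<lambda>\<alpha>. mi_power z \<alpha> * b j \<alpha>) has_sum F z $ j) UNIV" if "maxnorm z < \<rho>" for z j
    using has_sum_bounded_linear[OF bounded_linear_vec_nth[of j] c[OF that]] by (simp add: b_def)
  define G where "G j \<alpha> = cmod (b j \<alpha>) * r ^ mi_order \<alpha>" for j and \<alpha> :: "'n \<Rightarrow> nat"
  have G_nonneg: "0 \<le> G j \<alpha>" for j \<alpha> using r by (simp add: G_def)
  have G_summable: "G j summable_on UNIV" for j
  proof -
    \<comment> \<open>Complex summability is absolute; at the point with all coordinates r it bounds
      all coefficients and all tails at once.\<close>
    define z :: "complex ^ 'n" where "z = (\<chi> i. of_real r)"
    have "maxnorm z \<le> r" using r by (simp add: maxnorm_le_iff z_def)
    then have "(\<lambda>\<alpha>. mi_power z \<alpha> * b j \<alpha>) summable_on UNIV"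
      using comp[of z j] r by (auto simp: summable_on_def)
    then have "(\<lambda>\<alpha>. norm (mi_power z \<alpha> * b j \<alpha>)) summable_on UNIV"
      by (simp add: summable_on_iff_abs_summable_on_complex)
    moreover have "norm (mi_power z \<alpha> * b j \<alpha>) = G j \<alpha>" for \<alpha>
      using r by (simp add: G_def norm_mult mi_power_def z_def prod_norm[symmetric] norm_power
          mi_order_def power_sum mult.commute)
    ultimately show ?thesis by simp
  qed
  define K where "K = 1 + (\<Sum>j\<in>UNIV. infsum (G j) UNIV)"
  have GK: "infsum (G j) UNIV \<le> K" for j
  proof -
    have "infsum (G j) UNIV \<le> (\<Sum>j\<in>UNIV. infsum (G j) UNIV)"
      by (rule member_le_sum) (auto intro!: infsum_nonneg G_nonneg)
    then show ?thesis by (simp add: K_def)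
  qed
  have "K \<ge> 1" unfolding K_def by (simp add: sum_nonneg infsum_nonneg G_nonneg)
  have b_le: "cmod (b j \<alpha>) \<le> K * M ^ mi_order \<alpha>" for j \<alpha>
  proof -
    have "sum (G j) {\<alpha>} \<le> infsum (G j) UNIV"
      by (rule finite_sum_le_infsum[OF G_summable]) (auto simp: G_nonneg)
    then have "G j \<alpha> \<le> K" using GK[of j] by simp
    then show ?thesis using r by (simp add: G_def M_def field_simps)
  qed
  define word :: "('n \<Rightarrow> nat) \<Rightarrow> 'n list" where "word \<alpha> = (SOME xs. count (mset xs) = \<alpha>)" for \<alpha>
  have word: "count (mset (word \<alpha>)) = \<alpha>" for \<alpha>
    unfolding word_def by (rule someI_ex) (rule ex_word)
  define a where "a j w = (if w = word (count (mset w)) then b j (count (mset w)) else 0)" for j w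
  have a_le: "cmod (a j w) \<le> K * M ^ length w" for j w
    using b_le[of j "count (mset w)"] \<open>K \<ge> 1\<close> M by (simp add: a_def mi_order_count)
  have a_sum: "(\<Sum>w\<in>wlists UNIV k. a j w * monom_eval y w) = (\<Sum>\<alpha> | mi_order \<alpha> = k. mi_power y \<alpha> * b j \<alpha>)"
    for j y k
  proof -
    have "length (word \<alpha>) = mi_order \<alpha>" for \<alpha> using mi_order_count[of "word \<alpha>"] by (simp add: word)
    then have sub: "word ` {\<alpha>. mi_order \<alpha> = k} \<subseteq> wlists UNIV k" by (auto simp: wlists_def)
    have "inj_on word {\<alpha>. mi_order \<alpha> = k}" using word by (metis inj_onI)
    then have "(\<Sum>\<alpha> | mi_order \<alpha> = k. mi_power y \<alpha> * b j \<alpha>) =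
        (\<Sum>w\<in>word ` {\<alpha>. mi_order \<alpha> = k}. a j w * monom_eval y w)"
      by (simp add: sum.reindex a_def word monom_eval_eq_mi_power mult.commute)
    also have "\<dots> = (\<Sum>w\<in>wlists UNIV k. a j w * monom_eval y w)"
    proof (rule sum.mono_neutral_left[OF finite_wlists sub], simp, safe)
      fix w assume w: "w \<in> wlists UNIV k" "w \<notin> word ` {\<alpha>. mi_order \<alpha> = k}"
      then have "mi_order (count (mset w)) = k" by (simp add: mi_order_count wlists_def)
      then have "w \<noteq> word (count (mset w))" using w(2) by blast
      then show "a j w * monom_eval y w = 0" by (simp add: a_def)
    qed
    finally show ?thesis by simp
  qed
  have "cmod (F y $ j - (\<Sum>k\<le>N. \<Sum>w\<in>wlists UNIV k. a j w * monom_eval y w)) \<le> K * (M * maxnorm y) ^ Suc N"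
    if y: "M * maxnorm y \<le> 1" for y j N
  proof -
    define S where "S = {\<alpha> :: 'n \<Rightarrow> nat. mi_order \<alpha> < Suc N}"
    have finS: "finite S" unfolding S_def by (rule finite_mi_order)
    define t where "t \<alpha> = mi_power y \<alpha> * b j \<alpha>" for \<alpha>
    have yr: "maxnorm y \<le> r" using y r by (simp add: M_def field_simps)
    then have t_sum: "(t has_sum F y $ j) UNIV" using comp[of y j] r unfolding t_def by simp
    then have "t summable_on UNIV" by (auto simp: summable_on_def)
    then have "t summable_on (UNIV - S)" by (rule summable_on_subset) simp
    then obtain T where T: "(t has_sum T) (UNIV - S)" by (auto simp: summable_on_def)
    have "(t has_sum (sum t S + T)) (S \<union> (UNIV - S))"
      by (rule has_sum_Un_disjoint[OF has_sum_finite[OF finS] T]) auto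
    then have T_eq: "F y $ j = sum t S + T" using t_sum has_sum_unique by fastforce
    have "sum t S = (\<Sum>k\<in>{..N}. \<Sum>\<alpha> | \<alpha> \<in> S \<and> mi_order \<alpha> = k. t \<alpha>)"
      by (rule sum.group[symmetric, OF finS]) (auto simp: S_def)
    also have "\<dots> = (\<Sum>k\<le>N. \<Sum>w\<in>wlists UNIV k. a j w * monom_eval y w)"
      unfolding a_sum t_def by (intro sum.cong) (auto simp: S_def)
    finally have "F y $ j - (\<Sum>k\<le>N. \<Sum>w\<in>wlists UNIV k. a j w * monom_eval y w) = T"
      using T_eq by simp
    moreover have "norm T \<le> (M * maxnorm y) ^ Suc N * infsum (G j) (UNIV - S)"
    proof (rule norm_infsum_le[OF T])
      have "G j summable_on (UNIV - S)" using G_summable by (rule summable_on_subset) auto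
      then have "(G j has_sum infsum (G j) (UNIV - S)) (UNIV - S)" by (rule has_sum_infsum)
      then show "((\<lambda>\<alpha>. (M * maxnorm y) ^ Suc N * G j \<alpha>) has_sum
          (M * maxnorm y) ^ Suc N * infsum (G j) (UNIV - S)) (UNIV - S)"
        by (rule has_sum_cmult_right)
      fix \<alpha> assume "\<alpha> \<in> UNIV - S"
      then have \<alpha>: "Suc N \<le> mi_order \<alpha>" by (simp add: S_def)
      have "cmod (mi_power y \<alpha>) \<le> maxnorm y ^ mi_order \<alpha>" by (rule norm_mi_power_le)
      also have "\<dots> = (M * maxnorm y) ^ mi_order \<alpha> * r ^ mi_order \<alpha>"
        using r by (simp add: M_def power_mult_distrib[symmetric])
      also have "\<dots> \<le> (M * maxnorm y) ^ Suc N * r ^ mi_order \<alpha>"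
        using r M y \<alpha> maxnorm_nonneg[of y] by (intro mult_right_mono power_decreasing) auto
      finally have "cmod (mi_power y \<alpha>) * cmod (b j \<alpha>) \<le>
          ((M * maxnorm y) ^ Suc N * r ^ mi_order \<alpha>) * cmod (b j \<alpha>)"
        by (rule mult_right_mono) simp
      then show "norm (t \<alpha>) \<le> (M * maxnorm y) ^ Suc N * G j \<alpha>"
        by (simp add: t_def G_def norm_mult mult_ac)
    qed
    moreover have "infsum (G j) (UNIV - S) \<le> K"
    proof -
      have "infsum (G j) (UNIV - S) \<le> infsum (G j) UNIV"
        using summable_on_subset[OF G_summable[of j], of "UNIV - S"] G_summable[of j]
        by (rule infsum_mono_neutral) (auto simp: G_nonneg)
      then show ?thesis using GK[of j] by simp
    qed
    then have "(M * maxnorm y) ^ Suc N * infsum (G j) (UNIV - S) \<le> (M * maxnorm y) ^ Suc N * K"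
      using M maxnorm_nonneg[of y] by (intro mult_left_mono) auto
    ultimately show ?thesis by (simp add: mult.commute)
  qed
  then show ?thesis by (rule that[of K M a, OF \<open>K \<ge> 1\<close> M a_le])
qed

text \<open>Words of length 0 and 1 are matched with \<open>f 0 = 0\<close> and the derivative along
  each axis, so the nonlinear part starts at length 2.\<close>

lemma word_expansion:
  fixes F f :: "complex ^ 'n::finite \<Rightarrow> complex ^ 'n"
  assumes analytic: "mv_analytic_on F unit_polydisk"
    and F_eq: "\<And>z. z \<in> unit_polydisk \<Longrightarrow> F z = diag_matrix l *v z + f z"
    and f_zero: "f 0 = 0"
    and Df_zero: "(f has_derivative (\<lambda>_. 0)) (at 0)"
  obtains K M a where "K \<ge> 1" "M \<ge> 2" "\<And>j w. cmod (a j w) \<le> K * M ^ length w"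
    "\<And>y j N. M * maxnorm y \<le> 1 \<Longrightarrow> 1 \<le> N \<Longrightarrow>
      cmod (F y $ j - (l $ j * y $ j + (\<Sum>k=2..N. \<Sum>w\<in>wlists UNIV k. a j w * monom_eval y w)))
        \<le> K * (M * maxnorm y) ^ Suc N"
proof -
  obtain K M a where K: "K \<ge> 1" "M \<ge> 2" and a: "\<And>j w. cmod (a j w) \<le> K * M ^ length w"
    and ex: "\<And>y j N. M * maxnorm y \<le> 1 \<Longrightarrow>
      cmod (F y $ j - (\<Sum>k\<le>N. \<Sum>w\<in>wlists UNIV k. a j w * monom_eval y w)) \<le> K * (M * maxnorm y) ^ Suc N"
    using analytic_word_expansion[OF analytic] by blast
  have diag: "(diag_matrix l *v y) $ j = l $ j * y $ j" for y j
    by (simp add: diag_matrix_def matrix_vector_mult_def if_distrib[of "\<lambda>x. x * _"] cong: if_cong)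
  have poly: "y \<in> unit_polydisk" if "maxnorm y \<le> 1 / 2" for y :: "complex ^ 'n"
    using that unfolding unit_polydisk_def maxnorm_le_iff by (smt (verit) field_sum_of_halves mem_Collect_eq)
  have F: "F y $ j = l $ j * y $ j + f y $ j" if "maxnorm y \<le> 1 / 2" for y j
    using F_eq[OF poly[OF that]] diag by simp
  have a_Nil: "a j [] = 0" for j
    using ex[of 0 j 0] F[of 0 j] f_zero by simp
  have one: "(\<Sum>w\<in>wlists UNIV 1. g w) = (\<Sum>i\<in>(UNIV :: 'n set). g [i])" for g :: "'n list \<Rightarrow> complex"
    using sum_wlists_Suc[of UNIV g 0] by simp
  have a_one: "a j [i] = (if i = j then l $ j else 0)" for i j
  proof -
    define D where "D = cmod ((if i = j then l $ j else 0) - a j [i])"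
    have "D \<le> e" if e: "e > 0" for e
    proof -
      obtain d where d: "d > 0" "\<And>y. norm y < d \<Longrightarrow> norm (f y) \<le> e / 2 * norm y"
        using conjunct2[OF Df_zero[unfolded has_derivative_at_alt], rule_format, of "e / 2"] e
        by (auto simp: f_zero)
      \<comment> \<open>Small enough for the derivative estimate, for the validity of the expansion,
        and to make the quadratic remainder at most \<open>e / 2 * t\<close>.\<close>
      define t where "t = min (min (d / 2) (1 / M)) (e / (2 * K * M\<^sup>2))"
      have t: "0 < t" "t < d" "t \<le> 1 / M" "t \<le> e / (2 * K * M\<^sup>2)"
        using d e K by (auto simp: t_def)
      have tM: "M * t \<le> 1" "t \<le> 1 / 2" "K * M\<^sup>2 * t \<le> e / 2"
      proof -
        show "M * t \<le> 1" using t(3) K by (simp add: field_simps)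
        have "1 / M \<le> 1 / 2" using K by (intro divide_left_mono) auto
        then show "t \<le> 1 / 2" using t(3) by linarith
        show "K * M\<^sup>2 * t \<le> e / 2" using t(4) K by (simp add: field_simps)
      qed
      define y :: "complex ^ 'n" where "y = axis i (of_real t)"
      have y: "y $ k = (if k = i then of_real t else 0)" for k by (simp add: y_def axis_def)
      have my: "maxnorm y \<le> t" unfolding maxnorm_le_iff using t by (simp add: y)
      have "y = t *\<^sub>R axis i 1" by (simp add: vec_eq_iff y axis_def of_real_def)
      then have ny: "norm y = t" using t by (simp add: norm_axis_1)
      have "M * maxnorm y \<le> 1" using my tM K by (meson mult_left_mono order_trans zero_le_numeral)
      from ex[OF this, of j 1] have "cmod (F y $ j - a j [i] * of_real t) \<le> K * (M * maxnorm y) ^ 2"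
        by (simp add: one[unfolded One_nat_def] a_Nil y if_distrib[of "\<lambda>x. _ * x"] numeral_2_eq_2 cong: if_cong)
      also have "\<dots> \<le> K * (M * t) ^ 2"
        using K my maxnorm_nonneg[of y] by (intro mult_left_mono power_mono) auto
      finally have 1: "cmod (F y $ j - a j [i] * of_real t) \<le> K * M\<^sup>2 * t * t"
        by (simp add: power2_eq_square mult_ac)
      have "cmod (f y $ j) \<le> e / 2 * t" using d(2)[of y] ny t Finite_Cartesian_Product.norm_nth_le[of "f y" j] by simp
      moreover have "D * t = cmod ((F y $ j - a j [i] * of_real t) - f y $ j)"
      proof -
        have "(F y $ j - a j [i] * of_real t) - f y $ j = ((if i = j then l $ j else 0) - a j [i]) * of_real t"
          using F[of y j] my tM by (auto simp: y algebra_simps)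
        then show ?thesis using t by (simp add: D_def norm_mult)
      qed
      ultimately have "D * t \<le> K * M\<^sup>2 * t * t + e / 2 * t"
        using 1 norm_triangle_ineq4[of "F y $ j - a j [i] * of_real t" "f y $ j"] by linarith
      also have "\<dots> \<le> e / 2 * t + e / 2 * t" using tM(3) t by (intro add_right_mono mult_right_mono) auto
      finally show "D \<le> e" using t by simp
    qed
    then have "D \<le> 0" by (rule field_le_epsilon[of D 0, simplified])
    then show ?thesis by (simp add: D_def)
  qed
  have "cmod (F y $ j - (l $ j * y $ j + (\<Sum>k=2..N. \<Sum>w\<in>wlists UNIV k. a j w * monom_eval y w)))
        \<le> K * (M * maxnorm y) ^ Suc N" if "M * maxnorm y \<le> 1" "1 \<le> N" for y j N
  proof -
    let ?s = "\<lambda>k. \<Sum>w\<in>wlists UNIV k. a j w * monom_eval y w"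
    have set_eq: "{..N} = insert 0 (insert 1 {2..N})" using that(2) by auto
    have "(\<Sum>k\<le>N. ?s k) = ?s 0 + (?s 1 + (\<Sum>k=2..N. ?s k))" unfolding set_eq by simp
    also have "?s 1 = l $ j * y $ j"
      by (simp only: one) (simp add: a_one if_distrib[of "\<lambda>x. x * _"] cong: if_cong)
    finally show ?thesis using ex[OF that(1), of j N] by (simp add: a_Nil)
  qed
  then show ?thesis by (rule that[of K M a, OF K a])
qed

section \<open>The truncated linearization\<close>

fun tcoef :: "('n \<Rightarrow> 'n list \<Rightarrow> complex) \<Rightarrow> complex ^ 'n \<Rightarrow> 'n tree \<Rightarrow> complex" where
  "tcoef a l (Leaf i) = 1"
| "tcoef a l (Node j ts) = a j (map root_label ts) / (monom_eval l (leaves (Node j ts)) - l $ j)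
     * prod_list (map (tcoef a l) ts)"

text \<open>Majorant of \<open>tcoef\<close> without its divisors, which are accounted for by
  \<open>exp (cost l t)\<close>.\<close>

fun tweight :: "real \<Rightarrow> real \<Rightarrow> 'n tree \<Rightarrow> real" where
  "tweight K M (Leaf i) = 1"
| "tweight K M (Node j ts) = K * M ^ length ts * prod_list (map (tweight K M) ts)"

definition trees :: "nat \<Rightarrow> 'n tree set" where
  "trees N = {t. proper t \<and> nleaves t \<le> N}"

lemma prod_list_map_mult:
  fixes f g :: "'a \<Rightarrow> 'b::comm_monoid_mult"
  shows "prod_list (map (\<lambda>t. f t * g t) ts) = prod_list (map f ts) * prod_list (map g ts)"
  by (induction ts) (auto simp: mult_ac)

lemma prod_list_map_nonneg:
  fixes f :: "'a \<Rightarrow> real"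
  shows "(\<And>t. t \<in> set ts \<Longrightarrow> 0 \<le> f t) \<Longrightarrow> 0 \<le> prod_list (map f ts)"
  by (induction ts) auto

lemma prod_list_map_mono:
  fixes f g :: "'a \<Rightarrow> real"
  assumes "\<And>t. t \<in> set ts \<Longrightarrow> 0 \<le> f t \<and> f t \<le> g t"
  shows "prod_list (map f ts) \<le> prod_list (map g ts)"
  using assms
proof (induction ts)
  case (Cons t ts)
  then show ?case using prod_list_map_nonneg[of ts f]
    by (auto intro!: mult_mono intro: order_trans)
qed simp

lemma prod_list_power:
  fixes x :: "'b::comm_monoid_mult"
  shows "prod_list (map (\<lambda>t. x ^ f t) ts) = x ^ sum_list (map f ts)"
  by (induction ts) (auto simp: power_add)

lemma norm_prod_list: "cmod (prod_list (map f ts)) = prod_list (map (\<lambda>t. cmod (f t)) ts)"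
  by (induction ts) (auto simp: norm_mult)

lemma exp_sum_list: "exp (sum_list (map f ts)) = prod_list (map (\<lambda>t. exp (f t :: real)) ts)"
  by (induction ts) (auto simp: exp_add)

lemma monom_eval_concat: "monom_eval w (concat (map f ts)) = prod_list (map (\<lambda>t. monom_eval w (f t)) ts)"
  by (induction ts) (auto simp: monom_eval_append)

lemma tweight_nonneg: "0 \<le> K \<Longrightarrow> 0 \<le> M \<Longrightarrow> 0 \<le> tweight K M t"
  by (induction t) (auto intro!: mult_nonneg_nonneg prod_list_map_nonneg)

lemma divisor_pos:
  assumes "non_resonant l" "proper t" "is_node t"
  shows "0 < divisor l t"
  using assms nleaves_node_ge_2[OF assms(2,3)]
  by (simp add: divisor_def non_resonant_def monom_eval_eq_mi_power mi_order_count nleaves_def)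

lemma tcoef_le:
  assumes nonres: "non_resonant l" and K: "0 \<le> K" "0 \<le> M"
    and a: "\<And>j w. cmod (a j w) \<le> K * M ^ length w" and "proper t"
  shows "cmod (tcoef a l t) \<le> tweight K M t * exp (cost l t)"
  using \<open>proper t\<close>
proof (induction t)
  case (Node j ts)
  define d where "d = divisor l (Node j ts)"
  have d: "0 < d" unfolding d_def using divisor_pos[OF nonres Node.prems] by simp
  have "cmod (tcoef a l (Node j ts)) =
      cmod (a j (map root_label ts)) / d * prod_list (map (\<lambda>t. cmod (tcoef a l t)) ts)"
    by (simp add: d_def divisor_def norm_mult norm_divide norm_prod_list)
  also have "\<dots> \<le> (K * M ^ length ts) / d * prod_list (map (\<lambda>t. tweight K M t * exp (cost l t)) ts)"
    using a[of j "map root_label ts"] Node d K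
    by (intro mult_mono divide_right_mono prod_list_map_mono prod_list_map_nonneg) auto
  also have "exp (cost l (Node j ts)) = inverse d * prod_list (map (\<lambda>t. exp (cost l t)) ts)"
    using d by (simp only: cost.simps exp_add exp_minus exp_ln d_def[symmetric] exp_sum_list)
  then have "(K * M ^ length ts) / d * prod_list (map (\<lambda>t. tweight K M t * exp (cost l t)) ts) =
      tweight K M (Node j ts) * exp (cost l (Node j ts))"
    by (simp add: prod_list_map_mult divide_inverse)
  finally show ?case .
qed simp

text \<open>Properness is what bounds the set: a node has at most as many children as leaves, and
  each child has fewer leaves.\<close>

lemma finite_trees: "finite (trees N :: 'n::finite tree set)"
proof (induction N)
  case 0
  have "trees 0 = ({} :: 'n tree set)" using nleaves_ge_1 by (force simp: trees_def)
  then show ?case by simp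
next
  case (Suc N)
  have "(trees (Suc N) :: 'n tree set) \<subseteq> range Leaf \<union>
      (\<lambda>(j, ts). Node j ts) ` (UNIV \<times> {ts. set ts \<subseteq> trees N \<and> length ts \<le> Suc N})"
  proof
    fix t :: "'n tree" assume t: "t \<in> trees (Suc N)"
    show "t \<in> range Leaf \<union>
      (\<lambda>(j, ts). Node j ts) ` (UNIV \<times> {ts. set ts \<subseteq> trees N \<and> length ts \<le> Suc N})"
    proof (cases t)
      case (Node j ts)
      have p: "proper (Node j ts)" "nleaves (Node j ts) \<le> Suc N" using t Node by (auto simp: trees_def)
      have "set ts \<subseteq> trees N"
      proof
        fix u assume u: "u \<in> set ts"
        then show "u \<in> trees N" using nleaves_child_less[OF p(1) u] p by (auto simp: trees_def)
      qed
      moreover have "length ts \<le> Suc N" using length_le_lv_Node[OF p(1)] p(2) by linarith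
      ultimately show ?thesis using Node by auto
    qed simp
  qed
  moreover have "finite ((\<lambda>(j, ts). Node j ts) ` ((UNIV :: 'n set) \<times> {ts. set ts \<subseteq> trees N \<and> length ts \<le> Suc N}))"
    using finite_lists_length_le[OF Suc] by (intro finite_imageI finite_cartesian_product) auto
  ultimately show ?case by (meson finite_UnI finite_imageI finite finite_subset)
qed

lemma sum_wlists_prod:
  fixes g :: "'a \<Rightarrow> 'b::comm_semiring_1"
  assumes "finite A"
  shows "(\<Sum>ts\<in>wlists A k. prod_list (map g ts)) = (\<Sum>t\<in>A. g t) ^ k"
  by (induction k) (simp_all add: sum_wlists_Suc[OF assms] sum_distrib_left[symmetric] sum_distrib_right)

text \<open>Substitution of a sum over trees into a homogeneous polynomial: a word of labels expands
  into the lists of trees with these root labels. The coefficient function is generalized because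
  the first letter is absorbed into it.\<close>

lemma sum_wlists_root_label:
  fixes v :: "'n::finite tree \<Rightarrow> complex"
  assumes "finite A"
  shows "(\<Sum>w\<in>wlists UNIV k. b w * prod_list (map (\<lambda>i. \<Sum>t | t \<in> A \<and> root_label t = i. v t) w)) =
    (\<Sum>ts\<in>wlists A k. b (map root_label ts) * prod_list (map v ts))"
proof (induction k arbitrary: b)
  case (Suc k)
  let ?y = "\<lambda>i. \<Sum>t | t \<in> A \<and> root_label t = i. v t"
  let ?R = "\<lambda>j. \<Sum>ts\<in>wlists A k. b (j # map root_label ts) * prod_list (map v ts)"
  have "(\<Sum>w\<in>wlists UNIV (Suc k). b w * prod_list (map ?y w)) =
      (\<Sum>j\<in>UNIV. \<Sum>w\<in>wlists UNIV k. b (j # w) * prod_list (map ?y (j # w)))"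
    by (rule sum_wlists_Suc) simp
  also have "\<dots> = (\<Sum>j\<in>UNIV. ?y j * (\<Sum>w\<in>wlists UNIV k. b (j # w) * prod_list (map ?y w)))"
    by (simp add: sum_distrib_left mult_ac)
  also have "\<dots> = (\<Sum>j\<in>UNIV. ?y j * ?R j)" using Suc[of "\<lambda>w. b (_ # w)"] by simp
  also have "\<dots> = (\<Sum>j\<in>UNIV. \<Sum>t | t \<in> A \<and> root_label t = j. v t * ?R (root_label t))"
    by (simp add: sum_distrib_right)
  also have "\<dots> = (\<Sum>t\<in>A. v t * ?R (root_label t))"
    by (rule sum.group[OF assms]) auto
  also have "\<dots> = (\<Sum>t\<in>A. \<Sum>ts\<in>wlists A k. b (map root_label (t # ts)) * prod_list (map v (t # ts)))"
    by (simp add: sum_distrib_left mult_ac)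
  also have "\<dots> = (\<Sum>ts\<in>wlists A (Suc k). b (map root_label ts) * prod_list (map v ts))"
    by (rule sum_wlists_Suc[symmetric, OF assms])
  finally show ?case .
qed simp

lemma sum_power_ge_2_le:
  fixes y :: real
  assumes "0 \<le> y" "y \<le> 1 / 2"
  shows "(\<Sum>k=2..N. y ^ k) \<le> 2 * y\<^sup>2"
proof (cases "N \<ge> 2")
  case True
  \<comment> \<open>The subtracted last power makes the bound inductive.\<close>
  have "(\<Sum>k=2..N. y ^ k) \<le> 2 * y\<^sup>2 - y ^ N" using True
  proof (induction N rule: dec_induct)
    case base
    then show ?case by simp
  next
    case (step n)
    have "2 * y ^ Suc n \<le> y ^ n" using assms mult_right_mono[of "2 * y" 1 "y ^ n"] by simp
    then show ?case using step by simp
  qed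
  then show ?thesis using assms by (smt (verit) zero_le_power)
qed (use assms in simp)

definition nodes :: "nat \<Rightarrow> 'n tree set" where
  "nodes N = {t \<in> trees N. is_node t}"

lemma trees_split: "N \<ge> 1 \<Longrightarrow> trees N = range Leaf \<union> nodes N"
proof -
  assume "N \<ge> 1"
  have "t \<in> range Leaf \<or> is_node t" for t :: "'a tree" by (cases t) auto
  then show ?thesis using \<open>N \<ge> 1\<close> by (auto simp: trees_def nodes_def)
qed

lemma finite_nodes: "finite (nodes N :: 'n::finite tree set)"
  unfolding nodes_def by (rule finite_subset[OF _ finite_trees]) auto

lemma sum_trees_split:
  fixes g :: "'n::finite tree \<Rightarrow> 'b::comm_monoid_add"
  assumes "N \<ge> 1"
  shows "(\<Sum>t\<in>trees N. g t) = (\<Sum>i\<in>UNIV. g (Leaf i)) + (\<Sum>t\<in>nodes N. g t)"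
proof -
  have "(\<Sum>t\<in>trees N. g t) = (\<Sum>t\<in>range Leaf. g t) + (\<Sum>t\<in>nodes N. g t)"
    unfolding trees_split[OF assms]
    by (rule sum.union_disjoint) (auto simp: finite_nodes, auto simp: nodes_def)
  then show ?thesis by (simp add: sum.reindex inj_on_def)
qed

text \<open>Children of a node with at most N + 1 leaves lie in \<open>trees N\<close>. Allowing
  arbitrary lists of such children only adds nonnegative terms, and the sum then factors into powers
  of M times the sum over \<open>trees N\<close>.\<close>

lemma sum_tree_weights_nodes:
  fixes x K M :: real
  assumes K: "K \<ge> 0" "M \<ge> 0" and x: "x \<ge> 0"
    and S: "M * (\<Sum>t\<in>(trees N :: 'n::finite tree set). tweight K M t * x ^ nleaves t) \<le> 1 / 2"
  shows "(\<Sum>t\<in>(nodes (Suc N) :: 'n tree set). tweight K M t * x ^ nleaves t) \<le>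
     real CARD('n) * K * (2 * (M * (\<Sum>t\<in>(trees N :: 'n tree set). tweight K M t * x ^ nleaves t))\<^sup>2)"
proof -
  define g where "g t = tweight K M t * x ^ nleaves t" for t :: "'n tree"
  define S where "S = (\<Sum>t\<in>trees N. g t)"
  have g: "0 \<le> g t" for t unfolding g_def using K x by (simp add: tweight_nonneg)
  have g_Node: "g (Node j ts) = K * M ^ length ts * prod_list (map g ts)" for j ts
    by (simp add: g_def[abs_def] prod_list_map_mult prod_list_power)
  define I where "I = (SIGMA j:(UNIV :: 'n set). SIGMA k:{2..Suc N}. wlists (trees N :: 'n tree set) k)"
  have finI: "finite I" unfolding I_def by (intro finite_SigmaI finite_wlists finite_trees) auto
  have sub: "nodes (Suc N) \<subseteq> (\<lambda>(j, k, ts). Node j ts) ` I"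
  proof
    fix t :: "'n tree" assume t: "t \<in> nodes (Suc N)"
    then obtain j ts where Node: "t = Node j ts" by (cases t) (auto simp: nodes_def)
    have p: "proper (Node j ts)" "nleaves (Node j ts) \<le> Suc N" using t Node by (auto simp: nodes_def trees_def)
    have "set ts \<subseteq> trees N"
    proof
      fix u assume u: "u \<in> set ts"
      then show "u \<in> trees N" using nleaves_child_less[OF p(1) u] p by (auto simp: trees_def)
    qed
    moreover have "length ts \<le> Suc N" using length_le_lv_Node[OF p(1)] p(2) by linarith
    ultimately have "(j, length ts, ts) \<in> I" using p(1) by (auto simp: I_def wlists_def)
    then show "t \<in> (\<lambda>(j, k, ts). Node j ts) ` I" using Node by (force intro: image_eqI[rotated])
  qed
  have "(\<Sum>t\<in>nodes (Suc N). g t) \<le> (\<Sum>t\<in>(\<lambda>(j, k, ts). Node j ts) ` I. g t)"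
    by (rule sum_mono2) (use sub finI g in auto)
  also have "\<dots> \<le> (\<Sum>p\<in>I. (g \<circ> (\<lambda>(j, k, ts). Node j ts)) p)"
    by (rule sum_image_le) (use finI g in auto)
  also have "\<dots> = (\<Sum>j\<in>(UNIV :: 'n set). \<Sum>k=2..Suc N. \<Sum>ts\<in>wlists (trees N) k. g (Node j ts))"
  proof -
    have "(\<Sum>k=2..Suc N. \<Sum>ts\<in>wlists (trees N) k. g (Node j ts)) =
        (\<Sum>(k, ts)\<in>(SIGMA k:{2..Suc N}. wlists (trees N) k). g (Node j ts))" for j :: 'n
      by (rule sum.Sigma) (auto simp: finite_wlists finite_trees)
    then have "(\<Sum>j\<in>(UNIV :: 'n set). \<Sum>k=2..Suc N. \<Sum>ts\<in>wlists (trees N) k. g (Node j ts)) =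
        (\<Sum>j\<in>(UNIV :: 'n set). \<Sum>(k, ts)\<in>(SIGMA k:{2..Suc N}. wlists (trees N) k). g (Node j ts))"
      by (simp only:)
    also have "\<dots> = (\<Sum>(j, k, ts)\<in>I. g (Node j ts))" unfolding I_def
      by (rule sum.Sigma) (auto intro!: finite_SigmaI simp: finite_wlists finite_trees)
    finally show ?thesis by (simp add: comp_def case_prod_unfold)
  qed
  also have "\<dots> = (\<Sum>j\<in>(UNIV :: 'n set). \<Sum>k=2..Suc N. K * (M * S) ^ k)"
  proof (intro sum.cong refl)
    fix j :: 'n and k
    have "(\<Sum>ts\<in>wlists (trees N) k. g (Node j ts)) = (\<Sum>ts\<in>wlists (trees N) k. K * M ^ k * prod_list (map g ts))"
      by (intro sum.cong) (auto simp: g_Node wlists_def)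
    also have "\<dots> = K * M ^ k * S ^ k"
      by (simp add: sum_distrib_left[symmetric] sum_wlists_prod[OF finite_trees] S_def)
    finally show "(\<Sum>ts\<in>wlists (trees N) k. g (Node j ts)) = K * (M * S) ^ k"
      by (simp add: power_mult_distrib)
  qed
  also have "\<dots> = real CARD('n) * K * (\<Sum>k=2..Suc N. (M * S) ^ k)"
    by (simp add: sum_distrib_left mult.assoc del: sum.cl_ivl_Suc)
  also have "\<dots> \<le> real CARD('n) * K * (2 * (M * S)\<^sup>2)"
    using K assms(4) g by (intro mult_left_mono sum_power_ge_2_le) (auto simp: S_def sum_nonneg g_def[symmetric])
  finally show ?thesis unfolding S_def g_def .
qed

lemma nodes_0: "nodes 0 = {}"
  using nleaves_ge_1 by (force simp: trees_def nodes_def)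

text \<open>The sums obey S' <= n * x + 2 * n * K * (M * S)^2, and for small x the bound 2 * n * x
  reproduces itself, uniformly in N. The inner nodes alone are quadratic in x, which makes the
  nonlinear part of the linearization a contraction.\<close>

lemma sum_tree_weights:
  fixes x K M :: real
  assumes K: "K \<ge> 0" "M \<ge> 0" and x: "x \<ge> 0" "4 * real CARD('n) * M * x \<le> 1"
    "8 * (real CARD('n))\<^sup>2 * K * M\<^sup>2 * x \<le> 1"
  shows "(\<Sum>t\<in>(trees N :: 'n::finite tree set). tweight K M t * x ^ nleaves t) \<le> 2 * real CARD('n) * x" (is ?A)
    and "(\<Sum>t\<in>(nodes N :: 'n tree set). tweight K M t * x ^ nleaves t) \<le> 8 * real CARD('n) ^ 3 * K * M\<^sup>2 * x\<^sup>2" (is ?B)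
proof -
  let ?n = "real CARD('n)"
  let ?S = "\<lambda>N. \<Sum>t\<in>(trees N :: 'n tree set). tweight K M t * x ^ nleaves t"
  have S_nonneg: "0 \<le> ?S N" for N using K x by (intro sum_nonneg) (simp add: tweight_nonneg)
  have step: "(\<Sum>t\<in>(nodes (Suc N) :: 'n tree set). tweight K M t * x ^ nleaves t) \<le> 8 * ?n ^ 3 * K * M\<^sup>2 * x\<^sup>2"
    if "?S N \<le> 2 * ?n * x" for N
  proof -
    have MS: "M * ?S N \<le> M * (2 * ?n * x)" using that K by (intro mult_left_mono) auto
    then have "M * ?S N \<le> 1 / 2" using x(2) by (simp add: mult_ac)
    from sum_tree_weights_nodes[OF K x(1) this]
    have "(\<Sum>t\<in>(nodes (Suc N) :: 'n tree set). tweight K M t * x ^ nleaves t) \<le> ?n * K * (2 * (M * ?S N)\<^sup>2)" .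
    also have "(M * ?S N)\<^sup>2 \<le> (M * (2 * ?n * x))\<^sup>2"
      using MS K S_nonneg[of N] by (intro power_mono) auto
    then have "?n * K * (2 * (M * ?S N)\<^sup>2) \<le> ?n * K * (2 * (M * (2 * ?n * x))\<^sup>2)"
      using K by (intro mult_left_mono) auto
    also have "\<dots> = 8 * ?n ^ 3 * K * M\<^sup>2 * x\<^sup>2" by (simp add: power2_eq_square power3_eq_cube)
    finally show ?thesis .
  qed
  have A: "?S N \<le> 2 * ?n * x" for N
  proof (induction N)
    case 0
    have "trees 0 = ({} :: 'n tree set)" using nleaves_ge_1 by (force simp: trees_def)
    then show ?case using x by simp
  next
    case (Suc N)
    have "?S (Suc N) \<le> ?n * x + 8 * ?n ^ 3 * K * M\<^sup>2 * x\<^sup>2"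
      using step[OF Suc] by (simp add: sum_trees_split)
    also have "8 * ?n ^ 3 * K * M\<^sup>2 * x\<^sup>2 = (8 * ?n\<^sup>2 * K * M\<^sup>2 * x) * (?n * x)"
      by (simp add: power2_eq_square power3_eq_cube)
    also have "\<dots> \<le> 1 * (?n * x)" using x by (intro mult_right_mono) auto
    finally show ?case by (simp add: mult_ac)
  qed
  show ?A by (rule A)
  show ?B
  proof (cases N)
    case 0
    then show ?thesis using K x by (simp add: nodes_0)
  next
    case (Suc n)
    then show ?thesis using step[OF A] by simp
  qed
qed

text \<open>The leaf condition is kept as an \<open>if\<close> over all lists, so that the sum can
  be subtracted termwise from an unrestricted one.\<close>

lemma sum_nodes_root_label:
  fixes \<phi> :: "'n::finite tree \<Rightarrow> 'b::comm_monoid_add"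
  shows "(\<Sum>t | t \<in> nodes N \<and> root_label t = j. \<phi> t) =
    (\<Sum>k=2..N. \<Sum>ts\<in>wlists (trees N) k. if sum_list (map nleaves ts) \<le> N then \<phi> (Node j ts) else 0)"
proof -
  define I where "I = (SIGMA k:{2..N}. {ts \<in> wlists (trees N :: 'n tree set) k. sum_list (map nleaves ts) \<le> N})"
  have "bij_betw (\<lambda>(k, ts). Node j ts) I {t. t \<in> nodes N \<and> root_label t = j}"
  proof (rule bij_betwI')
    fix p assume "p \<in> I"
    then show "(case p of (k, ts) \<Rightarrow> Node j ts) \<in> {t. t \<in> nodes N \<and> root_label t = j}"
      by (auto simp: I_def wlists_def nodes_def trees_def)
  next
    fix t assume t: "t \<in> {t. t \<in> nodes N \<and> root_label t = j}"
    then obtain ts where ts: "t = Node j ts" by (cases t) (auto simp: nodes_def)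
    have p: "proper (Node j ts)" "nleaves (Node j ts) \<le> N" using t ts by (auto simp: nodes_def trees_def)
    have "u \<in> trees N" if "u \<in> set ts" for u
      using nleaves_child_less[OF p(1) that] p that by (auto simp: trees_def)
    moreover have "length ts \<le> N" using length_le_lv_Node[OF p(1)] p(2) by linarith
    ultimately have "(length ts, ts) \<in> I" using p by (auto simp: I_def wlists_def)
    then show "\<exists>p\<in>I. t = (case p of (k, ts) \<Rightarrow> Node j ts)" using ts by force
  qed (auto simp: I_def wlists_def)
  then have "(\<Sum>t | t \<in> nodes N \<and> root_label t = j. \<phi> t) = (\<Sum>p\<in>I. \<phi> (case p of (k, ts) \<Rightarrow> Node j ts))"
    by (rule sum.reindex_bij_betw[symmetric])
  also have "\<dots> = (\<Sum>k=2..N. \<Sum>ts | ts \<in> wlists (trees N) k \<and> sum_list (map nleaves ts) \<le> N. \<phi> (Node j ts))"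
    unfolding I_def by (simp add: sum.Sigma finite_wlists finite_trees case_prod_unfold)
  also have "\<dots> = (\<Sum>k=2..N. \<Sum>ts\<in>wlists (trees N) k. if sum_list (map nleaves ts) \<le> N then \<phi> (Node j ts) else 0)"
    by (intro sum.cong refl sum.inter_filter finite_wlists finite_trees)
  finally show ?thesis .
qed

lemma norm_monom_eval_le: "maxnorm w \<le> r \<Longrightarrow> cmod (monom_eval w xs) \<le> r ^ length xs"
proof (induction xs)
  case (Cons i xs)
  have "0 \<le> r" using Cons.prems maxnorm_nonneg[of w] by simp
  then show ?case using Cons cmod_le_maxnorm[of w i]
    by (auto simp: norm_mult intro!: mult_mono)
qed simp

text \<open>Telescoping over the letters. The extra factor r on the left avoids the exponent
  \<open>length xs - 1\<close>.\<close>

lemma norm_monom_eval_diff_le: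
  assumes "maxnorm w \<le> r" "maxnorm w' \<le> r"
  shows "r * cmod (monom_eval w xs - monom_eval w' xs) \<le> real (length xs) * r ^ length xs * maxnorm (w - w')"
proof (induction xs)
  case (Cons i xs)
  have r: "0 \<le> r" using assms(1) maxnorm_nonneg[of w] by simp
  have wi: "cmod (w $ i) \<le> r" using cmod_le_maxnorm[of w i] assms by simp
  have d: "cmod (w $ i - w' $ i) \<le> maxnorm (w - w')" using cmod_le_maxnorm[of "w - w'" i] by simp
  have "monom_eval w (i # xs) - monom_eval w' (i # xs) =
      w $ i * (monom_eval w xs - monom_eval w' xs) + (w $ i - w' $ i) * monom_eval w' xs"
    by (simp add: algebra_simps)
  then have "cmod (monom_eval w (i # xs) - monom_eval w' (i # xs)) \<le>
      cmod (w $ i) * cmod (monom_eval w xs - monom_eval w' xs) + cmod (w $ i - w' $ i) * cmod (monom_eval w' xs)"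
    by (metis norm_mult norm_triangle_ineq)
  also have "\<dots> \<le> r * cmod (monom_eval w xs - monom_eval w' xs) + maxnorm (w - w') * r ^ length xs"
    using wi d norm_monom_eval_le[OF assms(2), of xs] maxnorm_nonneg[of "w - w'"] r
    by (intro add_mono mult_mono) auto
  also have "\<dots> \<le> real (length xs) * r ^ length xs * maxnorm (w - w') + maxnorm (w - w') * r ^ length xs"
    using Cons by simp
  finally have "r * cmod (monom_eval w (i # xs) - monom_eval w' (i # xs)) \<le>
      r * (real (length xs) * r ^ length xs * maxnorm (w - w') + maxnorm (w - w') * r ^ length xs)"
    using r by (rule mult_left_mono)
  also have "\<dots> = real (length (i # xs)) * r ^ length (i # xs) * maxnorm (w - w')"
    by (simp add: algebra_simps)
  finally show ?case .
qed simp

text \<open>Below, \<open>D\<close> plays the role of \<open>N\<^sup>s\<close>. A factor \<open>1 / D\<close> is kept in the bound of each term, since the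
  polynomial must be close to the identity on the small polydisk of radius \<open>x / (C D)\<close>.\<close>

context
  fixes F :: "complex ^ 'n::finite \<Rightarrow> complex ^ 'n" and l :: "complex ^ 'n"
    and a :: "'n \<Rightarrow> 'n list \<Rightarrow> complex" and K M C D x :: real and N :: nat
  assumes unit: "\<And>i. cmod (l $ i) = 1" and nonres: "non_resonant l"
    and K: "K \<ge> 1" and M: "M \<ge> 2" and C: "C \<ge> 1" and D: "D \<ge> 1" and N: "N \<ge> 1"
    and a_le: "\<And>j w. cmod (a j w) \<le> K * M ^ length w"
    and expansion: "\<And>y j. M * maxnorm y \<le> 1 \<Longrightarrow>
      cmod (F y $ j - (l $ j * y $ j + (\<Sum>k=2..N. \<Sum>w\<in>wlists UNIV k. a j w * monom_eval y w)))
        \<le> K * (M * maxnorm y) ^ Suc N"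
    and cost: "\<And>t. t \<in> trees N \<Longrightarrow> exp (cost l t) * D \<le> (C * D) ^ nleaves t"
    and x_def: "x = 1 / (32 * real CARD('n) ^ 4 * K * M\<^sup>2 * C)"
begin

definition radius :: real where "radius = x / (C * D)"

definition lin_bound :: real where "lin_bound = 2 * real CARD('n) * x / D"

definition term_at :: "complex ^ 'n \<Rightarrow> 'n tree \<Rightarrow> complex" where
  "term_at w t = tcoef a l t * monom_eval w (leaves t)"

definition linearizer :: "complex ^ 'n \<Rightarrow> complex ^ 'n" where
  "linearizer w = (\<chi> j. \<Sum>t | t \<in> trees N \<and> root_label t = j. term_at w t)"

text \<open>Two equal shares \<open>K / 2 ^ N * (2 * (M * lin_bound)\<^sup>2)\<close>: one for the
  tuples with more than N leaves, one for the Taylor remainder.\<close>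

definition defect :: real where "defect = 4 * K * (M * lin_bound)\<^sup>2 / 2 ^ N"

lemma card_ge_1: "1 \<le> real CARD('n)"
  by (simp add: Suc_le_eq)

lemma x_pos: "0 < x"
  using card_ge_1 K M C unfolding x_def by (auto intro!: mult_pos_pos divide_pos_pos zero_less_power)

text \<open>The constant is tuned to \<open>linearizer_lipschitz\<close>, where it gives exactly
  \<open>1 / (2 * CARD('n))\<close>; the other smallness conditions on x are weaker.\<close>

lemma x_small: "32 * real CARD('n) ^ 4 * K * M\<^sup>2 * C * x = 1"
  using card_ge_1 K M C unfolding x_def by simp

lemma x_le:
  assumes "0 \<le> b" "b \<le> 32 * real CARD('n) ^ 4 * K * M\<^sup>2 * C"
  shows "b * x \<le> 1"
  using mult_right_mono[OF assms(2), of x] x_pos x_small by simp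

lemma x_conditions: "4 * real CARD('n) * M * x \<le> 1" "8 * (real CARD('n))\<^sup>2 * K * M\<^sup>2 * x \<le> 1"
proof -
  let ?n = "real CARD('n)"
  have n: "?n ^ 1 \<le> ?n ^ 4" "?n ^ 2 \<le> ?n ^ 4"
    by (rule power_increasing; use card_ge_1 in simp)+
  have MM: "M ^ 1 \<le> M ^ 2" by (rule power_increasing) (use M in auto)
  have 1: "4 * ?n * 1 * M * 1 \<le> 32 * ?n ^ 4 * K * M\<^sup>2 * C"
    using n MM K M C card_ge_1 by (intro mult_mono) auto
  have 2: "8 * ?n\<^sup>2 * K * M\<^sup>2 * 1 \<le> 32 * ?n ^ 4 * K * M\<^sup>2 * C"
    using n MM K M C card_ge_1 by (intro mult_mono) auto
  show "4 * ?n * M * x \<le> 1" using 1 M card_ge_1 by (intro x_le) auto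
  show "8 * ?n\<^sup>2 * K * M\<^sup>2 * x \<le> 1" using 2 K M card_ge_1 by (intro x_le) auto
qed

lemma radius_pos: "0 < radius"
  using x_pos C D unfolding radius_def by (auto intro!: mult_pos_pos)

lemma lin_bound_nonneg: "0 \<le> lin_bound"
  using x_pos D unfolding lin_bound_def by simp

lemma M_lin_bound_le: "M * lin_bound \<le> 1 / 2"
proof -
  have "M * lin_bound = (4 * real CARD('n) * M * x) / 2 / D" by (simp add: lin_bound_def)
  also have "\<dots> \<le> (4 * real CARD('n) * M * x) / 2 / 1"
    using D x_pos M by (intro divide_left_mono) auto
  finally show ?thesis using x_conditions(1) by (simp add: mult_ac)
qed

text \<open>The factors \<open>C * D\<close> granted per leaf by the cost bound cancel against the
  radius, leaving powers of x and the spare factor \<open>1 / D\<close>.\<close>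

lemma tcoef_radius_le:
  assumes "t \<in> trees N"
  shows "cmod (tcoef a l t) * radius ^ nleaves t \<le> tweight K M t * x ^ nleaves t / D"
proof -
  have "cmod (tcoef a l t) \<le> tweight K M t * exp (cost l t)"
    using tcoef_le[OF nonres _ _ a_le] K M assms by (auto simp: trees_def)
  also have "\<dots> \<le> tweight K M t * ((C * D) ^ nleaves t / D)"
    using cost[OF assms] D K M by (intro mult_left_mono tweight_nonneg) (auto simp: field_simps)
  finally have "cmod (tcoef a l t) * radius ^ nleaves t \<le> tweight K M t * ((C * D) ^ nleaves t / D) * radius ^ nleaves t"
    using radius_pos by (intro mult_right_mono) auto
  also have "\<dots> = tweight K M t * x ^ nleaves t / D"
    using C D by (simp add: radius_def power_divide)
  finally show ?thesis .
qed

lemma term_at_le: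
  assumes "t \<in> trees N" "maxnorm w \<le> radius / 2"
  shows "cmod (term_at w t) \<le> (1 / 2) ^ nleaves t * (tweight K M t * x ^ nleaves t / D)"
proof -
  have "cmod (term_at w t) \<le> cmod (tcoef a l t) * (radius / 2) ^ nleaves t"
    unfolding term_at_def norm_mult nleaves_def by (intro mult_left_mono norm_monom_eval_le assms) auto
  also have "\<dots> = (1 / 2) ^ nleaves t * (cmod (tcoef a l t) * radius ^ nleaves t)"
    by (simp add: power_divide)
  also have "\<dots> \<le> (1 / 2) ^ nleaves t * (tweight K M t * x ^ nleaves t / D)"
    by (intro mult_left_mono tcoef_radius_le assms) auto
  finally show ?thesis .
qed

lemma weight_nonneg: "0 \<le> tweight K M t * x ^ nleaves t / D"
  using K M D x_pos by (simp add: tweight_nonneg)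

lemma sum_weights_trees: "(\<Sum>t\<in>(trees N :: 'n tree set). tweight K M t * x ^ nleaves t / D) \<le> lin_bound"
proof -
  have "(\<Sum>t\<in>(trees N :: 'n tree set). tweight K M t * x ^ nleaves t) \<le> 2 * real CARD('n) * x"
    using K M x_pos x_conditions by (intro sum_tree_weights) auto
  then show ?thesis unfolding lin_bound_def sum_divide_distrib[symmetric] using D by (intro divide_right_mono) auto
qed

lemma maxnorm_linearizer_le:
  assumes "maxnorm w \<le> radius / 2"
  shows "maxnorm (linearizer w) \<le> lin_bound"
  unfolding maxnorm_le_iff
proof
  fix j
  have "cmod (linearizer w $ j) \<le> (\<Sum>t | t \<in> trees N \<and> root_label t = j. cmod (term_at w t))"
    by (simp add: linearizer_def norm_sum)
  also have "\<dots> \<le> (\<Sum>t | t \<in> trees N \<and> root_label t = j. tweight K M t * x ^ nleaves t / D)"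
  proof (rule sum_mono)
    fix t assume t: "t \<in> {t \<in> trees N. root_label t = j}"
    have "(1 / 2) ^ nleaves t * (tweight K M t * x ^ nleaves t / D) \<le> 1 * (tweight K M t * x ^ nleaves t / D)"
      by (intro mult_right_mono power_le_one weight_nonneg) auto
    then show "cmod (term_at w t) \<le> tweight K M t * x ^ nleaves t / D" using term_at_le[OF _ assms, of t] t by simp
  qed
  also have "\<dots> \<le> (\<Sum>t\<in>(trees N :: 'n tree set). tweight K M t * x ^ nleaves t / D)"
    by (rule sum_mono2[OF finite_trees _ weight_nonneg]) auto
  also have "\<dots> \<le> lin_bound" by (rule sum_weights_trees)
  finally show "cmod (linearizer w $ j) \<le> lin_bound" .
qed

lemma root_label_trees_split: "{t \<in> trees N. root_label t = j} = insert (Leaf j) {t. t \<in> nodes N \<and> root_label t = j}"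
  unfolding trees_split[OF N] by auto

lemma linearizer_eq: "linearizer w $ j = w $ j + (\<Sum>t | t \<in> nodes N \<and> root_label t = j. term_at w t)"
proof -
  have "Leaf j \<notin> {t. t \<in> nodes N \<and> root_label t = j}" by (simp add: nodes_def)
  then show ?thesis
    unfolding linearizer_def by (simp add: root_label_trees_split finite_nodes term_at_def)
qed

text \<open>The sum over inner nodes is quadratic in x and the radius is linear in it, so their
  ratio is small. The extra \<open>CARD('n)\<close> will pay for passing between the maximum norm
  and the Euclidean norm.\<close>

lemma linearizer_lipschitz:
  assumes "maxnorm w \<le> radius / 2" "maxnorm w' \<le> radius / 2"
  shows "maxnorm ((linearizer w - w) - (linearizer w' - w')) \<le> maxnorm (w - w') / (2 * real CARD('n))"
  unfolding maxnorm_le_iff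
proof
  fix j
  let ?n = "real CARD('n)"
  define \<delta> where "\<delta> = maxnorm (w - w')"
  have \<delta>: "0 \<le> \<delta>" by (simp add: \<delta>_def maxnorm_nonneg)
  have "((linearizer w - w) - (linearizer w' - w')) $ j = (\<Sum>t | t \<in> nodes N \<and> root_label t = j. term_at w t - term_at w' t)"
    by (simp add: linearizer_eq sum_subtractf)
  also have "cmod \<dots> \<le> (\<Sum>t | t \<in> nodes N \<and> root_label t = j. cmod (term_at w t - term_at w' t))"
    by (rule norm_sum)
  also have "\<dots> \<le> (\<Sum>t | t \<in> nodes N \<and> root_label t = j. 2 * \<delta> / radius * (tweight K M t * x ^ nleaves t / D))"
  proof (rule sum_mono)
    fix t :: "'n tree" assume "t \<in> {t. t \<in> nodes N \<and> root_label t = j}"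
    then have t: "t \<in> trees N" by (simp add: nodes_def)
    define m where "m = cmod (monom_eval w (leaves t) - monom_eval w' (leaves t))"
    have "radius / 2 * m \<le> real (nleaves t) * (radius / 2) ^ nleaves t * \<delta>"
      unfolding m_def \<delta>_def nleaves_def by (rule norm_monom_eval_diff_le[OF assms])
    \<comment> \<open>The factor \<open>nleaves t\<close> from differentiating is absorbed by
      halving the radius.\<close>
    also have "\<dots> \<le> 2 ^ nleaves t * (radius / 2) ^ nleaves t * \<delta>"
      using radius_pos \<delta> less_exp[of "nleaves t"] by (intro mult_right_mono) (auto simp: less_imp_le)
    also have "\<dots> = radius ^ nleaves t * \<delta>" by (simp add: power_divide)
    finally have m: "m \<le> 2 * \<delta> / radius * radius ^ nleaves t" using radius_pos by (simp add: field_simps)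
    have "cmod (term_at w t - term_at w' t) = cmod (tcoef a l t) * m"
      by (simp add: term_at_def m_def norm_mult[symmetric] algebra_simps)
    also have "\<dots> \<le> cmod (tcoef a l t) * (2 * \<delta> / radius * radius ^ nleaves t)"
      using m by (rule mult_left_mono) simp
    also have "\<dots> = 2 * \<delta> / radius * (cmod (tcoef a l t) * radius ^ nleaves t)" by simp
    also have "\<dots> \<le> 2 * \<delta> / radius * (tweight K M t * x ^ nleaves t / D)"
      using \<delta> radius_pos by (intro mult_left_mono tcoef_radius_le t) auto
    finally show "cmod (term_at w t - term_at w' t) \<le> 2 * \<delta> / radius * (tweight K M t * x ^ nleaves t / D)" .
  qed
  also have "\<dots> \<le> (\<Sum>t\<in>(nodes N :: 'n tree set). 2 * \<delta> / radius * (tweight K M t * x ^ nleaves t / D))"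
  proof (rule sum_mono2[OF finite_nodes])
    show "0 \<le> 2 * \<delta> / radius * (tweight K M t * x ^ nleaves t / D)" for t :: "'n tree"
      using \<delta> radius_pos by (intro mult_nonneg_nonneg weight_nonneg) auto
  qed auto
  also have "\<dots> = 2 * \<delta> / (radius * D) * (\<Sum>t\<in>(nodes N :: 'n tree set). tweight K M t * x ^ nleaves t)"
    by (simp add: sum_distrib_left)
  also have "\<dots> \<le> 2 * \<delta> / (radius * D) * (8 * ?n ^ 3 * K * M\<^sup>2 * x\<^sup>2)"
    using K M x_pos x_conditions \<delta> radius_pos D by (intro mult_left_mono sum_tree_weights) auto
  also have "\<dots> = \<delta> * (16 * ?n ^ 3 * K * M\<^sup>2 * C * x)"
    using x_pos C D by (simp add: radius_def power2_eq_square)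
  also have "16 * ?n ^ 3 * K * M\<^sup>2 * C * x = (32 * ?n ^ 4 * K * M\<^sup>2 * C * x) / (2 * ?n)"
    using card_ge_1 by (simp add: field_simps power_eq_if)
  also have "\<dots> = 1 / (2 * ?n)" unfolding x_small ..
  finally show "cmod (((linearizer w - w) - (linearizer w' - w')) $ j) \<le> maxnorm (w - w') / (2 * ?n)"
    by (simp add: \<delta>_def)
qed

section \<open>The conjugacy up to the defect\<close>

definition diag_act :: "complex ^ 'n \<Rightarrow> complex ^ 'n" where
  "diag_act w = (\<chi> j. l $ j * w $ j)"

lemma maxnorm_diag_act: "maxnorm (diag_act w) = maxnorm w"
  by (simp add: maxnorm_def diag_act_def norm_mult unit)

lemma monom_eval_diag_act: "monom_eval (diag_act w) xs = monom_eval l xs * monom_eval w xs"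
  by (induction xs) (auto simp: diag_act_def)

text \<open>The homological equation for one tree: composing with the linear part multiplies the
  term by a monomial in l, and the difference produces exactly the divisor in the denominator of
  \<open>tcoef\<close>.\<close>

lemma term_at_Node:
  assumes "Node j ts \<in> trees N"
  shows "term_at (diag_act w) (Node j ts) - l $ j * term_at w (Node j ts) =
    a j (map root_label ts) * prod_list (map (term_at w) ts)"
proof -
  have "0 < divisor l (Node j ts)"
    using assms by (intro divisor_pos nonres) (auto simp: trees_def)
  then have d: "monom_eval l (leaves (Node j ts)) - l $ j \<noteq> 0" by (simp add: divisor_def)
  have "term_at (diag_act w) (Node j ts) - l $ j * term_at w (Node j ts) =
      tcoef a l (Node j ts) * (monom_eval l (leaves (Node j ts)) - l $ j) * monom_eval w (leaves (Node j ts))"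
    unfolding term_at_def monom_eval_diag_act by (simp only: algebra_simps)
  also have "tcoef a l (Node j ts) * (monom_eval l (leaves (Node j ts)) - l $ j) =
      a j (map root_label ts) * prod_list (map (tcoef a l) ts)"
    using d by (simp del: leaves.simps)
  finally show ?thesis
    by (simp add: term_at_def[abs_def] prod_list_map_mult monom_eval_concat mult_ac)
qed

lemma linearizer_conjugates:
  assumes w: "maxnorm w \<le> radius / 2"
  shows "maxnorm (F (linearizer w) - linearizer (diag_act w)) \<le> defect"
  unfolding maxnorm_le_iff
proof
  fix j
  define y where "y = linearizer w"
  define W where "W = (\<Sum>t\<in>(trees N :: 'n tree set). tweight K M t * x ^ nleaves t / D)"
  have y: "maxnorm y \<le> lin_bound" unfolding y_def by (rule maxnorm_linearizer_le[OF w])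
  then have My: "M * maxnorm y \<le> M * lin_bound" using M by (intro mult_left_mono) auto
  define summand where "summand ts = a j (map root_label ts) * prod_list (map (term_at w) ts)" for ts
  define P where "P = (\<Sum>k=2..N. \<Sum>u\<in>wlists UNIV k. a j u * monom_eval y u)"
  have P: "P = (\<Sum>k=2..N. \<Sum>ts\<in>wlists (trees N) k. summand ts)"
  proof -
    have "monom_eval y u = prod_list (map (\<lambda>i. \<Sum>t | t \<in> trees N \<and> root_label t = i. term_at w t) u)" for u
      by (simp add: monom_eval_def y_def linearizer_def)
    then show ?thesis
      unfolding P_def summand_def by (simp only: sum_wlists_root_label[OF finite_trees])
  qed
  have "linearizer (diag_act w) $ j - l $ j * y $ j =
      (\<Sum>t | t \<in> nodes N \<and> root_label t = j. term_at (diag_act w) t - l $ j * term_at w t)"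
    by (simp add: y_def linearizer_eq diag_act_def sum_subtractf sum_distrib_left algebra_simps)
  also have "\<dots> = (\<Sum>k=2..N. \<Sum>ts\<in>wlists (trees N) k. if sum_list (map nleaves ts) \<le> N
      then term_at (diag_act w) (Node j ts) - l $ j * term_at w (Node j ts) else 0)"
    by (rule sum_nodes_root_label)
  also have "\<dots> = (\<Sum>k=2..N. \<Sum>ts\<in>wlists (trees N) k. if sum_list (map nleaves ts) \<le> N then summand ts else 0)"
  proof (intro sum.cong refl)
    fix k and ts :: "'n tree list" assume "k \<in> {2..N}" "ts \<in> wlists (trees N) k"
    then have "Node j ts \<in> trees N" if "sum_list (map nleaves ts) \<le> N"
      using that by (auto simp: wlists_def trees_def)
    from term_at_Node[OF this]
    show "(if sum_list (map nleaves ts) \<le> N then term_at (diag_act w) (Node j ts) - l $ j * term_at w (Node j ts) else 0)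
        = (if sum_list (map nleaves ts) \<le> N then summand ts else 0)"
      by (simp add: summand_def)
  qed
  finally have "l $ j * y $ j + P - linearizer (diag_act w) $ j =
      P - (\<Sum>k=2..N. \<Sum>ts\<in>wlists (trees N) k. if sum_list (map nleaves ts) \<le> N then summand ts else 0)"
    by (simp add: algebra_simps)
  also have "\<dots> = (\<Sum>k=2..N. \<Sum>ts\<in>wlists (trees N) k. if sum_list (map nleaves ts) \<le> N then 0 else summand ts)"
    unfolding P sum_subtractf[symmetric] by (intro sum.cong) auto
  \<comment> \<open>More than N leaves give the factor \<open>1 / 2 ^ N\<close>. The leaf condition
    is then dropped, so that the sum factors into powers.\<close>
  also have "cmod \<dots> \<le> (\<Sum>k=2..N. \<Sum>ts\<in>wlists (trees N :: 'n tree set) k.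
      K * M ^ k / 2 ^ N * prod_list (map (\<lambda>t. tweight K M t * x ^ nleaves t / D) ts))"
  proof (intro sum_norm_le)
    fix k and ts :: "'n tree list" assume ts: "k \<in> {2..N}" "ts \<in> wlists (trees N) k"
    define G where "G = prod_list (map (\<lambda>t. tweight K M t * x ^ nleaves t / D) ts)"
    have G: "0 \<le> G" unfolding G_def by (intro prod_list_map_nonneg weight_nonneg)
    show "cmod (if sum_list (map nleaves ts) \<le> N then 0 else summand ts) \<le> K * M ^ k / 2 ^ N * G"
    proof (cases "sum_list (map nleaves ts) \<le> N")
      case True
      then show ?thesis using G K M by simp
    next
      case False
      have "prod_list (map (\<lambda>t. cmod (term_at w t)) ts) \<le>
          prod_list (map (\<lambda>t. (1 / 2) ^ nleaves t * (tweight K M t * x ^ nleaves t / D)) ts)"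
        using ts term_at_le[OF _ w] by (intro prod_list_map_mono) (auto simp: wlists_def)
      also have "\<dots> = (1 / 2) ^ sum_list (map nleaves ts) * G"
        by (simp only: prod_list_map_mult prod_list_power G_def)
      also have "\<dots> \<le> (1 / 2) ^ N * G"
        using False G by (intro mult_right_mono power_decreasing) auto
      finally have "cmod (summand ts) \<le> (K * M ^ k) * ((1 / 2) ^ N * G)"
        using a_le[of j "map root_label ts"] ts K M G
        unfolding summand_def norm_mult norm_prod_list
        by (intro mult_mono) (auto simp: wlists_def intro!: prod_list_map_nonneg)
      then show ?thesis using False by (simp add: power_divide)
    qed
  qed
  also have "\<dots> = K / 2 ^ N * (\<Sum>k=2..N. (M * W) ^ k)"
    unfolding sum_distrib_left[symmetric] sum_wlists_prod[OF finite_trees] W_def[symmetric]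
    by (simp add: sum_distrib_left power_mult_distrib mult.assoc)
  also have "\<dots> \<le> K / 2 ^ N * (\<Sum>k=2..N. (M * lin_bound) ^ k)"
  proof (intro mult_left_mono sum_mono power_mono)
    show "W \<le> lin_bound" unfolding W_def by (rule sum_weights_trees)
    have "0 \<le> W" unfolding W_def by (intro sum_nonneg weight_nonneg)
    then show "0 \<le> M * W" using M by simp
  qed (use K M in auto)
  also have "\<dots> \<le> K / 2 ^ N * (2 * (M * lin_bound)\<^sup>2)"
    using K M lin_bound_nonneg M_lin_bound_le by (intro mult_left_mono sum_power_ge_2_le) auto
  finally have 1: "cmod (l $ j * y $ j + P - linearizer (diag_act w) $ j) \<le> K / 2 ^ N * (2 * (M * lin_bound)\<^sup>2)" .
  have "cmod (F y $ j - (l $ j * y $ j + P)) \<le> K * (M * maxnorm y) ^ Suc N"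
    unfolding P_def by (rule expansion) (use My M_lin_bound_le in simp)
  also have "\<dots> \<le> K * (M * lin_bound) ^ Suc N"
    using K M My maxnorm_nonneg[of y] by (intro mult_left_mono power_mono) auto
  \<comment> \<open>Two factors are kept to match the other share; the remaining N - 1, each at most
    1/2, give \<open>2 / 2 ^ N\<close>.\<close>
  also have "(M * lin_bound) ^ Suc N = (M * lin_bound)\<^sup>2 * (M * lin_bound) ^ (N - 1)"
    using N by (simp add: power_add[symmetric] flip: power_Suc)
  also have "K * \<dots> \<le> K * ((M * lin_bound)\<^sup>2 * (1 / 2) ^ (N - 1))"
    using K M lin_bound_nonneg M_lin_bound_le by (intro mult_left_mono power_mono) auto
  also have "\<dots> = K / 2 ^ N * (2 * (M * lin_bound)\<^sup>2)"
    using N by (cases N) (auto simp: power_divide)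
  finally have 2: "cmod (F y $ j - (l $ j * y $ j + P)) \<le> K / 2 ^ N * (2 * (M * lin_bound)\<^sup>2)" .
  have "cmod ((F (linearizer w) - linearizer (diag_act w)) $ j) \<le>
      cmod (F y $ j - (l $ j * y $ j + P)) + cmod (l $ j * y $ j + P - linearizer (diag_act w) $ j)"
    using norm_triangle_ineq[of "F y $ j - (l $ j * y $ j + P)" "l $ j * y $ j + P - linearizer (diag_act w) $ j"]
    by (simp add: y_def)
  also have "\<dots> \<le> defect" using 1 2 by (simp add: defect_def)
  finally show "cmod ((F (linearizer w) - linearizer (diag_act w)) $ j) \<le> defect" .
qed

text \<open>A displacement e of the image is realized by moving w' at most twice as far:
  \<open>f\<close> below is a contraction because the linearizer is the identity plus a map with
  small Lipschitz constant. In the maximum norm \<open>f\<close> moves w' by at most epsilon plus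
  half of 2 * epsilon, so the ball is preserved.\<close>

lemma linearizer_solve:
  assumes e: "maxnorm e \<le> \<epsilon>" and w': "maxnorm w' + 2 * \<epsilon> \<le> radius / 2"
  obtains w where "linearizer w = linearizer w' + e" "maxnorm (w - w') \<le> 2 * \<epsilon>"
proof -
  define S where "S = {w. maxnorm (w - w') \<le> 2 * \<epsilon>}"
  define f where "f w = w' + e - ((linearizer w - w) - (linearizer w' - w'))" for w
  have \<epsilon>: "0 \<le> \<epsilon>" using e maxnorm_nonneg[of e] by simp
  have small: "maxnorm w \<le> radius / 2" if "w \<in> S" for w
    using maxnorm_triangle[of "w - w'" w'] that w' by (simp add: S_def)
  have w'_small: "maxnorm w' \<le> radius / 2" using w' \<epsilon> by simp
  have half: "b / (2 * real CARD('n)) \<le> b / 2" if "0 \<le> b" for b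
    using card_ge_1 that by (intro divide_left_mono) auto
  have neg: "maxnorm (- u) = maxnorm u" for u :: "complex ^ 'n" by (simp add: maxnorm_def)
  have "\<exists>!w\<in>S. f w = w"
  proof (rule Banach_fix[where c = "1 / 2"])
    have "S = {w. \<forall>i. cmod (w $ i - w' $ i) \<le> 2 * \<epsilon>}" by (auto simp: S_def maxnorm_le_iff)
    also have "closed \<dots>"
      by (intro closed_Collect_all closed_Collect_le continuous_intros)
    finally show "complete S" by (simp add: complete_eq_closed)
    show "S \<noteq> {}" using \<epsilon> by (auto simp: S_def intro!: exI[of _ w'])
    show "f ` S \<subseteq> S"
    proof (intro image_subsetI)
      fix w assume w: "w \<in> S"
      have "f w - w' = e + - ((linearizer w - w) - (linearizer w' - w'))" by (simp add: f_def)
      also have "maxnorm \<dots> \<le> maxnorm e + maxnorm ((linearizer w - w) - (linearizer w' - w'))"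
        using maxnorm_triangle[of e "- ((linearizer w - w) - (linearizer w' - w'))"] unfolding neg .
      also have "maxnorm ((linearizer w - w) - (linearizer w' - w')) \<le> maxnorm (w - w') / 2"
        using linearizer_lipschitz[OF small[OF w] w'_small] half[OF maxnorm_nonneg] by (rule order_trans)
      finally show "f w \<in> S" using w e by (simp add: S_def)
    qed
    fix u v assume uv: "u \<in> S" "v \<in> S"
    have "f u - f v = - ((linearizer u - u) - (linearizer v - v))" by (simp add: f_def)
    then have "dist (f u) (f v) = norm ((linearizer u - u) - (linearizer v - v))"
      unfolding dist_norm by (simp only: norm_minus_cancel)
    also have "\<dots> \<le> real CARD('n) * maxnorm ((linearizer u - u) - (linearizer v - v))" by (rule norm_le_maxnorm)
    also have "\<dots> \<le> real CARD('n) * (maxnorm (u - v) / (2 * real CARD('n)))"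
      by (intro mult_left_mono linearizer_lipschitz small uv) auto
    also have "\<dots> = maxnorm (u - v) / 2" by simp
    also have "\<dots> \<le> norm (u - v) / 2" using maxnorm_le_norm[of "u - v"] by simp
    finally show "dist (f u) (f v) \<le> 1 / 2 * dist u v" by (simp add: dist_norm)
  qed auto
  then obtain w where w: "w \<in> S" "f w = w" by blast
  have "linearizer w = linearizer w' + e" using w(2) by (simp add: f_def algebra_simps)
  then show ?thesis using that w(1) by (simp add: S_def)
qed

section \<open>Orbits in the linearizing coordinate\<close>

lemma linearizer_0: "linearizer 0 = 0"
proof -
  have "monom_eval (0 :: complex ^ 'n) (leaves t) = 0" if "t \<in> trees N" for t :: "'n tree"
    using nleaves_ge_1[of t] that by (cases "leaves t") (auto simp: trees_def nleaves_def)
  then show ?thesis by (simp add: linearizer_def vec_eq_iff term_at_def)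
qed

text \<open>The budget is \<open>radius / 2\<close>: lifting the initial point uses
  \<open>radius / 4\<close>, and m steps, each drifting by at most \<open>2 * defect\<close>, use
  the other \<open>radius / 4\<close>. The linear part preserves the maximum norm.\<close>

lemma iterates_bounded:
  assumes z: "maxnorm z \<le> radius / 8" and m: "8 * real m * defect \<le> radius"
  shows "maxnorm ((F ^^ m) z) \<le> lin_bound"
proof -
  have defect: "0 \<le> defect" using K by (simp add: defect_def)
  have "\<exists>w. maxnorm w \<le> radius / 4 + 2 * real k * defect \<and> (F ^^ k) z = linearizer w" if "k \<le> m" for k
    using that
  proof (induction k)
    case 0
    obtain w where "linearizer w = linearizer 0 + z" "maxnorm (w - 0) \<le> 2 * (radius / 8)"
      using linearizer_solve[OF z, of 0] radius_pos by auto
    then show ?case by (auto simp: linearizer_0)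
  next
    case (Suc k)
    then obtain w where w: "maxnorm w \<le> radius / 4 + 2 * real k * defect" "(F ^^ k) z = linearizer w" by auto
    have "real (Suc k) * defect \<le> real m * defect" using Suc.prems defect by (intro mult_right_mono) auto
    then have sm: "maxnorm w + 2 * defect \<le> radius / 2" using w(1) m by (simp add: algebra_simps)
    obtain w' where w': "linearizer w' = linearizer (diag_act w) + (F (linearizer w) - linearizer (diag_act w))" "maxnorm (w' - diag_act w) \<le> 2 * defect"
      using linearizer_solve[OF linearizer_conjugates[of w], of "diag_act w"] sm defect by (auto simp: maxnorm_diag_act)
    have "maxnorm w' \<le> maxnorm (w' - diag_act w) + maxnorm (diag_act w)"
      using maxnorm_triangle[of "w' - diag_act w" "diag_act w"] by simp
    also have "\<dots> \<le> radius / 4 + 2 * real (Suc k) * defect"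
      using w' w by (simp add: maxnorm_diag_act algebra_simps)
    finally show ?case using w w' by auto
  qed
  then obtain w where w: "maxnorm w \<le> radius / 4 + 2 * real m * defect" "(F ^^ m) z = linearizer w" by blast
  then show ?thesis using m by (simp add: maxnorm_linearizer_le)
qed

text \<open>Estimating one factor \<open>M * lin_bound\<close> by 1/2 makes the defect linear in the
  radius, so D drops out of the condition on m.\<close>

lemma long_stability:
  assumes z: "maxnorm z \<le> x / (8 * C * D)" and m: "32 * real CARD('n) * K * M * C * real m \<le> 2 ^ N"
  shows "maxnorm ((F ^^ m) z) \<le> 1 / 4"
proof -
  have lin_bound_eq: "lin_bound = 2 * real CARD('n) * C * radius" using C by (simp add: lin_bound_def radius_def)
  have "(M * lin_bound)\<^sup>2 \<le> (M * lin_bound) * (1 / 2)"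
    unfolding power2_eq_square using M lin_bound_nonneg M_lin_bound_le by (intro mult_left_mono) auto
  also have "\<dots> = real CARD('n) * M * C * radius" by (simp add: lin_bound_eq)
  finally have "4 * K * (M * lin_bound)\<^sup>2 / 2 ^ N \<le> 4 * K * (real CARD('n) * M * C * radius) / 2 ^ N"
    using K by (intro divide_right_mono mult_left_mono) auto
  then have "8 * real m * defect \<le> 8 * real m * (4 * K * (real CARD('n) * M * C * radius) / 2 ^ N)"
    unfolding defect_def by (intro mult_left_mono) auto
  also have "\<dots> = (32 * real CARD('n) * K * M * C * real m) * (radius / 2 ^ N)" by simp
  also have "\<dots> \<le> 2 ^ N * (radius / 2 ^ N)" using m radius_pos by (intro mult_right_mono) auto
  finally have "8 * real m * defect \<le> radius" by simp
  then have "maxnorm ((F ^^ m) z) \<le> lin_bound" using z by (intro iterates_bounded) (simp_all add: radius_def mult_ac)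
  also have "2 * lin_bound \<le> M * lin_bound" using M lin_bound_nonneg by (intro mult_right_mono) auto
  then have "lin_bound \<le> 1 / 4" using M_lin_bound_le by simp
  finally show ?thesis .
qed

end

section \<open>Exponentially long stability\<close>

text \<open>For k <= N, replacing ln k by ln N in k - 1 of the k copies leaves one ln k <= k. The
  spare factor N^s thus costs only \<open>exp s\<close> per leaf.\<close>

lemma cost_bound_trees:
  fixes l :: "complex ^ 'n::finite"
  assumes s: "s > 0" and C0: "C0 \<ge> 0" and N: "N \<ge> 1" and t: "t \<in> trees N"
    and cost: "cost l t \<le> real (nleaves t) * (s * ln (real (nleaves t)) + C0)"
  shows "exp (cost l t) * (real N powr s) \<le> (exp (C0 + s) * real N powr s) ^ nleaves t"
proof -
  define k where "k = nleaves t"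
  have k: "1 \<le> k" "k \<le> N" using t nleaves_ge_1 by (auto simp: trees_def k_def)
  have "ln (real k) \<le> ln (real N)" using k by simp
  then have "real (k - 1) * ln (real k) \<le> real (k - 1) * ln (real N)" by (intro mult_left_mono) auto
  moreover have "ln (real k) \<le> real k" using ln_le_minus_one[of "real k"] k by simp
  ultimately have "real k * ln (real k) + ln (real N) \<le> real k + real k * ln (real N)"
    using k by (simp add: of_nat_diff algebra_simps)
  then have "s * (real k * ln (real k) + ln (real N)) \<le> s * (real k + real k * ln (real N))"
    using s by (intro mult_left_mono) auto
  then have "cost l t + s * ln (real N) \<le> real k * (C0 + s + s * ln (real N))"
    using cost by (simp add: k_def[symmetric] algebra_simps)
  then have "exp (cost l t + s * ln (real N)) \<le> exp (real k * (C0 + s + s * ln (real N)))" by simp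
  also have "\<dots> = (exp (C0 + s) * real N powr s) ^ k"
    using N by (simp add: exp_of_nat_mult exp_add powr_def)
  finally show ?thesis using N by (simp add: exp_add powr_def k_def)
qed

theorem theorem1p2:
  fixes l :: "complex ^ 'n::finite"
    and F f :: "complex ^ 'n \<Rightarrow> complex ^ 'n"
    and s :: real
  assumes unit_modulus: "\<And>i. cmod (l $ i) = 1"
    and F_analytic: "mv_analytic_on F unit_polydisk"
    and F_univalent: "inj_on F unit_polydisk"
    and F_eq: "\<And>z. z \<in> unit_polydisk \<Longrightarrow> F z = diag_matrix l *v z + f z"
    and f_zero: "f 0 = 0"
    and Df_zero: "(f has_derivative (\<lambda>_. 0)) (at 0)"
    and s_pos: "s > 0"
    and nonres: "non_resonant l"
    and bruno: "bruno_cond s l \<or> (CARD('n) = 1 \<and> (\<forall>i. bruno_cond_1d s (l $ i)))"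
  shows "\<exists>r0. 0 < r0 \<and> r0 < 1 \<and>
    (\<forall>r. 0 < r \<and> r < r0 \<longrightarrow>
      (\<exists>A B C :: real. A > 0 \<and> B > 0 \<and> C > 0 \<and>
        (\<forall>z0 :: complex ^ 'n. 0 < maxnorm z0 \<and> maxnorm z0 < r / 2 \<longrightarrow>
          (\<forall>m :: nat. int m \<le> \<lfloor>inverse A * exp (B * (r / maxnorm z0) powr (1 / s))\<rfloor> \<longrightarrow>
             (\<forall>k<m. (F ^^ k) z0 \<in> unit_polydisk) \<and>
             maxnorm ((F ^^ m) z0) \<le> C * r))))"
proof -
  obtain C1 where "\<forall>t. proper t \<longrightarrow> cost l t \<le> real (nleaves t) * (s * ln (real (nleaves t)) + C1)"
    using bruno cost_bruno[OF unit_modulus nonres] cost_bruno_1d[where 'n = 'n] by metis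
  then have C1: "cost l t \<le> real (nleaves t) * (s * ln (real (nleaves t)) + max C1 0)" if "proper t" for t
    using that by (meson add_left_mono max.cobounded1 mult_left_mono of_nat_0_le_iff order_trans)
  obtain K M a where K: "K \<ge> 1" and M: "M \<ge> 2" and a: "\<And>j w. cmod (a j w) \<le> K * M ^ length w"
    and ex: "\<And>y j N. M * maxnorm y \<le> 1 \<Longrightarrow> 1 \<le> N \<Longrightarrow>
      cmod (F y $ j - (l $ j * y $ j + (\<Sum>k=2..N. \<Sum>w\<in>wlists UNIV k. a j w * monom_eval y w)))
        \<le> K * (M * maxnorm y) ^ Suc N"
    using word_expansion[OF F_analytic F_eq f_zero Df_zero] by blast
  define C where "C = exp (max C1 0 + s)"
  have C: "C \<ge> 1" using s_pos by (simp add: C_def)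
  define x where "x = 1 / (32 * real CARD('n) ^ 4 * K * M\<^sup>2 * C)"
  have x: "x > 0" using K M C by (auto simp: x_def intro!: divide_pos_pos mult_pos_pos)
  define E where "E = 32 * real CARD('n) * K * M * C"
  have E: "E > 0" using K M C by (auto simp: E_def intro!: mult_pos_pos)
  define G where "G = x / (8 * C)"
  have G: "G > 0" using x C by (simp add: G_def)
  \<comment> \<open>The part \<open>2 * E\<close> absorbs rounding the exponent Y below down to an
    integer; the summand 2 leaves only m = 0 when Y < 1, where no order N is available.\<close>
  define A where "A = 2 * E + 2"
  have A: "A > 0" using E by (simp add: A_def)
  have stable: "maxnorm ((F ^^ m) z) \<le> 1 / 4"
    if N: "1 \<le> N" and z: "maxnorm z \<le> G / real N powr s" and m: "E * real m \<le> 2 ^ N" for N m z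
  proof (rule long_stability[OF unit_modulus nonres K M C _ N a ex[OF _ N] _ x_def])
    show "1 \<le> real N powr s" using N s_pos by (simp add: ge_one_powr_ge_zero)
    show "exp (cost l t) * (real N powr s) \<le> (C * real N powr s) ^ nleaves t" if "t \<in> trees N" for t
      unfolding C_def using that by (intro cost_bound_trees s_pos N C1) (auto simp: trees_def)
  qed (use z m in \<open>simp_all add: G_def E_def\<close>)
  show ?thesis
  proof (rule exI[of _ "1 / 2"], intro conjI allI impI)
    fix r :: real assume r: "0 < r \<and> r < 1 / 2"
    \<comment> \<open>This turns the exponential into \<open>2 powr Y\<close>, with Y free of r.
      Likewise the constant \<open>1 / r\<close> will turn the bound into 1.\<close>
    define B where "B = ln 2 * (G / r) powr (1 / s)"
    have B: "B > 0" unfolding B_def using G r by simp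
    have "(\<forall>k<m. (F ^^ k) z \<in> unit_polydisk) \<and> maxnorm ((F ^^ m) z) \<le> 1 / r * r"
      if z: "0 < maxnorm z \<and> maxnorm z < r / 2"
        and m: "int m \<le> \<lfloor>inverse A * exp (B * (r / maxnorm z) powr (1 / s))\<rfloor>" for z :: "complex ^ 'n" and m
    proof -
      define Y where "Y = (G / maxnorm z) powr (1 / s)"
      have "(G / r) powr (1 / s) * (r / maxnorm z) powr (1 / s) = Y"
        using G r z by (simp add: Y_def powr_mult[symmetric])
      then have "exp (B * (r / maxnorm z) powr (1 / s)) = 2 powr Y"
        by (simp add: B_def powr_def mult_ac)
      then have "real m \<le> inverse A * 2 powr Y" using m by (simp add: le_floor_iff)
      then have Am: "A * real m \<le> 2 powr Y" using A by (simp add: field_simps)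
      show ?thesis
      proof (cases "Y < 1")
        case True
        then have "2 powr Y < 2 powr 1" by (intro powr_less_mono) auto
        then have "A * real m < 2" using Am by simp
        moreover have "2 * real m \<le> A * real m" using E by (intro mult_right_mono) (auto simp: A_def)
        ultimately have "m = 0" by simp
        then show ?thesis using z r by simp
      next
        case False
        \<comment> \<open>The largest order whose polydisk of radius \<open>G / N powr s\<close>
          still contains z.\<close>
        define N where "N = nat \<lfloor>Y\<rfloor>"
        have fl: "1 \<le> \<lfloor>Y\<rfloor>" using False by (simp add: le_floor_iff)
        then have N: "1 \<le> N" "real N \<le> Y" "Y < real N + 1"
          unfolding N_def by (simp_all add: le_nat_iff)
        have "real N powr s \<le> Y powr s" using N s_pos by (intro powr_mono2) auto
        also have "\<dots> = G / maxnorm z" using s_pos G z by (simp add: Y_def powr_powr)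
        finally have zN: "maxnorm z \<le> G / real N powr s"
          using z N by (simp add: field_simps)
        have "2 powr Y \<le> 2 powr (real N + 1)" using N by (intro powr_mono) auto
        also have "\<dots> = 2 * 2 ^ N" by (simp add: powr_add powr_realpow)
        finally have "A * real m \<le> 2 * 2 ^ N" using Am by simp
        moreover have "2 * (E * real m) \<le> A * real m" by (simp add: A_def algebra_simps)
        ultimately have Em: "E * real m \<le> 2 ^ N" by simp
        have bound: "maxnorm ((F ^^ k) z) \<le> 1 / 4" if "k \<le> m" for k
        proof (rule stable[OF N(1) zN])
          have "E * real k \<le> E * real m" using that E by (intro mult_left_mono) auto
          then show "E * real k \<le> 2 ^ N" using Em by simp
        qed
        have "(F ^^ k) z \<in> unit_polydisk" if "k < m" for k
          unfolding unit_polydisk_def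
        proof safe
          fix i
          have "cmod ((F ^^ k) z $ i) \<le> 1 / 4" 
            using cmod_le_maxnorm bound[OF less_imp_le[OF that]] by (rule order_trans)
          then show "cmod ((F ^^ k) z $ i) < 1" by simp
        qed
        then show ?thesis using bound[of m] r by simp
      qed
    qed
    then show "\<exists>A B C. 0 < A \<and> 0 < B \<and> 0 < C \<and>
        (\<forall>z0 :: complex ^ 'n. 0 < maxnorm z0 \<and> maxnorm z0 < r / 2 \<longrightarrow>
          (\<forall>m. int m \<le> \<lfloor>inverse A * exp (B * (r / maxnorm z0) powr (1 / s))\<rfloor> \<longrightarrow>
             (\<forall>k<m. (F ^^ k) z0 \<in> unit_polydisk) \<and> maxnorm ((F ^^ m) z0) \<le> C * r))"
      using A B r by (intro exI[of _ A] exI[of _ B] exI[of _ "1 / r"]) auto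
  qed auto
qed

end
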